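(* For a parameter $t>0$, let $(X_{j,k})_{j,k\ge1}$ be independent random variables with $\mathbb{P}_t(X_{j,k}=m)=(1-e^{-jk(j+k)t/2})e^{-jk(j+k)mt/2}$ for $m=0,1,2,\ldots$, and let $N=\sum_{j,k\ge1}\tfrac12jk(j+k)X_{j,k}$ (almost surely finite). Let $$X=\left(\tfrac19\Gamma\!\left(\tfrac13\right)^2\zeta\!\left(\tfrac53\right)\right)^{3/10},\quad Y=-\sqrt\pi\,\zeta\!\left(\tfrac12\right)\zeta\!\left(\tfrac32\right),$$ $\tau_1=2X^2$, $\tau_2=\tfrac{3}{10}X^{-1}Y$, $\tau_3=\tfrac{3}{400}X^{-4}Y^2$, and $t_n=\tau_1n^{-3/5}-\tau_2n^{-7/10}-\tau_3n^{-4/5}$ for $n\ge1$. Then as $n\to\infty$, $$\mathbb{P}_{t_n}(N=n)=\frac{1+o(1)}{\sqrt{2\pi\operatorname{Var}_{t_n}(N)}}=(1+o(1))\frac{\sqrt3\,X}{\sqrt{5\pi}}\,n^{-4/5}.$$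
   Context: $\mathbb{P}_t$, $\mathbb{E}_t$, $\operatorname{Var}_t$ denote probability, expectation and variance in the model with parameter $t$. $\Gamma$ is the gamma function and $\zeta$ the Riemann zeta function. *)

theory Defs
  imports
    "HOL-Complex_Analysis.Complex_Analysis"
    "HOL-Probability.Probability"
    "HOL-Library.Landau_Symbols"
begin

section \<open>The Riemann zeta function\<close>

text \<open>
  The meromorphic continuation of the Dirichlet series to the punctured plane. Existence and
  uniqueness are proved below (\<open>is_zeta_riemann_zeta\<close>, \<open>is_zeta_unique\<close>); the value at the pole
  \<open>1\<close> is unspecified.
\<close>

definition is_zeta :: "(complex \<Rightarrow> complex) \<Rightarrow> bool" where
  "is_zeta f \<longleftrightarrow> f holomorphic_on (- {1}) \<and>
     (\<forall>s. Re s > 1 \<longrightarrow> (\<lambda>n. of_nat (Suc n) powr (- s)) sums f s)"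

definition riemann_zeta :: "complex \<Rightarrow> complex" where
  "riemann_zeta = (SOME f. is_zeta f)"

lemma is_zeta_unique:
  assumes "is_zeta f" "is_zeta g" "s \<noteq> 1"
  shows "f s = g s"
proof (rule analytic_continuation_open[of "{s. Re s > 1}" "- {1}" f g])
  show "open {s. 1 < Re s}" by (rule open_halfspace_Re_gt)
  show "connected (- {1::complex})" by (rule connected_punctured_universe) simp
  have "(2::complex) \<in> {s. 1 < Re s}" by simp
  then show "{s. 1 < Re s} \<noteq> {}" by blast
qed (use assms in \<open>auto simp: is_zeta_def dest: sums_unique2\<close>)

lemma holomorphic_on_suminf_halfplane:
  fixes f :: "nat \<Rightarrow> complex \<Rightarrow> complex"
  assumes hol: "\<And>n. f n holomorphic_on {s. Re s > a}"
    and bd: "\<And>c r. c > a \<Longrightarrow> \<exists>B. summable B \<and>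
                  (\<forall>n y. Re y \<ge> c \<and> norm y \<le> r \<longrightarrow> norm (f n y) \<le> B n)"
  shows "(\<lambda>s. \<Sum>n. f n s) holomorphic_on {s. Re s > a}"
proof (rule holomorphic_uniform_sequence[of _ "\<lambda>n s. \<Sum>i<n. f i s"])
  show "open {s. Re s > a}" by (rule open_halfspace_Re_gt)
  show "(\<lambda>s. \<Sum>i<n. f i s) holomorphic_on {s. Re s > a}" for n
    by (intro holomorphic_intros hol)
  fix x assume x: "x \<in> {s. Re s > a}"
  define d where "d = (Re x - a) / 2"
  have d: "d > 0" "Re x - d > a" using x by (auto simp: d_def field_simps)
  from bd[OF d(2), of "norm x + d"] obtain B where B: "summable B"
    "\<And>n y. Re y \<ge> Re x - d \<Longrightarrow> norm y \<le> norm x + d \<Longrightarrow> norm (f n y) \<le> B n" by blast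
  have y: "Re y \<ge> Re x - d" "norm y \<le> norm x + d" if "y \<in> cball x d" for y
  proof -
    have "norm (x - y) \<le> d" using that by (simp add: dist_norm)
    then show "Re y \<ge> Re x - d" "norm y \<le> norm x + d"
      using abs_Re_le_cmod[of "x - y"] norm_triangle_ineq4[of x "x - y"] by auto
  qed
  have "uniform_limit (cball x d) (\<lambda>n s. \<Sum>i<n. f i s) (\<lambda>s. \<Sum>i. f i s) sequentially"
    using B y by (intro Weierstrass_m_test[of _ _ B]) auto
  moreover have "cball x d \<subseteq> {s. Re s > a}" using y d by force
  ultimately show "\<exists>d>0. cball x d \<subseteq> {s. Re s > a} \<and>
      uniform_limit (cball x d) (\<lambda>n s. \<Sum>i<n. f i s) (\<lambda>s. \<Sum>i. f i s) sequentially"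
    using d by blast
qed

lemma norm_gbinomial_le:
  fixes a :: complex
  assumes "norm a \<le> A"
  shows "norm (a gchoose k) \<le> pochhammer A k / fact k"
proof -
  have "norm (\<Prod>i=0..<k. a - of_nat i) \<le> (\<Prod>i=0..<k. A + real i)"
  proof -
    have "norm (a - of_nat i) \<le> A + real i" for i
      using assms norm_triangle_ineq4[of a "of_nat i"] by simp
    then show ?thesis
      by (simp add: prod_norm[symmetric] prod_mono)
  qed
  then show ?thesis
    by (simp add: gbinomial_prod_rev norm_divide pochhammer_prod divide_right_mono)
qed

lemma binomial_series_tail:
  fixes a :: complex and x :: real
  assumes a: "norm a \<le> A" and x: "0 \<le> x" "x \<le> 1 / 2"
  shows "norm ((1 - of_real x) powr a - (\<Sum>k<m. (a gchoose k) * (- of_real x) ^ k))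
           \<le> (2 * x) ^ m * (\<Sum>k. pochhammer A k / fact k * (1 / 2) ^ k)"
proof -
  let ?b = "\<lambda>k. pochhammer A k / fact k * (1 / 2) ^ k"
  have A: "A \<ge> 0" using a norm_ge_zero order_trans by blast
  have p0: "pochhammer A k \<ge> 0" for k using A by (simp add: pochhammer_prod prod_nonneg)
  have b0: "?b k \<ge> 0" for k using p0 by simp
  have "(\<lambda>k. ((- A) gchoose k) * (- (1 / 2)) ^ k) sums (1 + (- (1 / 2))) powr (- A)"
    by (rule gen_binomial_real) simp
  also have "(\<lambda>k. ((- A) gchoose k) * (- (1 / 2)) ^ k) = ?b"
  proof (rule ext)
    fix k
    have "(-1) ^ k * (-1 :: real) ^ k = 1" by (simp flip: power_mult_distrib)
    moreover have "(- (1 / 2) :: real) ^ k = (-1) ^ k * (1 / 2) ^ k"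
      by (rule power_minus)
    ultimately show "((- A) gchoose k) * (- (1 / 2)) ^ k = ?b k"
      by (simp add: gbinomial_pochhammer mult_ac)
  qed
  finally have sb: "summable ?b" by (rule sums_summable)
  let ?t = "\<lambda>k. (a gchoose k) * (- of_real x) ^ k"
  have "?t sums (1 + (- of_real x)) powr a"
    using x by (intro gen_binomial_complex) simp
  then have "?t sums (1 - of_real x) powr a" by simp
  then have tail: "(\<lambda>k. ?t (k + m)) sums ((1 - of_real x) powr a - (\<Sum>k<m. ?t k))"
    by (rule sums_split_initial_segment)
  have le: "norm (?t (k + m)) \<le> (2 * x) ^ m * ?b (k + m)" for k
  proof -
    have "norm (?t (k + m)) \<le> pochhammer A (k + m) / fact (k + m) * x ^ (k + m)"
      unfolding norm_mult norm_power
      using x by (intro mult_mono norm_gbinomial_le[OF a] p0 divide_nonneg_nonneg) auto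
    also have "x ^ (k + m) \<le> (2 * x) ^ m * (1 / 2) ^ (k + m)"
    proof -
      have "x ^ k \<le> (1 / 2) ^ k" using x by (intro power_mono) auto
      then have "x ^ k * x ^ m \<le> (1 / 2) ^ k * x ^ m"
        using x by (intro mult_right_mono) auto
      also have "\<dots> = (2 * x) ^ m * (1 / 2) ^ (k + m)"
        by (simp add: power_add power_mult_distrib field_simps)
      finally show ?thesis by (simp add: power_add)
    qed
    then have "pochhammer A (k + m) / fact (k + m) * x ^ (k + m) \<le>
        pochhammer A (k + m) / fact (k + m) * ((2 * x) ^ m * (1 / 2) ^ (k + m))"
      using p0 by (intro mult_left_mono) auto
    finally show ?thesis by (simp add: mult_ac)
  qed
  have sb': "summable (\<lambda>k. (2 * x) ^ m * ?b (k + m))"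
    by (intro summable_mult summable_ignore_initial_segment sb)
  have "norm ((1 - of_real x) powr a - (\<Sum>k<m. ?t k)) = norm (\<Sum>k. ?t (k + m))"
    using tail by (simp add: sums_iff)
  also have "\<dots> \<le> (\<Sum>k. (2 * x) ^ m * ?b (k + m))"
    by (rule norm_suminf_le[OF le sb'])
  also have "\<dots> = (2 * x) ^ m * (\<Sum>k. ?b (k + m))"
    by (intro suminf_mult summable_ignore_initial_segment sb)
  also have "\<dots> \<le> (2 * x) ^ m * (\<Sum>k. ?b k)"
  proof (rule mult_left_mono)
    show "(\<Sum>k. ?b (k + m)) \<le> (\<Sum>k. ?b k)"
      using suminf_split_initial_segment[OF sb, of m] sum_nonneg[of "{..<m}" ?b] b0 by simp
  qed (use x in simp)
  finally show ?thesis .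
qed

lemma summable_shifted_powr:
  assumes "a < -1"
  shows "summable (\<lambda>n. real (n + 2) powr a)"
proof -
  have "summable (\<lambda>n. real n powr a)" using assms by (simp add: summable_real_powr_iff)
  then show ?thesis by (rule summable_ignore_initial_segment)
qed

text \<open>
  The continuation is obtained from the recursion resulting from summing the binomial expansion
  of \<open>(n - 1) powr (1 - s) - n powr (1 - s)\<close> over \<open>n \<ge> 2\<close>. Below, \<open>zeta_tail s\<close> is \<open>\<zeta>(s) - 1\<close> for
  \<open>Re s > 1\<close>.
\<close>

definition zeta_tail :: "complex \<Rightarrow> complex" where
  "zeta_tail s = (\<Sum>n. of_nat (n + 2) powr (- s))"

definition zeta_rem_term :: "nat \<Rightarrow> nat \<Rightarrow> complex \<Rightarrow> complex" where
  "zeta_rem_term m n s = of_nat (n + 1) powr (1 - s) -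
     (\<Sum>k<m. ((1 - s) gchoose k) * (-1) ^ k * of_nat (n + 2) powr (1 - s - of_nat k))"

lemma norm_of_nat_powr: "n > 0 \<Longrightarrow> norm (of_nat n powr s :: complex) = real n powr Re s"
  using norm_powr_real_powr[of "of_nat n" s] by simp

lemma zeta_tail_sums:
  assumes "Re s > 1"
  shows "(\<lambda>n. of_nat (n + 2) powr (- s)) sums zeta_tail s"
proof -
  have "summable (\<lambda>n. norm (of_nat (n + 2) powr (- s) :: complex))"
  proof -
    have "norm (of_nat (n + 2) powr (- s) :: complex) = real (n + 2) powr (- Re s)" for n
      using norm_of_nat_powr[of "n + 2" "- s"] by (simp del: of_nat_add)
    then show ?thesis using assms by (simp only:) (rule summable_shifted_powr, simp)
  qed
  then show ?thesis unfolding zeta_tail_def by (rule summable_sums[OF summable_norm_cancel])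
qed

lemma holomorphic_zeta_tail: "zeta_tail holomorphic_on {s. Re s > 1}"
  unfolding zeta_tail_def[abs_def]
proof (rule holomorphic_on_suminf_halfplane)
  show "(\<lambda>s. of_nat (n + 2) powr (- s)) holomorphic_on {s. Re s > 1}" for n
    by (intro holomorphic_intros)
  fix c r :: real assume c: "c > 1"
  have "norm (of_nat (n + 2) powr (- y) :: complex) \<le> real (n + 2) powr (- c)"
    if "Re y \<ge> c" for n y
    using that norm_of_nat_powr[of "n + 2" "- y"] by (auto intro!: powr_mono simp del: of_nat_add)
  with c summable_shifted_powr[of "- c"]
  show "\<exists>B. summable B \<and> (\<forall>n y. c \<le> Re y \<and> norm y \<le> r \<longrightarrow>
      norm (of_nat (n + 2) powr (- y) :: complex) \<le> B n)"
    by (intro exI[of _ "\<lambda>n. real (n + 2) powr (- c)"]) auto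
qed

lemma norm_zeta_rem_term_le:
  assumes "norm (1 - s) \<le> A"
  shows "norm (zeta_rem_term m n s) \<le> real (n + 2) powr (1 - Re s - real m) *
           (2 ^ m * (\<Sum>k. pochhammer A k / fact k * (1 / 2) ^ k))"
proof -
  define N where "N = real (n + 2)"
  define x where "x = 1 / N"
  have N: "N \<ge> 2" "N > 0" by (simp_all add: N_def)
  have x: "0 \<le> x" "x \<le> 1 / 2" using N by (auto simp: x_def field_simps)
  let ?S = "\<Sum>k. pochhammer A k / fact k * (1 / 2) ^ k"
  have *: "zeta_rem_term m n s = of_real N powr (1 - s) *
      ((1 - of_real x) powr (1 - s) - (\<Sum>k<m. ((1 - s) gchoose k) * (- of_real x) ^ k))"
  proof -
    have 1: "of_nat (n + 1) powr (1 - s) = of_real N powr (1 - s) * (1 - of_real x) powr (1 - s)"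
    proof -
      have "of_real N powr (1 - s) * of_real (1 - x) powr (1 - s) = of_real (N * (1 - x)) powr (1 - s)"
        using N x by (simp add: powr_times_real del: of_real_diff)
      also have "N * (1 - x) = real (n + 1)" using N by (simp add: x_def N_def field_simps)
      finally show ?thesis by simp
    qed
    have 2: "of_nat (n + 2) powr (1 - s - of_nat k) * (-1) ^ k =
        of_real N powr (1 - s) * (- of_real x) ^ k" for k
    proof -
      have "of_nat (n + 2) powr (1 - s - of_nat k) = of_real N powr (1 - s) / of_real N ^ k"
      proof -
        have "of_nat (n + 2) = complex_of_real N" by (simp add: N_def)
        moreover have "complex_of_real N powr of_nat k = of_real N ^ k"
          using N by (subst powr_nat') auto
        ultimately show ?thesis by (simp only: powr_diff)
      qed
      then show ?thesis
        by (simp add: x_def power_divide power_minus[of "1 / of_real N"] field_simps)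
    qed
    show ?thesis
      unfolding zeta_rem_term_def 1 right_diff_distrib sum_distrib_left
      using 2 by (intro arg_cong2[of _ _ _ _ "(-)"] sum.cong refl) (simp add: mult_ac)
  qed
  have "norm (zeta_rem_term m n s) \<le> N powr (1 - Re s) * ((2 * x) ^ m * ?S)"
    unfolding * norm_mult
  proof (intro mult_mono binomial_series_tail assms x)
    show "norm (of_real N powr (1 - s)) \<le> N powr (1 - Re s)"
      using N by (subst norm_powr_real_powr) auto
  qed auto
  also have "\<dots> = N powr (1 - Re s - real m) * (2 ^ m * ?S)"
  proof -
    have "N powr (1 - Re s) * (2 * x) ^ m = N powr (1 - Re s - real m) * 2 ^ m"
      using N by (simp add: x_def powr_diff powr_realpow power_divide)
    then show ?thesis by (simp only: mult.assoc[symmetric])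
  qed
  finally show ?thesis unfolding N_def .
qed

lemma holomorphic_zeta_rem:
  "(\<lambda>s. \<Sum>n. zeta_rem_term m n s) holomorphic_on {s. Re s > 2 - real m}"
proof (rule holomorphic_on_suminf_halfplane)
  show "(\<lambda>s. zeta_rem_term m n s) holomorphic_on {s. Re s > 2 - real m}" for n
    unfolding zeta_rem_term_def gbinomial_prod_rev
    by (intro holomorphic_intros) (simp_all del: of_nat_add)
  fix c r :: real assume c: "c > 2 - real m"
  define C where "C = 2 ^ m * (\<Sum>k. pochhammer (1 + \<bar>r\<bar>) k / fact k * (1 / 2) ^ k)"
  have "norm (zeta_rem_term m n y) \<le> real (n + 2) powr (1 - c - real m) * \<bar>C\<bar>"
    if y: "Re y \<ge> c" "norm y \<le> r" for n y
  proof -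
    have "norm (1 - y) \<le> 1 + \<bar>r\<bar>" using norm_triangle_ineq4[of 1 y] y by simp
    from norm_zeta_rem_term_le[OF this, of m n]
    have "norm (zeta_rem_term m n y) \<le> real (n + 2) powr (1 - Re y - real m) * C"
      by (simp add: C_def)
    also have "\<dots> \<le> real (n + 2) powr (1 - Re y - real m) * \<bar>C\<bar>"
      by (intro mult_left_mono) auto
    also have "\<dots> \<le> real (n + 2) powr (1 - c - real m) * \<bar>C\<bar>"
      using y by (intro mult_right_mono powr_mono) auto
    finally show ?thesis .
  qed
  with c show "\<exists>B. summable B \<and>
      (\<forall>n y. c \<le> Re y \<and> norm y \<le> r \<longrightarrow> norm (zeta_rem_term m n y) \<le> B n)"
    by (intro exI[of _ "\<lambda>n. real (n + 2) powr (1 - c - real m) * \<bar>C\<bar>"] conjI summable_mult2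
        summable_shifted_powr) auto
qed

lemma zeta_rem_eq:
  assumes s: "Re s > 1"
  shows "(\<Sum>n. zeta_rem_term (m + 2) n s) = 1 - (s - 1) * zeta_tail s -
    (\<Sum>k<m. ((1 - s) gchoose (k + 2)) * (-1) ^ k * zeta_tail (s + of_nat (k + 1)))"
proof -
  let ?h = "\<lambda>n. of_nat (n + 1) powr (1 - s) - of_nat (n + 2) powr (1 - s) :: complex"
  have "(\<lambda>n. of_nat (n + 1) powr (1 - s) :: complex) \<longlonglongrightarrow> 0"
  proof (rule tendsto_norm_zero_cancel)
    have "((\<lambda>n. real n powr (1 - Re s)) \<longlongrightarrow> 0) sequentially"
      using s by real_asymp
    then have "(\<lambda>n. real (n + 1) powr (1 - Re s)) \<longlonglongrightarrow> 0"
      by (rule LIMSEQ_ignore_initial_segment)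
    moreover have "norm (of_nat (n + 1) powr (1 - s) :: complex) = real (n + 1) powr (1 - Re s)" for n
      using norm_of_nat_powr[of "n + 1" "1 - s"] by (simp del: of_nat_add)
    ultimately show "(\<lambda>n. norm (of_nat (n + 1) powr (1 - s) :: complex)) \<longlonglongrightarrow> 0"
      by (simp only:)
  qed
  from telescope_sums'[OF this] have h: "?h sums 1" by (simp add: add_ac)
  have t: "(\<lambda>n. of_nat (n + 2) powr (1 - s - of_nat (k + 1))) sums zeta_tail (s + of_nat k)" for k
    using zeta_tail_sums[of "s + of_nat k"] s by (simp add: algebra_simps)
  have "zeta_rem_term (m + 2) n s = ?h n - (s - 1) * of_nat (n + 2) powr (1 - s - of_nat (0 + 1)) -
    (\<Sum>k<m. ((1 - s) gchoose (k + 2)) * (-1) ^ k * of_nat (n + 2) powr (1 - s - of_nat (k + 1 + 1)))" for n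
    unfolding zeta_rem_term_def
    by (simp only: add_2_eq_Suc' sum.lessThan_Suc_shift) (simp add: algebra_simps)
  moreover have "(\<lambda>n. ?h n - (s - 1) * of_nat (n + 2) powr (1 - s - of_nat (0 + 1)) -
    (\<Sum>k<m. ((1 - s) gchoose (k + 2)) * (-1) ^ k * of_nat (n + 2) powr (1 - s - of_nat (k + 1 + 1)))) sums
    (1 - (s - 1) * zeta_tail (s + of_nat 0) -
    (\<Sum>k<m. ((1 - s) gchoose (k + 2)) * (-1) ^ k * zeta_tail (s + of_nat (k + 1))))"
    by (intro sums_diff sums_sum sums_mult h t)
  ultimately show ?thesis by (simp add: sums_iff)
qed

lemma gbinomial_factor:
  "((1 - s :: complex) gchoose (k + 2)) =
     - (\<Prod>i<k+1. 1 - s - of_nat i) / fact (k + 2) * (s + of_nat (k + 1) - 1)"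
  by (simp add: gbinomial_prod_rev atLeast0LessThan field_simps)

lemma zeta_continuation_halfplane:
  "\<exists>G. G holomorphic_on {s. Re s > 1 - real N} \<and> (\<forall>s. Re s > 1 \<longrightarrow> G s = (s - 1) * zeta_tail s)"
proof (induction N)
  case 0
  show ?case
    by (rule exI[of _ "\<lambda>s. (s - 1) * zeta_tail s"])
       (auto intro!: holomorphic_intros holomorphic_zeta_tail)
next
  case (Suc N)
  then obtain G where G: "G holomorphic_on {s. Re s > 1 - real N}"
    "\<And>s. Re s > 1 \<Longrightarrow> G s = (s - 1) * zeta_tail s" by blast
  define p where "p k s = - (\<Prod>i<k+1. 1 - s - of_nat i) / fact (k + 2) * (-1) ^ k" for k and s :: complex
  define H where "H s = 1 - (\<Sum>n. zeta_rem_term (N + 2) n s) -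
    (\<Sum>k<N. p k s * G (s + of_nat (k + 1)))" for s
  have shift: "(\<lambda>s. G (s + of_nat (k + 1))) holomorphic_on {s. Re s > 1 - real (Suc N)}" for k
    by (rule holomorphic_on_compose_gen[OF _ G(1), unfolded o_def])
       (auto intro!: holomorphic_intros)
  have "H holomorphic_on {s. Re s > 1 - real (Suc N)}"
    unfolding H_def p_def
    by (intro holomorphic_intros shift holomorphic_on_subset[OF holomorphic_zeta_rem]) auto
  moreover have "H s = (s - 1) * zeta_tail s" if s: "Re s > 1" for s
  proof -
    have "((1 - s) gchoose (k + 2)) * (-1) ^ k * zeta_tail (s + of_nat (k + 1)) =
        p k s * G (s + of_nat (k + 1))" for k
    proof -
      have "G (s + of_nat (k + 1)) = (s + of_nat (k + 1) - 1) * zeta_tail (s + of_nat (k + 1))"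
        using s by (intro G(2)) simp
      then show ?thesis by (simp only: gbinomial_factor p_def mult_ac)
    qed
    then show ?thesis unfolding H_def by (simp only: zeta_rem_eq[OF s])  simp
  qed
  ultimately show ?case by blast
qed

lemma ex_is_zeta: "\<exists>f. is_zeta f"
proof -
  let ?S = "\<lambda>N. {s::complex. Re s > 1 - real N}"
  have "\<forall>N. \<exists>G. G holomorphic_on ?S N \<and> (\<forall>s. Re s > 1 \<longrightarrow> G s = (s - 1) * zeta_tail s)"
    using zeta_continuation_halfplane by blast
  from choice[OF this] obtain G where hol: "\<And>N. G N holomorphic_on ?S N"
    and eq: "\<And>N s. Re s > 1 \<Longrightarrow> G N s = (s - 1) * zeta_tail s" by blast
  have step: "G M s = G N s" if "M \<le> N" "s \<in> ?S M" for M N s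
  proof (rule analytic_continuation_open[of "{s. Re s > 1}" "?S M" "G M" "G N"])
    show "open {s. 1 < Re s}" "open (?S M)" by (rule open_halfspace_Re_gt)+
    show "connected (?S M)" by (intro convex_connected convex_halfspace_Re_gt)
    have "(2::complex) \<in> {s. 1 < Re s}" by simp
    then show "{s. 1 < Re s} \<noteq> {}" by blast
    show "G N holomorphic_on ?S M" using that by (intro holomorphic_on_subset[OF hol[of N]]) auto
  qed (use that eq hol in auto)
  define F where "F s = G (nat \<lceil>2 - Re s\<rceil>) s" for s
  have F: "F s = G N s" if "s \<in> ?S N" for N s
  proof -
    have "s \<in> ?S (nat \<lceil>2 - Re s\<rceil>)" by simp linarith
    with that show ?thesis unfolding F_def by (metis step nle_le)
  qed
  have "F holomorphic_on (\<Union>N. ?S N)"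
  proof (rule holomorphic_on_UN_open)
    show "F holomorphic_on ?S N" for N
      using F by (subst holomorphic_cong[OF refl, of _ F "G N"]) (auto intro: hol)
  qed (rule open_halfspace_Re_gt)
  moreover have "(\<Union>N. ?S N) = UNIV"
  proof -
    have "s \<in> ?S (nat \<lceil>2 - Re s\<rceil>)" for s by simp linarith
    then show ?thesis by blast
  qed
  ultimately have holF: "F holomorphic_on UNIV" by simp
  have "is_zeta (\<lambda>s. 1 + F s / (s - 1))"
    unfolding is_zeta_def
  proof safe
    show "(\<lambda>s. 1 + F s / (s - 1)) holomorphic_on - {1}"
      by (intro holomorphic_intros holomorphic_on_subset[OF holF]) auto
    fix s :: complex assume s: "1 < Re s"
    then have "F s = (s - 1) * zeta_tail s" using F[of s 0] eq[of s 0] by simp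
    moreover have "s \<noteq> 1" using s by auto
    ultimately have "F s / (s - 1) = zeta_tail s" by simp
    moreover have "(\<lambda>n. of_nat (Suc (Suc n)) powr (- s)) sums zeta_tail s"
      using zeta_tail_sums[OF s] by simp
    ultimately show "(\<lambda>n. of_nat (Suc n) powr - s) sums (1 + F s / (s - 1))"
      using sums_Suc[of "\<lambda>n. of_nat (Suc n) powr - s" "zeta_tail s"] by (simp add: add.commute)
  qed
  then show ?thesis by blast
qed

lemma is_zeta_riemann_zeta: "is_zeta riemann_zeta"
  unfolding riemann_zeta_def using ex_is_zeta by (rule someI_ex)

lemma riemann_zeta_real:
  assumes "x \<noteq> 1"
  shows "riemann_zeta (of_real x) \<in> \<real>"
proof -
  have "is_zeta (cnj \<circ> riemann_zeta \<circ> cnj)"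
    unfolding is_zeta_def
  proof safe
    have "cnj ` (- {1}) = - {1}" by (force simp: image_iff intro: complex_cnj_cnj[symmetric])
    then show "cnj \<circ> riemann_zeta \<circ> cnj holomorphic_on - {1}"
      using is_zeta_riemann_zeta by (intro holomorphic_on_compose_cnj_cnj) (auto simp: is_zeta_def)
    fix s :: complex assume "1 < Re s"
    then have "(\<lambda>n. of_nat (Suc n) powr (- cnj s)) sums riemann_zeta (cnj s)"
      using is_zeta_riemann_zeta unfolding is_zeta_def by simp
    then have "(\<lambda>n. cnj (of_nat (Suc n) powr (- cnj s))) sums cnj (riemann_zeta (cnj s))"
      by (simp only: sums_cnj)
    moreover have "cnj (of_nat (Suc n) powr (- cnj s)) = of_nat (Suc n) powr (- s)" for n
      by (subst cnj_powr) (auto simp del: of_nat_Suc)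
    ultimately show "(\<lambda>n. of_nat (Suc n) powr (- s)) sums (cnj \<circ> riemann_zeta \<circ> cnj) s"
      by (simp add: o_def)
  qed
  from is_zeta_unique[OF this is_zeta_riemann_zeta, of "of_real x"] assms show ?thesis
    by (simp add: Reals_cnj_iff)
qed

definition zeta_real :: "real \<Rightarrow> real" where
  "zeta_real x = Re (riemann_zeta (of_real x))"

lemma riemann_zeta_of_real: "x \<noteq> 1 \<Longrightarrow> riemann_zeta (of_real x) = of_real (zeta_real x)"
  using riemann_zeta_real by (simp add: zeta_real_def)

section \<open>The probabilistic model\<close>

definition pos_pairs :: "(nat \<times> nat) set" where
  "pos_pairs = {1..} \<times> {1..}"

text \<open>
  \<open>M t\<close> and \<open>X t\<close> are the probability space and the family of random variables of the model with
  parameter \<open>t\<close>; both may depend on \<open>t\<close> arbitrarily, only the joint law is prescribed.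
\<close>

definition geometric_model ::
  "(real \<Rightarrow> 'a measure) \<Rightarrow> (real \<Rightarrow> nat \<times> nat \<Rightarrow> 'a \<Rightarrow> nat) \<Rightarrow> bool" where
  "geometric_model M X \<longleftrightarrow> (\<forall>t>0.
     prob_space (M t) \<and>
     prob_space.indep_vars (M t) (\<lambda>_. count_space UNIV) (X t) pos_pairs \<and>
     (\<forall>(j,k)\<in>pos_pairs. \<forall>m.
        measure (M t) {\<omega> \<in> space (M t). X t (j,k) \<omega> = m} =
          (1 - exp (- (real (j * k * (j + k)) * t / 2))) *
          exp (- (real (j * k * (j + k)) * real m * t / 2))))"

text \<open>
  The random variable \<open>N\<close>. The series is summed in the extended nonnegative reals, so that it is
  defined everywhere, with value \<open>\<infinity>\<close> where it diverges.
\<close>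

definition N_sum :: "(nat \<times> nat \<Rightarrow> 'a \<Rightarrow> nat) \<Rightarrow> 'a \<Rightarrow> ennreal" where
  "N_sum X \<omega> = (\<Sum>\<^sub>\<infinity>(j,k)\<in>pos_pairs. ennreal (1 / 2 * real (j * k * (j + k)) * real (X (j,k) \<omega>)))"

text \<open>
  \<open>enn2real\<close> changes \<open>N\<close> only where it is infinite, which is a null event.
\<close>

definition N_variance :: "'a measure \<Rightarrow> (nat \<times> nat \<Rightarrow> 'a \<Rightarrow> nat) \<Rightarrow> real" where
  "N_variance M X = prob_space.variance M (\<lambda>\<omega>. enn2real (N_sum X \<omega>))"

section \<open>The constants\<close>

definition const_X :: real where
  "const_X = (1 / 9 * Gamma (1 / 3) ^ 2 * zeta_real (5 / 3)) powr (3 / 10)"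

definition const_Y :: real where
  "const_Y = - sqrt pi * zeta_real (1 / 2) * zeta_real (3 / 2)"

definition tau1 :: real where "tau1 = 2 * const_X ^ 2"
definition tau2 :: real where "tau2 = 3 / 10 * const_X powr (-1) * const_Y"
definition tau3 :: real where "tau3 = 3 / 400 * const_X powr (-4) * const_Y ^ 2"

definition t_seq :: "nat \<Rightarrow> real" where
  "t_seq n = tau1 * real n powr (- 3 / 5) - tau2 * real n powr (- 7 / 10)
              - tau3 * real n powr (- 4 / 5)"

end

theory Submission
  imports Defs
begin

text \<open>
  Put \<open>d = j * k * (j + k) / 2\<close>. By Fourier inversion, \<open>2 * pi * P (N = n)\<close> is the integral of
  \<open>\<phi> \<theta> * exp (- \<i> * n * \<theta>)\<close> over \<open>[-pi, pi]\<close>, where \<open>\<phi>\<close> is an explicit product over all pairs \<open>(j, k)\<close>.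
  On the scale \<open>\<theta> = s / \<sigma>\<close> every factor is close to its Gaussian approximation, so the integrand tends to
  \<open>exp (- s\<^sup>2 / 2)\<close> as soon as the mean differs from \<open>n\<close> by \<open>o(\<sigma>)\<close>. For \<open>\<bar>\<theta>\<bar> \<le> t\<close> the factors with
  \<open>j, k \<le> t powr (- 1 / 3)\<close> give a Gaussian bound. For \<open>t \<le> \<bar>\<theta>\<bar> \<le> pi\<close> the factors with \<open>j = 1\<close>, where \<open>d\<close> runs
  through the triangular numbers, give the bound \<open>exp (- c * t powr (- 1 / 2))\<close>.

  Since \<open>\<sigma>\<close> has order \<open>t powr (- 4 / 3)\<close>, the mean is needed up to \<open>o(t powr (- 4 / 3))\<close>. Expanding
  \<open>1 / (exp (t * d) - 1)\<close> into a geometric series reduces it to the sum of \<open>x * exp (- x)\<close> over the points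
  \<open>x = t * d\<close>. This double sum is split along the diagonal and evaluated by the trapezoidal rule, first in \<open>k\<close>
  and then in \<open>j\<close>. The singularity \<open>j powr (- 1 / 2)\<close> in the second step produces \<open>\<zeta>(1 / 2)\<close>. The variance
  follows from the mean, because difference quotients of the mean bound the variance from both sides.
\<close>

section \<open>Values of the zeta function\<close>

text \<open>Doubling the sum over \<open>k \<ge> j\<close> and removing one copy of the diagonal
  gives twice a trapezoidal sum, because the end term \<open>k = j\<close> then has weight one half;
  so cutting the quadrant along the diagonal creates no boundary term. After scaling by
  \<open>sqrt (t * j)\<close> a row depends on \<open>t\<close> and \<open>j\<close> only through
  \<open>sqrt t * j powr (3 / 2)\<close>, so one function of one variable describes all rows. The
  leading constant is the integral of \<open>x * exp (- x)\<close>,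
  \<open>x = u * v * (u + v) / 2\<close>, over \<open>v \<ge> u > 0\<close>: putting
  \<open>v = u * z\<close> splits it into a Gamma integral in \<open>u\<close> and half of a Beta
  integral with both parameters \<open>1 / 3\<close> in \<open>z\<close>, whence
  \<open>Gamma (1 / 3) ^ 2\<close>. The values of zeta at \<open>5 / 3\<close> and
  \<open>3 / 2\<close> come from summing \<open>m powr (- 2 / 3) / m\<close> and
  \<open>m powr (- 1 / 2) / m\<close> over the geometric series. The Fourier integral converges by
  dominated convergence in \<open>s\<close>, so one integrable majorant must serve for all
  \<open>\<bar>s\<bar> \<le> pi * \<sigma>\<close>. It is a multiple of
  \<open>1 / (1 + s ^ 2)\<close>: on that range \<open>1 + s ^ 2\<close> is at most a power of
  \<open>1 / t\<close>, which the far bound beats.\<close>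

lemma zeta_real_sums:
  assumes "x > 1"
  shows "(\<lambda>n. real (Suc n) powr (- x)) sums zeta_real x"
proof -
  have "(\<lambda>n. of_nat (Suc n) powr (- of_real x)) sums riemann_zeta (of_real x)"
    using is_zeta_riemann_zeta assms unfolding is_zeta_def by simp
  moreover have "of_nat (Suc n) powr (- of_real x) = complex_of_real (real (Suc n) powr (- x))" for n
    using powr_of_real[of "real (Suc n)" "- x"] by simp
  ultimately have "(\<lambda>n. complex_of_real (real (Suc n) powr (- x))) sums of_real (zeta_real x)"
    using riemann_zeta_of_real[of x] assms by simp
  then show ?thesis by (simp only: sums_of_real_iff)
qed

lemma zeta_real_pos:
  assumes "x > 1"
  shows "zeta_real x > 0"
proof -
  have "(\<lambda>n. real (Suc n) powr (- x)) sums zeta_real x" by (rule zeta_real_sums[OF assms])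
  then show ?thesis
    using suminf_pos[of "\<lambda>n. real (Suc n) powr (- x)"] by (simp add: sums_iff)
qed

text \<open>For \<open>Re s > 1\<close> this is \<open>zeta_rem_eq\<close> with an empty correction
  sum. The second-order remainder terms decay like \<open>n powr (- 1 - Re s)\<close>, so their
  series is holomorphic for \<open>Re s > 0\<close> and the identity extends to that region, in
  particular to \<open>1 / 2\<close>.\<close>

lemma zeta_rem_continuation:
  assumes "Re s > 0" "s \<noteq> 1"
  shows "(\<Sum>n. zeta_rem_term 2 n s) = 1 - (s - 1) * (riemann_zeta s - 1)"
proof (rule analytic_continuation_open[of "{s. Re s > 1}" "{s. Re s > 0} - {1}"
      "\<lambda>s. \<Sum>n. zeta_rem_term 2 n s" "\<lambda>s. 1 - (s - 1) * (riemann_zeta s - 1)"])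
  show "open {s. 1 < Re s}" by (rule open_halfspace_Re_gt)
  show "open ({s. 0 < Re s} - {1})" by (intro open_Diff open_halfspace_Re_gt) auto
  show "connected ({s. 0 < Re s} - {1})"
    by (intro connected_open_delete open_halfspace_Re_gt convex_connected convex_halfspace_Re_gt) auto
  have "(2::complex) \<in> {s. 1 < Re s}" by simp
  then show "{s. 1 < Re s} \<noteq> {}" by blast
  show "(\<lambda>s. \<Sum>n. zeta_rem_term 2 n s) holomorphic_on {s. 0 < Re s} - {1}"
    by (rule holomorphic_on_subset[OF holomorphic_zeta_rem]) auto
  have "riemann_zeta holomorphic_on {s. 0 < Re s} - {1}"
    using is_zeta_riemann_zeta unfolding is_zeta_def by (auto elim!: holomorphic_on_subset)
  then show "(\<lambda>s. 1 - (s - 1) * (riemann_zeta s - 1)) holomorphic_on {s. 0 < Re s} - {1}"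
    by (intro holomorphic_intros)
  fix s assume "s \<in> {s. 1 < Re s}"
  then have s: "Re s > 1" by simp
  have "(\<lambda>n. of_nat (Suc n) powr (- s)) sums riemann_zeta s"
    using is_zeta_riemann_zeta s unfolding is_zeta_def by simp
  then have "(\<lambda>n. of_nat (Suc (Suc n)) powr (- s)) sums (riemann_zeta s - 1)"
    by (subst sums_Suc_iff) simp
  moreover have "(\<lambda>n. of_nat (Suc (Suc n)) powr (- s)) sums zeta_tail s"
    using zeta_tail_sums[OF s] by simp
  ultimately have "zeta_tail s = riemann_zeta s - 1" by (rule sums_unique2[rotated])
  then show "(\<Sum>n. zeta_rem_term 2 n s) = 1 - (s - 1) * (riemann_zeta s - 1)"
    using zeta_rem_eq[OF s, of 0] by (simp add: numeral_2_eq_2)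
qed (use assms in auto)

text \<open>At \<open>s = 1 / 2\<close> the remainder terms are real and their partial sums
  telescope up to the terms \<open>j powr (- 1 / 2)\<close>. The continued value thereby becomes a
  limit of partial sums with the divergent part removed.\<close>

lemma zeta_half_limit:
  "(\<lambda>N. (\<Sum>j=1..N. real j powr (- 1 / 2)) - 2 * sqrt (real N)) \<longlonglongrightarrow> zeta_real (1 / 2)"
proof -
  let ?s = "1 / 2 :: complex"
  let ?r = "\<lambda>n. sqrt (real (n + 1)) - sqrt (real (n + 2)) + 1 / 2 * real (n + 2) powr (- 1 / 2)"
  have cpow: "of_nat m powr of_real a = complex_of_real (real m powr a)" for m a
    using powr_of_real[of "real m" a] by simp
  have trm: "zeta_rem_term 2 n ?s = of_real (?r n)" for n
  proof -
    have 1: "(of_nat (n + 1) :: complex) powr (1 - ?s) = of_real (sqrt (real (n + 1)))"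
      using cpow[of "n + 1" "1 / 2"] by (simp add: powr_half_sqrt)
    have 2: "(of_nat (n + 2) :: complex) powr (1 - ?s) = of_real (sqrt (real (n + 2)))"
      using cpow[of "n + 2" "1 / 2"] by (simp add: powr_half_sqrt)
    have 3: "(of_nat (n + 2) :: complex) powr (1 - ?s - 1) = of_real (real (n + 2) powr (- 1 / 2))"
      using cpow[of "n + 2" "- 1 / 2"] by simp
    have "zeta_rem_term 2 n ?s = of_nat (n + 1) powr (1 - ?s) - (of_nat (n + 2) powr (1 - ?s) -
        1 / 2 * of_nat (n + 2) powr (1 - ?s - 1))"
      unfolding zeta_rem_term_def numeral_2_eq_2 sum.lessThan_Suc by simp
    then show ?thesis unfolding 1 2 3 by simp
  qed
  have "summable (\<lambda>n. zeta_rem_term 2 n ?s)"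
  proof (rule summable_comparison_test'[where N = 0])
    show "norm (zeta_rem_term 2 n ?s) \<le> real (n + 2) powr (1 - Re ?s - real 2) *
           (2 ^ 2 * (\<Sum>k. pochhammer 1 k / fact k * (1 / 2) ^ k))" for n
      by (rule norm_zeta_rem_term_le) (simp add: norm_divide)
    show "summable (\<lambda>n. real (n + 2) powr (1 - Re ?s - real 2) *
           (2 ^ 2 * (\<Sum>k. pochhammer 1 k / fact k * (1 / 2) ^ k)))"
      by (intro summable_mult2 summable_shifted_powr) simp
  qed
  then have "(\<lambda>n. zeta_rem_term 2 n ?s) sums (1 - (?s - 1) * (riemann_zeta ?s - 1))"
    using zeta_rem_continuation[of ?s] by (simp add: sums_iff)
  moreover have "riemann_zeta ?s = of_real (zeta_real (1 / 2))"
    using riemann_zeta_of_real[of "1 / 2"] by simp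
  ultimately have "(\<lambda>n. complex_of_real (?r n)) sums of_real (1 / 2 + 1 / 2 * zeta_real (1 / 2))"
    unfolding trm by (simp add: field_simps)
  then have "?r sums (1 / 2 + 1 / 2 * zeta_real (1 / 2))"
    by (simp only: sums_of_real_iff)
  then have lim: "(\<lambda>N. \<Sum>n<N. ?r n) \<longlonglongrightarrow> 1 / 2 + 1 / 2 * zeta_real (1 / 2)"
    by (simp add: sums_def)
  \<comment> \<open>Telescoping the square roots leaves \<open>2\<close> at the lower end; the term
    \<open>j = 1\<close>, absent on the left, takes \<open>1\<close> of it back.\<close>
  have part: "2 * (\<Sum>n<N. ?r n) = (\<Sum>j=1..Suc N. real j powr (- 1 / 2)) - 2 * sqrt (real (Suc N)) + 1" for N
    by (induction N) (simp_all add: algebra_simps)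
  have "(\<lambda>N. 2 * (\<Sum>n<N. ?r n) - 1) \<longlonglongrightarrow> 2 * (1 / 2 + 1 / 2 * zeta_real (1 / 2)) - 1"
    by (intro tendsto_intros lim)
  then have "(\<lambda>N. (\<Sum>j=1..Suc N. real j powr (- 1 / 2)) - 2 * sqrt (real (Suc N))) \<longlonglongrightarrow> zeta_real (1 / 2)"
    unfolding part by simp
  then show ?thesis by (rule LIMSEQ_imp_Suc)
qed

section \<open>A Gaussian kernel\<close>

text \<open>The integral of \<open>exp (- y\<^sup>2 / 2)\<close> over \<open>y \<ge> z\<close>,
  written as half the total mass minus an integral over a bounded interval, so that its derivative
  comes from the fundamental theorem.\<close>

definition gtail :: "real \<Rightarrow> real" where
  "gtail z = sqrt (pi / 2) - (LBINT y=0..z. exp (- y\<^sup>2 / 2))"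

lemma gtail_0: "gtail 0 = sqrt (pi / 2)"
  by (simp add: gtail_def flip: zero_ereal_def)

lemma gtail_deriv [derivative_intros]:
  assumes "(f has_real_derivative f') (at x within S)"
  shows "((\<lambda>x. gtail (f x)) has_real_derivative - exp (- (f x)\<^sup>2 / 2) * f') (at x within S)"
proof -
  have "(gtail has_real_derivative - exp (- z\<^sup>2 / 2)) (at z)" for z
  proof -
    have "((\<lambda>u. LBINT y=ereal 0..u. exp (- y\<^sup>2 / 2)) has_vector_derivative exp (- z\<^sup>2 / 2))
        (at z within {- \<bar>z\<bar> - 1..\<bar>z\<bar> + 1})"
      by (rule interval_integral_FTC2) (auto intro!: continuous_intros)
    moreover have "at z within {- \<bar>z\<bar> - 1..\<bar>z\<bar> + 1} = at z"
      by (rule at_within_interior) (auto simp: interior_atLeastAtMost_real)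
    ultimately have "((\<lambda>u. LBINT y=0..u. exp (- y\<^sup>2 / 2)) has_real_derivative exp (- z\<^sup>2 / 2)) (at z)"
      by (simp add: has_real_derivative_iff_has_vector_derivative zero_ereal_def)
    then show ?thesis unfolding gtail_def[abs_def]
      by (auto intro!: derivative_eq_intros)
  qed
  from DERIV_chain'[OF assms this] show ?thesis by (simp add: mult_ac)
qed

lemma gtail_tendsto_0: "(gtail \<longlongrightarrow> 0) at_top"
proof -
  have g: "has_bochner_integral lborel (\<lambda>x. indicator {0..} x *\<^sub>R exp (- x\<^sup>2)) (sqrt pi / 2)"
    by (rule gaussian_moment_0)
  \<comment> \<open>Rescaling by \<open>1 / sqrt 2\<close> turns the known integral of
    \<open>exp (- x\<^sup>2)\<close> into that of \<open>exp (- x\<^sup>2 / 2)\<close>.\<close>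
  have "has_bochner_integral lborel (\<lambda>x. indicator {0..} (0 + 1 / sqrt 2 * x) *\<^sub>R
      exp (- (0 + 1 / sqrt 2 * x)\<^sup>2)) ((sqrt pi / 2) /\<^sub>R \<bar>1 / sqrt 2\<bar>)"
    using g by (intro lborel_has_bochner_integral_real_affine_iff[THEN iffD1]) auto
  moreover have "(indicator {0..} (0 + 1 / sqrt 2 * x) :: real) = indicator {0..} x" for x :: real
    by (auto simp: indicator_def zero_le_mult_iff divide_simps)
  moreover have "(0 + 1 / sqrt 2 * x)\<^sup>2 = x\<^sup>2 / 2" for x :: real
    by (simp add: power_mult_distrib power_divide)
  moreover have "(sqrt pi / 2) /\<^sub>R \<bar>1 / sqrt 2\<bar> = sqrt (pi / 2)"
    by (simp add: real_sqrt_divide field_simps)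
  ultimately have h: "has_bochner_integral lborel (\<lambda>x. indicator {0..} x *\<^sub>R exp (- x\<^sup>2 / 2)) (sqrt (pi / 2))"
    by (simp only: minus_divide_left)
  let ?g = "\<lambda>x::real. exp (- x\<^sup>2 / 2) :: real"
  have "((\<lambda>y. set_lebesgue_integral lborel {0..y} ?g) \<longlongrightarrow> set_lebesgue_integral lborel {0..} ?g) at_top"
    by (rule tendsto_set_lebesgue_integral_at_top)
      (use h in \<open>auto simp: set_integrable_def has_bochner_integral_iff\<close>)
  also have "set_lebesgue_integral lborel {0..} ?g = sqrt (pi / 2)"
    using h by (simp add: set_lebesgue_integral_def has_bochner_integral_iff)
  finally have "((\<lambda>y. sqrt (pi / 2) - set_lebesgue_integral lborel {0..y} ?g) \<longlongrightarrow>
      sqrt (pi / 2) - sqrt (pi / 2)) at_top"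
    by (intro tendsto_intros)
  then have "((\<lambda>y. sqrt (pi / 2) - set_lebesgue_integral lborel {0..y} ?g) \<longlongrightarrow> 0) at_top"
    by simp
  then show ?thesis
  proof (rule Lim_transform_eventually)
    show "eventually (\<lambda>y. sqrt (pi / 2) - set_lebesgue_integral lborel {0..y} ?g = gtail y) at_top"
      using eventually_ge_at_top[of 0]
      by eventually_elim (simp add: gtail_def interval_integral_Icc zero_ereal_def)
  qed
qed

lemma gtail_pos: "gtail z > 0"
proof (rule DERIV_neg_imp_decreasing_at_top[OF _ gtail_tendsto_0])
  fix x show "\<exists>y. (gtail has_real_derivative y) (at x) \<and> y < 0"
    using gtail_deriv[OF DERIV_ident, of x UNIV]
    by (intro exI[of _ "- exp (- x\<^sup>2 / 2) * 1"]) simp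
qed

text \<open>The difference \<open>h\<close> of the two sides vanishes at \<open>0\<close> and at
  infinity, and its derivative changes sign once, from plus to minus, at
  \<open>sqrt (2 / pi)\<close>. Hence \<open>h\<close> is nonnegative: compare with \<open>0\<close>
  before that point and with infinity after it.\<close>

lemma gtail_le:
  assumes "z \<ge> 0"
  shows "gtail z \<le> sqrt (pi / 2) * exp (- z\<^sup>2 / 2)"
proof -
  define h where "h z = sqrt (pi / 2) * exp (- z\<^sup>2 / 2) - gtail z" for z
  have dh: "(h has_real_derivative exp (- z\<^sup>2 / 2) * (1 - sqrt (pi / 2) * z)) (at z)" for z
    unfolding h_def[abs_def] by (auto intro!: derivative_eq_intros simp: algebra_simps)
  have h0: "h 0 = 0" by (simp add: h_def gtail_0)
  show ?thesis
  proof (cases "sqrt (pi / 2) * z \<le> 1")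
    case True
    have "h 0 \<le> h z"
    proof (rule DERIV_nonneg_imp_nondecreasing[OF assms])
      fix x assume x: "0 \<le> x" "x \<le> z"
      then have "sqrt (pi / 2) * x \<le> sqrt (pi / 2) * z" by (intro mult_left_mono) auto
      then have "sqrt (pi / 2) * x \<le> 1" using True by linarith
      then show "\<exists>y. (h has_real_derivative y) (at x) \<and> 0 \<le> y"
        using dh[of x]
        by (intro exI[of _ "exp (- x\<^sup>2 / 2) * (1 - sqrt (pi / 2) * x)"] conjI mult_nonneg_nonneg) auto
    qed
    then show ?thesis using h0 by (simp add: h_def)
  next
    case False
    have lim: "(h \<longlongrightarrow> sqrt (pi / 2) * 0 - 0) at_top"
      unfolding h_def[abs_def]
    proof (intro tendsto_intros gtail_tendsto_0)
      show "((\<lambda>z::real. exp (- z\<^sup>2 / 2)) \<longlongrightarrow> 0) at_top" by real_asymp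
    qed
    have "sqrt (pi / 2) * 0 - 0 < h z"
    proof (rule DERIV_neg_imp_decreasing_at_top[OF _ lim])
      fix x assume x: "z \<le> x"
      then have "sqrt (pi / 2) * z \<le> sqrt (pi / 2) * x" by (intro mult_left_mono) auto
      then have "sqrt (pi / 2) * x > 1" using False by linarith
      then show "\<exists>y. (h has_real_derivative y) (at x) \<and> y < 0"
        using dh[of x]
        by (intro exI[of _ "exp (- x\<^sup>2 / 2) * (1 - sqrt (pi / 2) * x)"] conjI mult_pos_neg) auto
    qed
    then show ?thesis by (simp add: h_def)
  qed
qed

text \<open>The integral of \<open>exp (- x)\<close> at \<open>x = (y\<^sup>2 + s * y) / 2\<close>
  over \<open>y \<ge> s\<close>: with \<open>z = y + s / 2\<close> one has
  \<open>x = z\<^sup>2 / 2 - s\<^sup>2 / 8\<close>, and \<open>y = s\<close> corresponds to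
  \<open>z = 3 * s / 2\<close>.\<close>

definition wtail :: "real \<Rightarrow> real" where
  "wtail s = exp (s\<^sup>2 / 8) * gtail (3 * s / 2)"

lemma wtail_deriv [derivative_intros]:
  "(wtail has_real_derivative s / 4 * wtail s - 3 / 2 * exp (- s\<^sup>2)) (at s within S)"
proof -
  have "exp (s\<^sup>2 / 8) * exp (- (3 * s / 2)\<^sup>2 / 2) = exp (- s\<^sup>2)"
    by (simp add: field_simps power2_eq_square flip: exp_add)
  then show ?thesis unfolding wtail_def[abs_def]
    by (auto intro!: derivative_eq_intros simp: algebra_simps)
qed

lemma wtail_nonneg: "wtail s \<ge> 0"
  using gtail_pos[of "3 * s / 2"] by (simp add: wtail_def)

lemma wtail_le:
  assumes "s \<ge> 0"
  shows "wtail s \<le> 2 * exp (- s\<^sup>2)"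
proof -
  have "wtail s \<le> exp (s\<^sup>2 / 8) * (sqrt (pi / 2) * exp (- (3 * s / 2)\<^sup>2 / 2))"
    unfolding wtail_def using assms by (intro mult_left_mono gtail_le) auto
  also have "\<dots> = sqrt (pi / 2) * exp (- s\<^sup>2)"
    by (simp add: field_simps power2_eq_square flip: exp_add)
  also have "\<dots> \<le> 2 * exp (- s\<^sup>2)"
    using pi_less_4 by (intro mult_right_mono real_le_lsqrt) auto
  finally show ?thesis .
qed

text \<open>For \<open>s \<ge> 0\<close>, \<open>kern s\<close> is the integral of \<open>x * exp (- x)\<close> at \<open>x = (y\<^sup>2 + s * y) / 2\<close> over \<open>y \<ge> s\<close>.\<close>

definition kern :: "real \<Rightarrow> real" where
  "kern s = 3 / 4 * s * exp (- s\<^sup>2) + (1 / 2 - s\<^sup>2 / 8) * wtail s"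

definition kern1 :: "real \<Rightarrow> real" where
  "kern1 s = - (21 / 16) * s\<^sup>2 * exp (- s\<^sup>2) - (s / 8 + s ^ 3 / 32) * wtail s"

definition kern2 :: "real \<Rightarrow> real" where
  "kern2 s = exp (- s\<^sup>2) * (- (21 / 8) * s + 21 / 8 * s ^ 3 + 3 / 2 * (s / 8 + s ^ 3 / 32))
     - (1 / 8 + 3 * s\<^sup>2 / 32 + s\<^sup>2 / 32 + s ^ 4 / 128) * wtail s"

lemma kern_0: "kern 0 = sqrt (pi / 2) / 2"
  by (simp add: kern_def wtail_def gtail_0)

lemma kern_deriv: "(kern has_real_derivative kern1 s) (at s within S)"
  unfolding kern_def[abs_def] kern1_def
  by (rule derivative_eq_intros refl | simp)+ (simp add: field_simps power2_eq_square power3_eq_cube)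

lemma kern1_deriv: "(kern1 has_real_derivative kern2 s) (at s within S)"
  unfolding kern1_def[abs_def] kern2_def
  by (rule derivative_eq_intros refl | simp)+
    (simp add: field_simps power2_eq_square power3_eq_cube eval_nat_numeral)

section \<open>Bounds for the kernel and its first two derivatives\<close>

lemma poly_exp_minus_square_le:
  assumes "(s::real) \<ge> 0"
  shows "(1 + s) ^ 6 * exp (- s\<^sup>2) \<le> 216 * exp 1"
proof -
  let ?y = "1 + s\<^sup>2"
  have "(1 + s)\<^sup>2 \<le> 2 * ?y"
    using sum_squares_ge_zero[of "s - 1" 0] by (simp add: power2_eq_square algebra_simps)
  then have "((1 + s)\<^sup>2) ^ 3 \<le> (2 * ?y) ^ 3" by (intro power_mono) auto
  also have "\<dots> = 216 * (?y / 3) ^ 3" by (simp only: power_mult_distrib power_divide) simp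
  also have "\<dots> \<le> 216 * (exp (?y / 3)) ^ 3"
  proof (intro mult_left_mono power_mono)
    show "?y / 3 \<le> exp (?y / 3)" using exp_ge_add_one_self[of "?y / 3"] by linarith
  qed auto
  also have "(exp (?y / 3)) ^ 3 = exp ?y" by (simp flip: exp_of_nat_mult)
  finally have "(1 + s) ^ 6 \<le> 216 * exp ?y" by (simp flip: power_mult)
  then have "(1 + s) ^ 6 * exp (- s\<^sup>2) \<le> 216 * exp ?y * exp (- s\<^sup>2)" by (intro mult_right_mono) auto
  then show ?thesis by (simp add: mult.assoc flip: exp_add)
qed

text \<open>The sixth power is spent twice: \<open>6 - k\<close> of it absorbs the polynomial
  factors of \<open>kern\<close>, \<open>kern1\<close> and \<open>kern2\<close>, and the remaining
  \<open>k\<close> is decay.\<close>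

lemma exp_minus_square_decay:
  assumes "(s::real) \<ge> 0" "k \<le> 6"
  shows "(1 + s) ^ (6 - k) * exp (- s\<^sup>2) \<le> 600 / (1 + s) ^ k"
proof -
  have "(1 + s) ^ 6 * exp (- s\<^sup>2) \<le> 216 * exp 1" by (rule poly_exp_minus_square_le[OF assms(1)])
  also have "exp 1 \<le> (600 / 216 :: real)" using e_less_272 by simp
  finally have "(1 + s) ^ 6 * exp (- s\<^sup>2) \<le> 600" by simp
  moreover have "(1 + s) ^ 6 = (1 + s) ^ (6 - k) * (1 + s) ^ k"
    using assms by (simp flip: power_add)
  ultimately show ?thesis using assms by (simp add: field_simps)
qed

lemma kern1_bound:
  assumes "s \<ge> 0"
  shows "\<bar>kern1 s\<bar> \<le> 1800 / (1 + s) ^ 3"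
proof -
  have "\<bar>kern1 s\<bar> \<le> 21 / 16 * s\<^sup>2 * exp (- s\<^sup>2) + (s / 8 + s ^ 3 / 32) * wtail s"
    unfolding kern1_def using assms wtail_nonneg[of s] by (simp add: abs_if)
  also have "\<dots> \<le> 21 / 16 * s\<^sup>2 * exp (- s\<^sup>2) + (s / 8 + s ^ 3 / 32) * (2 * exp (- s\<^sup>2))"
    using assms by (intro add_left_mono mult_left_mono wtail_le) auto
  also have "\<dots> = (21 / 16 * s\<^sup>2 + s / 4 + s ^ 3 / 16) * exp (- s\<^sup>2)" by (simp add: field_simps)
  also have "\<dots> \<le> (3 * (1 + s) ^ 3) * exp (- s\<^sup>2)"
  proof (rule mult_right_mono)
    have n: "s\<^sup>2 \<ge> 0" "s ^ 3 \<ge> 0" using assms by auto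
    have "(1 + s) ^ 3 = 1 + 3 * s + 3 * s\<^sup>2 + s ^ 3"
      by (simp add: eval_nat_numeral algebra_simps)
    then show "21 / 16 * s\<^sup>2 + s / 4 + s ^ 3 / 16 \<le> 3 * (1 + s) ^ 3" using n assms by linarith
  qed auto
  also have "\<dots> \<le> 3 * (600 / (1 + s) ^ 3)"
    using exp_minus_square_decay[OF assms, of 3] by simp
  finally show ?thesis by simp
qed

lemma kern2_bound:
  assumes "s \<ge> 0"
  shows "\<bar>kern2 s\<bar> \<le> 3600 / (1 + s)\<^sup>2"
proof -
  have n: "s\<^sup>2 \<ge> 0" "s ^ 3 \<ge> 0" "s ^ 4 \<ge> 0" using assms by auto
  let ?p = "21 / 8 * s + 21 / 8 * s ^ 3 + 3 / 2 * (s / 8 + s ^ 3 / 32)"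
  let ?q = "1 / 8 + 3 * s\<^sup>2 / 32 + s\<^sup>2 / 32 + s ^ 4 / 128"
  have "\<bar>kern2 s\<bar> \<le> \<bar>exp (- s\<^sup>2) * (- (21 / 8) * s + 21 / 8 * s ^ 3 + 3 / 2 * (s / 8 + s ^ 3 / 32))\<bar>
      + \<bar>?q * wtail s\<bar>"
    unfolding kern2_def by (rule abs_triangle_ineq4)
  also have "\<dots> \<le> exp (- s\<^sup>2) * ?p + ?q * wtail s"
    unfolding abs_mult using assms n wtail_nonneg[of s]
    by (intro add_mono mult_mono) (auto simp: abs_le_iff)
  also have "\<dots> \<le> exp (- s\<^sup>2) * ?p + ?q * (2 * exp (- s\<^sup>2))"
    using assms n by (intro add_left_mono mult_left_mono wtail_le) auto
  also have "\<dots> = (?p + 2 * ?q) * exp (- s\<^sup>2)" by (simp add: algebra_simps)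
  also have "\<dots> \<le> (6 * (1 + s) ^ 4) * exp (- s\<^sup>2)"
  proof (rule mult_right_mono)
    have "(1 + s) ^ 4 = 1 + 4 * s + 6 * s\<^sup>2 + 4 * s ^ 3 + s ^ 4"
      by (simp add: eval_nat_numeral algebra_simps)
    then show "?p + 2 * ?q \<le> 6 * (1 + s) ^ 4" using n assms by (simp only: distrib_left)
  qed auto
  also have "\<dots> \<le> 6 * (600 / (1 + s)\<^sup>2)"
    using exp_minus_square_decay[OF assms, of 2] by simp
  finally show ?thesis by simp
qed

lemma kern_decay:
  assumes "s \<ge> 0"
  shows "\<bar>kern s\<bar> \<le> 1800 / (1 + s) ^ 4"
proof -
  have n: "s\<^sup>2 \<ge> 0" using assms by auto
  have "\<bar>kern s\<bar> \<le> \<bar>3 / 4 * s * exp (- s\<^sup>2)\<bar> + \<bar>(1 / 2 - s\<^sup>2 / 8) * wtail s\<bar>"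
    unfolding kern_def by (rule abs_triangle_ineq)
  also have "\<dots> \<le> 3 / 4 * s * exp (- s\<^sup>2) + (1 / 2 + s\<^sup>2 / 8) * (2 * exp (- s\<^sup>2))"
    unfolding abs_mult using assms n wtail_nonneg[of s] wtail_le[of s]
    by (intro add_mono mult_mono) (auto simp: abs_le_iff)
  also have "\<dots> = (3 / 4 * s + 1 + s\<^sup>2 / 4) * exp (- s\<^sup>2)" by (simp add: algebra_simps)
  also have "\<dots> \<le> (3 * (1 + s) ^ 2) * exp (- s\<^sup>2)"
  proof (rule mult_right_mono)
    have "(1 + s) ^ 2 = 1 + 2 * s + s\<^sup>2" by (simp add: power2_eq_square algebra_simps)
    then show "3 / 4 * s + 1 + s\<^sup>2 / 4 \<le> 3 * (1 + s) ^ 2" using n assms by linarith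
  qed auto
  also have "\<dots> \<le> 3 * (600 / (1 + s) ^ 4)"
    using exp_minus_square_decay[OF assms, of 4] by simp
  finally show ?thesis by simp
qed

lemma kern_bound:
  assumes "s \<ge> 0"
  shows "\<bar>kern s\<bar> \<le> 1800"
proof -
  have "1 \<le> (1 + s) ^ 4" using assms by (intro one_le_power) auto
  then have "1800 / (1 + s) ^ 4 \<le> 1800 / 1" using assms by (intro divide_left_mono) auto
  then show ?thesis using kern_decay[OF assms] by simp
qed

text \<open>Trades half a power of \<open>s\<close> for one power of the decay of
  \<open>kern1\<close> or \<open>kern2\<close>; the bounds below thus become multiples of
  \<open>sqrt s\<close> valid for all \<open>s\<close>.\<close>

lemma le_sqrt_mult: "(s::real) \<ge> 0 \<Longrightarrow> s \<le> sqrt s * (1 + s)"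
proof -
  assume s: "s \<ge> 0"
  have "(1 + s)\<^sup>2 \<ge> s" using s by (simp add: power2_eq_square algebra_simps)
  then have "sqrt s \<le> 1 + s" using s by (intro real_le_lsqrt) auto
  then have "sqrt s * sqrt s \<le> sqrt s * (1 + s)" using s by (intro mult_left_mono) auto
  then show ?thesis using s by simp
qed

text \<open>\<open>kern\<close> is Lipschitz on \<open>[0, 1]\<close>, where
  \<open>s \<le> sqrt s\<close>, and bounded beyond. Weakening \<open>s\<close> to
  \<open>sqrt s\<close> makes one estimate cover both ranges.\<close>

lemma kern_diff_bound:
  assumes "s \<ge> 0"
  shows "\<bar>kern s - kern 0\<bar> \<le> 3600 * sqrt s"
proof (cases "s \<le> 1")
  case True
  have "norm (kern s - kern 0) \<le> 1800 * norm (s - 0)"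
  proof (rule field_differentiable_bound[of "{0..s}"])
    show "(kern has_field_derivative kern1 x) (at x within {0..s})" for x by (rule kern_deriv)
    show "norm (kern1 x) \<le> 1800" if "x \<in> {0..s}" for x
    proof -
      have "1 \<le> (1 + x) ^ 3" using that by (intro one_le_power) auto
      then have "1800 / (1 + x) ^ 3 \<le> 1800 / 1" using that by (intro divide_left_mono) auto
      then show ?thesis using kern1_bound[of x] that by simp
    qed
  qed (use assms in auto)
  also have "s \<le> sqrt s" using True assms by (intro real_le_rsqrt) (auto simp: power2_eq_square mult_left_le)
  then have "1800 * norm (s - 0) \<le> 3600 * sqrt s" using assms by simp
  finally show ?thesis by simp
next
  case False
  then have "sqrt s \<ge> 1" by simp
  then show ?thesis using kern_bound[OF assms] kern_bound[of 0] by linarith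
qed

text \<open>At \<open>s = sqrt t * x powr (3 / 2)\<close>, this combination times
  \<open>x powr (- 5 / 2)\<close> is the second derivative of the function that is summed over the
  rows. The factor \<open>sqrt s\<close> improves \<open>x powr (- 5 / 2)\<close> only to
  \<open>x powr (- 7 / 4)\<close>, which is still summable, and contributes the small factor
  \<open>t powr (1 / 4)\<close>.\<close>

lemma kern_combination_bound:
  assumes "s \<ge> 0"
  shows "\<bar>3 / 4 * (kern s - kern 0) - 3 / 4 * s * kern1 s + 9 / 4 * s\<^sup>2 * kern2 s\<bar> \<le> 13000 * sqrt s"
proof -
  have a: "s * \<bar>kern1 s\<bar> \<le> 1800 * sqrt s"
  proof -
    have "s * \<bar>kern1 s\<bar> \<le> sqrt s * (1 + s) * (1800 / (1 + s) ^ 3)"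
      using assms by (intro mult_mono kern1_bound le_sqrt_mult) auto
    also have "\<dots> = sqrt s * (1800 / (1 + s)\<^sup>2)"
      using assms by (simp add: power3_eq_cube power2_eq_square)
    also have "\<dots> \<le> sqrt s * (1800 / 1)"
      using assms by (intro mult_left_mono divide_left_mono) auto
    finally show ?thesis by simp
  qed
  have b: "s\<^sup>2 * \<bar>kern2 s\<bar> \<le> 3600 * sqrt s"
  proof -
    have "s\<^sup>2 * \<bar>kern2 s\<bar> \<le> (s * (sqrt s * (1 + s))) * (3600 / (1 + s)\<^sup>2)"
      using assms unfolding power2_eq_square[of s]
      by (intro mult_mono mult_left_mono kern2_bound le_sqrt_mult) auto
    also have "\<dots> = 3600 * sqrt s * (s / (1 + s))"
      using assms by (simp add: power2_eq_square)
    also have "\<dots> \<le> 3600 * sqrt s * 1"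
      using assms by (intro mult_left_mono) (auto simp: field_simps)
    finally show ?thesis by simp
  qed
  have "\<bar>3 / 4 * (kern s - kern 0) - 3 / 4 * s * kern1 s + 9 / 4 * s\<^sup>2 * kern2 s\<bar>
      \<le> \<bar>3 / 4 * (kern s - kern 0)\<bar> + \<bar>3 / 4 * s * kern1 s\<bar> + \<bar>9 / 4 * s\<^sup>2 * kern2 s\<bar>"
    by linarith
  also have "\<dots> = 3 / 4 * \<bar>kern s - kern 0\<bar> + 3 / 4 * (s * \<bar>kern1 s\<bar>) + 9 / 4 * (s\<^sup>2 * \<bar>kern2 s\<bar>)"
    using assms by (simp only: abs_mult) simp
  also have "\<dots> \<le> 3 / 4 * (3600 * sqrt s) + 3 / 4 * (1800 * sqrt s) + 9 / 4 * (3600 * sqrt s)"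
    by (intro add_mono mult_left_mono a b kern_diff_bound assms) auto
  also have "\<dots> \<le> 13000 * sqrt s" using assms by simp
  finally show ?thesis .
qed

section \<open>Rows of the double sum\<close>

text \<open>The defect \<open>h\<close> of the rule on \<open>[a, x]\<close> has derivative
  \<open>(f x - f a - (x - a) * f1 x) / 2\<close>. The mean value theorem applied to
  \<open>h\<close>, to \<open>f\<close> and to \<open>f1\<close> reduces it to one value of
  \<open>f2\<close>; the sharp constant \<open>1 / 12\<close> is not pursued.\<close>

lemma trapezoid_error:
  fixes \<Phi> f f1 f2 :: "real \<Rightarrow> real"
  assumes d: "\<And>x. x \<in> {a..a+1} \<Longrightarrow> (\<Phi> has_real_derivative f x) (at x)"
    "\<And>x. x \<in> {a..a+1} \<Longrightarrow> (f has_real_derivative f1 x) (at x)"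
    "\<And>x. x \<in> {a..a+1} \<Longrightarrow> (f1 has_real_derivative f2 x) (at x)"
    and B: "\<And>x. x \<in> {a..a+1} \<Longrightarrow> \<bar>f2 x\<bar> \<le> B"
  shows "\<bar>(f a + f (a + 1)) / 2 - (\<Phi> (a + 1) - \<Phi> a)\<bar> \<le> B"
proof -
  define h where "h x = \<Phi> x - \<Phi> a - (x - a) * (f a + f x) / 2" for x
  have dh: "(h has_real_derivative (f x - f a - (x - a) * f1 x) / 2) (at x)" if "x \<in> {a..a+1}" for x
    unfolding h_def[abs_def]
    by (rule derivative_eq_intros d that refl | simp)+ (simp add: field_simps)
  obtain y where y: "a < y" "y < a + 1" "h (a + 1) - h a = (f y - f a - (y - a) * f1 y) / 2"
    using MVT2[of a "a + 1" h "\<lambda>x. (f x - f a - (x - a) * f1 x) / 2"] dh by auto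
  obtain x where x: "a < x" "x < y" "f y - f a = (y - a) * f1 x"
    using MVT2[of a y f f1] d(2) y by auto
  obtain z where z: "x < z" "z < y" "f1 y - f1 x = (y - x) * f2 z"
    using MVT2[of x y f1 f2] d(3) x y by auto
  have B0: "B \<ge> 0" using B[of a] by auto
  have "\<bar>h (a + 1)\<bar> = \<bar>(y - a) * (f1 x - f1 y)\<bar> / 2"
  proof -
    have "h (a + 1) = ((y - a) * f1 x - (y - a) * f1 y) / 2"
      using y(3) x(3) by (simp add: h_def)
    then show ?thesis by (simp only: right_diff_distrib[symmetric] abs_divide abs_numeral)
  qed
  also have "\<dots> = (y - a) * ((y - x) * \<bar>f2 z\<bar>) / 2"
    using z(3) x y by (simp add: abs_mult abs_minus_commute[of "f1 x"])
  also have "\<dots> \<le> 1 * (1 * B) / 2"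
    using x y z B0 by (intro divide_right_mono mult_mono B) auto
  finally show ?thesis using B0 by (simp add: h_def abs_minus_commute)
qed

definition xexp :: "real \<Rightarrow> real" where
  "xexp x = x * exp (- x)"

lemma xexp_nonneg: "x \<ge> 0 \<Longrightarrow> xexp x \<ge> 0"
  by (simp add: xexp_def)

lemma poly_exp_minus_le:
  assumes "(x::real) \<ge> 0"
  shows "(1 + x) ^ 4 * exp (- x) \<le> 700"
proof -
  have "(1 + x) ^ 4 = 256 * ((1 + x) / 4) ^ 4" by (simp add: power_divide)
  also have "\<dots> \<le> 256 * (exp ((1 + x) / 4)) ^ 4"
  proof (intro mult_left_mono power_mono)
    show "(1 + x) / 4 \<le> exp ((1 + x) / 4)" using exp_ge_add_one_self[of "(1 + x) / 4"] by linarith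
  qed (use assms in auto)
  also have "(exp ((1 + x) / 4)) ^ 4 = exp (1 + x)" by (simp flip: exp_of_nat_mult)
  finally have "(1 + x) ^ 4 * exp (- x) \<le> 256 * exp (1 + x) * exp (- x)" by (intro mult_right_mono) auto
  also have "\<dots> = 256 * exp 1" by (simp add: mult.assoc flip: exp_add)
  also have "\<dots> \<le> 700" using e_less_272 by simp
  finally show ?thesis .
qed

text \<open>A bound \<open>x powr (- a)\<close> leads to an error \<open>O(t powr (1 - a))\<close> in the double sum. Summability requires
  \<open>a > 1\<close>, and an error \<open>o(t powr (- 1 / 3))\<close> requires \<open>a < 4 / 3\<close>.\<close>

lemma quadratic_exp_minus_le:
  assumes "(x::real) > 0"
  shows "(9 / 2 * x\<^sup>2 + 10 * x + 1) * exp (- x) \<le> 3500 * x powr (- 5 / 4)"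
proof -
  have "x powr (5 / 4) \<le> (1 + x) powr (5 / 4)" using assms by (intro powr_mono2) auto
  also have "\<dots> \<le> (1 + x) powr 2" using assms by (intro powr_mono) auto
  finally have le: "x powr (5 / 4) \<le> (1 + x)\<^sup>2" using assms by simp
  have "(9 / 2 * x\<^sup>2 + 10 * x + 1) * exp (- x) * x powr (5 / 4) \<le> (5 * (1 + x)\<^sup>2) * exp (- x) * (1 + x)\<^sup>2"
  proof (intro mult_mono le mult_nonneg_nonneg order.refl)
    have "x\<^sup>2 \<ge> 0" by simp
    then show "9 / 2 * x\<^sup>2 + 10 * x + 1 \<le> 5 * (1 + x)\<^sup>2"
      using assms unfolding power2_sum by (simp add: algebra_simps)
  qed (use assms in auto)
  also have "\<dots> = 5 * ((1 + x) ^ 4 * exp (- x))" by (simp add: eval_nat_numeral)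
  also have "\<dots> \<le> 3500" using poly_exp_minus_le[of x] assms by linarith
  finally show ?thesis using assms by (simp add: powr_minus field_simps)
qed

lemma xexp_le:
  assumes "x > 0"
  shows "xexp x \<le> 3500 * x powr (- 5 / 4)"
proof -
  have "xexp x \<le> (9 / 2 * x\<^sup>2 + 10 * x + 1) * exp (- x)"
    unfolding xexp_def using assms by (intro mult_right_mono) auto
  then show ?thesis using quadratic_exp_minus_le[OF assms] by linarith
qed

text \<open>The exponent \<open>- 5 / 2\<close> is shared equally between the row index and the
  position in the row. The error of the trapezoidal rule then sums over the row, and together with
  the factor \<open>j powr (- 1 / 4)\<close> of \<open>row_f2_bound\<close> it leaves
  \<open>j powr (- 3 / 2)\<close>, which sums over the rows.\<close>

lemma powr_le_row:
  assumes "n \<ge> (1::real)" "j \<ge> 1"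
  shows "(j + (n - 1)) powr (- 5 / 2) \<le> j powr (- 5 / 4) * n powr (- 5 / 4)"
proof -
  have "(j + (n - 1)) powr (- 5 / 2) = (j + (n - 1)) powr (- 5 / 4) * (j + (n - 1)) powr (- 5 / 4)"
    using assms by (simp flip: powr_add)
  also have "\<dots> \<le> j powr (- 5 / 4) * n powr (- 5 / 4)"
    using assms by (intro mult_mono powr_mono2') auto
  finally show ?thesis .
qed

text \<open>One row: \<open>A x\<close> is \<open>t * d\<close> at the pair \<open>(j, x)\<close>
  with real \<open>x\<close>, and \<open>f\<close>, \<open>f1\<close>, \<open>f2\<close> are the
  summand and its derivatives. The antiderivative \<open>\<Phi>\<close> comes from completing the
  square: with \<open>z = r * x + r * j / 2\<close> one has
  \<open>A x = z\<^sup>2 / 2 - (r * j)\<^sup>2 / 8\<close>, and integrating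
  \<open>z\<^sup>2 * exp (- z\<^sup>2 / 2)\<close> by parts leaves a boundary term and the Gaussian
  tail.\<close>

context
  fixes t j r :: real and f f1 f2 \<Phi> :: "real \<Rightarrow> real" and A :: "real \<Rightarrow> real"
  assumes t: "t > 0" and j: "j > 0"
  defines "r \<equiv> sqrt (t * j)"
    and "A \<equiv> \<lambda>x. t * (j * x * (j + x) / 2)"
    and "f \<equiv> \<lambda>x. xexp (A x)"
    and "f1 \<equiv> \<lambda>x. (1 - A x) * exp (- A x) * (t * j * (j + 2 * x) / 2)"
    and "f2 \<equiv> \<lambda>x. exp (- A x) * ((A x - 2) * (t * j * (j + 2 * x) / 2)\<^sup>2 + (1 - A x) * (t * j))"
    and "\<Phi> \<equiv> \<lambda>x. - (exp ((r * j)\<^sup>2 / 8) / r) * (1 / 2 * (r * x + r * j / 2) * exp (- (r * x + r * j / 2)\<^sup>2 / 2)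
            + (1 / 2 - (r * j)\<^sup>2 / 8) * gtail (r * x + r * j / 2))"
begin

lemma row_r: "r > 0" "r\<^sup>2 = t * j"
  using t j by (auto simp: r_def)

lemma row_A_eq: "A x = r\<^sup>2 * (x * (j + x) / 2)"
  unfolding row_r(2) by (simp add: A_def)

lemma row_A_ge: "x \<ge> j \<Longrightarrow> A x \<ge> r\<^sup>2 * x\<^sup>2 / 2" "x \<ge> j \<Longrightarrow> A x > 0"
proof -
  assume x: "x \<ge> j"
  have "A x = r\<^sup>2 * x\<^sup>2 / 2 + t * j\<^sup>2 * x / 2"
    unfolding row_A_eq row_r(2) by (simp add: field_simps power2_eq_square)
  then show "A x \<ge> r\<^sup>2 * x\<^sup>2 / 2" using t j x by simp
  then show "A x > 0" using row_r(1) x j by (smt (verit) zero_less_power zero_less_mult_iff half_gt_zero)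
qed

lemma row_deriv: "(\<Phi> has_real_derivative f x) (at x)"
proof -
  let ?z = "r * x + r * j / 2"
  have e: "exp ((r * j)\<^sup>2 / 8) * exp (- ?z\<^sup>2 / 2) = exp (- A x)"
    unfolding exp_add[symmetric] row_A_eq by (simp add: field_simps power2_eq_square)
  have a: "A x = ?z\<^sup>2 / 2 - (r * j)\<^sup>2 / 8"
    unfolding row_A_eq by (simp add: field_simps power2_eq_square)
  \<comment> \<open>This value of \<open>c\<close> makes the bracket
    \<open>1 / 2 - z\<^sup>2 / 2 - c\<close> in \<open>dG\<close> equal to
    \<open>- A x\<close>.\<close>
  define c where "c = 1 / 2 - (r * j)\<^sup>2 / 8"
  define E where "E = exp ((r * j)\<^sup>2 / 8)"
  have dG: "((\<lambda>z. 1 / 2 * z * exp (- z\<^sup>2 / 2) + c * gtail z) has_real_derivative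
      (1 / 2 - z\<^sup>2 / 2 - c) * exp (- z\<^sup>2 / 2)) (at z)" for z
    by (rule derivative_eq_intros refl | simp)+ (simp add: algebra_simps power2_eq_square)
  have dz: "((\<lambda>x. r * x + r * j / 2) has_real_derivative r) (at x)"
    by (auto intro!: derivative_eq_intros)
  have "(\<Phi> has_real_derivative - (E / r) * ((1 / 2 - ?z\<^sup>2 / 2 - c) * exp (- ?z\<^sup>2 / 2) * r)) (at x)"
    unfolding \<Phi>_def c_def[symmetric] E_def[symmetric]
    using DERIV_cmult[OF DERIV_chain2[OF dG dz], of "- (E / r)"] by simp
  also have "- (E / r) * ((1 / 2 - ?z\<^sup>2 / 2 - c) * exp (- ?z\<^sup>2 / 2) * r) =
      (E * exp (- ?z\<^sup>2 / 2)) * - (1 / 2 - ?z\<^sup>2 / 2 - c)"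
  proof -
    have "- (E / r) * (w * p * r) = (E * p) * - w" for w p
      using row_r(1) by simp
    then show ?thesis .
  qed
  also have "\<dots> = exp (- A x) * - (1 / 2 - ?z\<^sup>2 / 2 - c)"
    unfolding E_def e ..
  also have "- (1 / 2 - ?z\<^sup>2 / 2 - c) = A x"
    unfolding a c_def by simp
  also have "exp (- A x) * A x = f x" unfolding f_def xexp_def by simp
  finally show ?thesis .
qed

lemma row_deriv1: "(f has_real_derivative f1 x) (at x)"
  unfolding f_def xexp_def A_def f1_def
  by (rule derivative_eq_intros refl | simp)+ (simp add: field_simps)

lemma row_deriv2: "(f1 has_real_derivative f2 x) (at x)"
  unfolding f1_def A_def f2_def
  by (rule derivative_eq_intros refl | simp)+ (simp add: field_simps power2_eq_square)

text \<open>Beyond the diagonal \<open>j + 2 * x \<le> 3 * x\<close>, so the square of the slope of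
  \<open>A\<close> is at most \<open>9 / 2 * r\<^sup>2 * A x\<close>. Hence \<open>f2 x\<close> is
  \<open>r\<^sup>2\<close> times at most a quadratic polynomial in \<open>A x\<close> times
  \<open>exp (- A x)\<close>, and \<open>A x \<ge> r\<^sup>2 * x\<^sup>2 / 2\<close> converts this
  into a power of \<open>x\<close>.\<close>

lemma row_f2_bound:
  assumes x: "x \<ge> j"
  shows "\<bar>f2 x\<bar> \<le> 14000 * (t * j) powr (- 1 / 4) * x powr (- 5 / 2)"
proof -
  have A0: "A x > 0" "A x \<ge> r\<^sup>2 * x\<^sup>2 / 2" using row_A_ge[OF x] by auto
  have x0: "x > 0" using x j by simp
  have sq: "(t * j * (j + 2 * x) / 2)\<^sup>2 \<le> 9 / 2 * r\<^sup>2 * A x"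
  proof -
    have "(t * j * (j + 2 * x) / 2)\<^sup>2 \<le> (t * j * (3 * x) / 2)\<^sup>2"
      using t j x by (intro power_mono divide_right_mono mult_left_mono) auto
    also have "\<dots> = 9 / 2 * r\<^sup>2 * (r\<^sup>2 * x\<^sup>2 / 2)"
      unfolding row_r(2) by (simp add: field_simps power2_eq_square)
    also have "\<dots> \<le> 9 / 2 * r\<^sup>2 * A x" using A0 by (intro mult_left_mono) auto
    finally show ?thesis .
  qed
  have "\<bar>f2 x\<bar> = exp (- A x) * \<bar>(A x - 2) * (t * j * (j + 2 * x) / 2)\<^sup>2 + (1 - A x) * (t * j)\<bar>"
    by (simp add: f2_def abs_mult)
  also have "\<dots> \<le> exp (- A x) * ((A x + 2) * (9 / 2 * r\<^sup>2 * A x) + (1 + A x) * r\<^sup>2)"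
  proof (rule mult_left_mono)
    have "\<bar>(A x - 2) * (t * j * (j + 2 * x) / 2)\<^sup>2 + (1 - A x) * (t * j)\<bar> \<le>
       \<bar>A x - 2\<bar> * (t * j * (j + 2 * x) / 2)\<^sup>2 + \<bar>1 - A x\<bar> * (t * j)"
      using abs_triangle_ineq[of "(A x - 2) * (t * j * (j + 2 * x) / 2)\<^sup>2" "(1 - A x) * (t * j)"] t j
      by (simp add: abs_mult)
    also have "\<dots> \<le> (A x + 2) * (9 / 2 * r\<^sup>2 * A x) + (1 + A x) * r\<^sup>2"
      using A0 sq t j unfolding row_r(2)[symmetric]
      by (intro add_mono mult_mono) (auto simp: abs_le_iff)
    finally show "\<bar>(A x - 2) * (t * j * (j + 2 * x) / 2)\<^sup>2 + (1 - A x) * (t * j)\<bar> \<le> \<dots>" .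
  qed auto
  also have "\<dots> = r\<^sup>2 * ((9 / 2 * (A x)\<^sup>2 + 10 * A x + 1) * exp (- A x))"
    by (simp add: field_simps power2_eq_square)
  also have "\<dots> \<le> r\<^sup>2 * (3500 * A x powr (- 5 / 4))"
    using A0 by (intro mult_left_mono quadratic_exp_minus_le) auto
  also have "\<dots> \<le> r\<^sup>2 * (3500 * (r\<^sup>2 * x\<^sup>2 / 2) powr (- 5 / 4))"
    using A0 row_r(1) x0 by (intro mult_left_mono powr_mono2') auto
  also have "(r\<^sup>2 * x\<^sup>2 / 2) powr (- 5 / 4) = (t * j) powr (- 5 / 4) * x powr (- 5 / 2) * 2 powr (5 / 4)"
    using t j x0 row_r(2) powr_powr[of x 2 "- 5 / 4"] by (simp add: powr_mult powr_divide powr_minus field_simps)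
  also have "r\<^sup>2 * (3500 * ((t * j) powr (- 5 / 4) * x powr (- 5 / 2) * 2 powr (5 / 4)))
     = 3500 * (t * j) powr (- 1 / 4) * x powr (- 5 / 2) * 2 powr (5 / 4)"
    using powr_add[of "t * j" 1 "- 5 / 4"] t j by (simp add: row_r)
  also have "\<dots> \<le> 3500 * (t * j) powr (- 1 / 4) * x powr (- 5 / 2) * 2 powr 2"
    by (intro mult_left_mono powr_mono) auto
  finally show ?thesis by simp
qed

lemma row_f_bound:
  assumes x: "x \<ge> j"
  shows "f x \<le> 14000 * (t * j) powr (- 5 / 4) * x powr (- 5 / 2)"
proof -
  have A0: "A x > 0" "A x \<ge> r\<^sup>2 * x\<^sup>2 / 2" using row_A_ge[OF x] by auto
  have x0: "x > 0" using x j by simp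
  have "f x \<le> 3500 * A x powr (- 5 / 4)" unfolding f_def by (rule xexp_le[OF A0(1)])
  also have "\<dots> \<le> 3500 * (r\<^sup>2 * x\<^sup>2 / 2) powr (- 5 / 4)"
    using A0 row_r(1) x0 by (intro mult_left_mono powr_mono2') auto
  also have "(r\<^sup>2 * x\<^sup>2 / 2) powr (- 5 / 4) = (t * j) powr (- 5 / 4) * x powr (- 5 / 2) * 2 powr (5 / 4)"
    using t j x0 row_r(2) powr_powr[of x 2 "- 5 / 4"] by (simp add: powr_mult powr_divide powr_minus field_simps)
  also have "3500 * \<dots> \<le> 3500 * ((t * j) powr (- 5 / 4) * x powr (- 5 / 2) * 2 powr 2)"
    by (intro mult_left_mono powr_mono) auto
  finally show ?thesis by simp
qed

lemma row_f_nonneg: "x \<ge> j \<Longrightarrow> f x \<ge> 0"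
  using row_A_ge(2)[of x] by (simp add: f_def xexp_nonneg)

lemma row_antiderivative_limit: "(\<Phi> \<longlongrightarrow> 0) at_top"
proof -
  have z: "filterlim (\<lambda>x. r * x + r * j / 2) at_top at_top"
    using row_r(1) by real_asymp
  have "((\<lambda>x. - (exp ((r * j)\<^sup>2 / 8) / r) * (1 / 2 * ((r * x + r * j / 2) * exp (- (r * x + r * j / 2)\<^sup>2 / 2))
            + (1 / 2 - (r * j)\<^sup>2 / 8) * gtail (r * x + r * j / 2))) \<longlongrightarrow>
      - (exp ((r * j)\<^sup>2 / 8) / r) * (1 / 2 * 0 + (1 / 2 - (r * j)\<^sup>2 / 8) * 0)) at_top"
  proof (intro tendsto_intros filterlim_compose[OF gtail_tendsto_0 z])
    have "((\<lambda>z::real. z * exp (- z\<^sup>2 / 2)) \<longlongrightarrow> 0) at_top" by real_asymp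
    from filterlim_compose[OF this z]
    show "((\<lambda>x. (r * x + r * j / 2) * exp (- (r * x + r * j / 2)\<^sup>2 / 2)) \<longlongrightarrow> 0) at_top" .
  qed
  then show ?thesis by (simp add: \<Phi>_def mult.assoc)
qed

lemma row_antiderivative_start: "\<Phi> j = - kern (r * j) / r"
proof -
  have z: "r * j + r * j / 2 = 3 * (r * j) / 2" by simp
  have e: "exp ((r * j)\<^sup>2 / 8) * exp (- (3 * (r * j) / 2)\<^sup>2 / 2) = exp (- (r * j)\<^sup>2)"
    by (simp add: field_simps power2_eq_square flip: exp_add)
  have "\<Phi> j = - (1 / r) * (1 / 2 * (3 * (r * j) / 2) * (exp ((r * j)\<^sup>2 / 8) * exp (- (3 * (r * j) / 2)\<^sup>2 / 2))
      + (1 / 2 - (r * j)\<^sup>2 / 8) * (exp ((r * j)\<^sup>2 / 8) * gtail (3 * (r * j) / 2)))"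
    unfolding \<Phi>_def z by (simp add: algebra_simps)
  then show ?thesis unfolding e kern_def wtail_def using row_r(1) by (simp add: field_simps)
qed

text \<open>The closed form hides the sign, since \<open>1 / 2 - s\<^sup>2 / 8\<close> becomes
  negative. It is read off from the antiderivative instead: \<open>\<Phi>\<close> increases to the
  limit \<open>0\<close>, so \<open>\<Phi> j \<le> 0\<close>.\<close>

lemma row_kern_nonneg: "kern (r * j) \<ge> 0"
proof -
  have "\<Phi> j \<le> \<Phi> x" if "x \<ge> j" for x
    by (rule DERIV_nonneg_imp_nondecreasing[OF that]) (use row_deriv row_f_nonneg in blast)
  then have "eventually (\<lambda>x. \<Phi> j \<le> \<Phi> x) at_top"
    using eventually_ge_at_top[of j] by (rule eventually_mono[rotated])
  then have "\<Phi> j \<le> 0"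
    by (rule tendsto_lowerbound[OF row_antiderivative_limit]) simp
  then show ?thesis using row_r(1) by (simp add: row_antiderivative_start zero_le_divide_iff)
qed

text \<open>Identifies \<open>kern\<close> as a row integral for every real \<open>j > 0\<close>.
  With \<open>t = 1\<close> this is the inner integral of the double integral that gives the mass of
  the kernel.\<close>

lemma row_nn_integral: "(\<integral>\<^sup>+x. ennreal (f x) * indicator {j..} x \<partial>lborel) = ennreal (kern (r * j) / r)"
proof -
  have "(\<integral>\<^sup>+x. ennreal (f x) * indicator {j..} x \<partial>lborel) = ennreal (0 - \<Phi> j)"
  proof (rule nn_integral_FTC_atLeast)
    show "f \<in> borel_measurable borel"
      unfolding f_def A_def xexp_def by measurable
  qed (rule row_deriv row_f_nonneg row_antiderivative_limit, assumption?)+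
  then show ?thesis by (simp add: row_antiderivative_start)
qed

lemma row_summable:
  assumes j1: "j \<ge> 1"
  shows "summable (\<lambda>n. f (j + real n))"
proof (rule summable_comparison_test'[where N = 0])
  show "summable (\<lambda>n. 14000 * (t * j) powr (- 5 / 4) * (j powr (- 5 / 4) * real (Suc n) powr (- 5 / 4)))"
    using zeta_real_sums[of "5 / 4"] by (intro summable_mult) (simp add: sums_iff)
  fix n :: nat
  have "f (j + real n) \<le> 14000 * (t * j) powr (- 5 / 4) * (j + real n) powr (- 5 / 2)"
    by (rule row_f_bound) simp
  also have "\<dots> \<le> 14000 * (t * j) powr (- 5 / 4) * (j powr (- 5 / 4) * real (Suc n) powr (- 5 / 4))"
    using powr_le_row[of "real (Suc n)" j] j1 by (intro mult_left_mono) auto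
  finally show "norm (f (j + real n)) \<le> \<dots>" using row_f_nonneg[of "j + real n"] by simp
qed

text \<open>Summing the trapezoidal rule over the unit cells from \<open>j\<close> on counts every
  value of \<open>f\<close> once except \<open>f j\<close>, which is counted half; doubling produces
  exactly the combination that symmetry of the pair sum asks for.\<close>

lemma row_estimate:
  assumes j1: "j \<ge> 1"
  shows "\<bar>2 * (\<Sum>n. f (j + real n)) - f j - 2 * kern (r * j) / r\<bar>
     \<le> 28000 * zeta_real (5 / 4) * t powr (- 1 / 4) * j powr (- 3 / 2)"
proof -
  have sf: "summable (\<lambda>n. f (j + real n))" by (rule row_summable[OF j1])
  have sf': "summable (\<lambda>n. f (j + real n + 1))"
    using summable_ignore_initial_segment[OF sf, of 1] by (simp add: add_ac)
  have tel: "(\<lambda>n. \<Phi> (j + real n + 1) - \<Phi> (j + real n)) sums (kern (r * j) / r)"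
    using telescope_sums[OF filterlim_compose[OF row_antiderivative_limit,
          of "\<lambda>n. j + real n" sequentially]] filterlim_real_sequentially row_antiderivative_start by (simp add: add_ac filterlim_tendsto_add_at_top[OF tendsto_const])
  let ?e = "\<lambda>n. (f (j + real n) + f (j + real n + 1)) / 2 - (\<Phi> (j + real n + 1) - \<Phi> (j + real n))"
  let ?b = "\<lambda>n. 14000 * (t * j) powr (- 1 / 4) * (j powr (- 5 / 4) * real (Suc n) powr (- 5 / 4))"
  have e: "norm (?e n) \<le> ?b n" for n
  proof -
    have "\<bar>?e n\<bar> \<le> 14000 * (t * j) powr (- 1 / 4) * (j + real n) powr (- 5 / 2)"
    proof (rule trapezoid_error)
      fix x assume "x \<in> {j + real n..j + real n + 1}"
      then have x: "x \<ge> j" "x \<ge> j + real n" by auto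
      have "\<bar>f2 x\<bar> \<le> 14000 * (t * j) powr (- 1 / 4) * x powr (- 5 / 2)" by (rule row_f2_bound[OF x(1)])
      also have "\<dots> \<le> 14000 * (t * j) powr (- 1 / 4) * (j + real n) powr (- 5 / 2)"
        using x j by (intro mult_left_mono powr_mono2') auto
      finally show "\<bar>f2 x\<bar> \<le> \<dots>" .
    qed (rule row_deriv row_deriv1 row_deriv2)+
    also have "\<dots> \<le> ?b n"
      using powr_le_row[of "real (Suc n)" j] j1 by (intro mult_left_mono) auto
    finally show ?thesis by simp
  qed
  have b: "?b sums (14000 * (t * j) powr (- 1 / 4) * (j powr (- 5 / 4) * zeta_real (5 / 4)))"
    using zeta_real_sums[of "5 / 4"] by (intro sums_mult) simp
  have "(\<Sum>n. f (j + real n + 1)) = (\<Sum>n. f (j + real n)) - f j"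
    using suminf_split_head[OF sf] by (simp add: add_ac)
  then have "?e sums (((\<Sum>n. f (j + real n)) + ((\<Sum>n. f (j + real n)) - f j)) / 2 - kern (r * j) / r)"
    using summable_sums[OF sf] summable_sums[OF sf'] by (intro sums_diff sums_divide sums_add tel) auto
  then have "\<bar>((\<Sum>n. f (j + real n)) + ((\<Sum>n. f (j + real n)) - f j)) / 2 - kern (r * j) / r\<bar> \<le>
      14000 * (t * j) powr (- 1 / 4) * (j powr (- 5 / 4) * zeta_real (5 / 4))"
    using norm_suminf_le[OF e sums_summable[OF b]] b by (simp add: sums_iff)
  also have "\<dots> = 14000 * zeta_real (5 / 4) * t powr (- 1 / 4) * j powr (- 3 / 2)"
    using t j powr_add[of j "- 1 / 4" "- 5 / 4"] by (simp add: powr_mult mult_ac)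
  finally have "2 * \<bar>((\<Sum>n. f (j + real n)) + ((\<Sum>n. f (j + real n)) - f j)) / 2 - kern (r * j) / r\<bar> \<le>
      28000 * zeta_real (5 / 4) * t powr (- 1 / 4) * j powr (- 3 / 2)"
    using mult_left_mono[of _ "14000 * zeta_real (5 / 4) * t powr (- 1 / 4) * j powr (- 3 / 2)" 2] by auto
  also have "2 * \<bar>((\<Sum>n. f (j + real n)) + ((\<Sum>n. f (j + real n)) - f j)) / 2 - kern (r * j) / r\<bar> =
     \<bar>2 * (\<Sum>n. f (j + real n)) - f j - 2 * kern (r * j) / r\<bar>"
    unfolding abs_mult_pos'[symmetric] by (simp add: abs_if field_simps)
  finally show ?thesis .
qed

end

section \<open>The mass of the kernel\<close>

text \<open>The change of variables theorem is about absolutely integrable functions; for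
  nonnegative ones integrability already gives that.\<close>

lemma has_integral_substitution_nonneg:
  fixes f g g' :: "real \<Rightarrow> real"
  assumes S: "S \<in> sets lebesgue"
    and d: "\<And>x. x \<in> S \<Longrightarrow> (g has_real_derivative g' x) (at x within S)"
    and inj: "inj_on g S"
    and nn: "\<And>y. y \<in> g ` S \<Longrightarrow> f y \<ge> 0"
    and f: "(f has_integral b) (g ` S)"
  shows "((\<lambda>x. \<bar>g' x\<bar> * f (g x)) has_integral b) S"
proof -
  have "f absolutely_integrable_on (g ` S)"
    using f nn by (intro nonnegative_absolutely_integrable_1) (auto simp: has_integral_iff)
  moreover have "integral (g ` S) f = b" using f by (simp add: has_integral_iff)
  ultimately have "(\<lambda>x. \<bar>g' x\<bar> * f (g x)) absolutely_integrable_on S \<and>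
      integral S (\<lambda>x. \<bar>g' x\<bar> * f (g x)) = b"
    using has_absolute_integral_change_of_variables_1'[OF S d inj] by blast
  then show ?thesis by (auto simp: has_integral_iff absolutely_integrable_on_def)
qed

text \<open>Substitute \<open>w = \<kappa> * u ^ 3\<close> in the integral for
  \<open>Gamma (5 / 3)\<close>: then \<open>\<kappa> * u ^ 4\<close> times \<open>du\<close> is
  \<open>u\<^sup>2 / 3\<close> times \<open>dw\<close>, and
  \<open>u\<^sup>2 = (w / \<kappa>) powr (2 / 3)\<close>.\<close>

lemma has_integral_cubic_Gamma:
  assumes k: "\<kappa> > 0"
  shows "((\<lambda>u. u * xexp (u ^ 3 * \<kappa>)) has_integral \<kappa> powr (- 2 / 3) * (Gamma (5 / 3) / 3)) {0<..}"
proof -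
  let ?f = "\<lambda>t::real. t powr (5 / 3 - 1) / exp t"
  have "(?f has_integral Gamma (5 / 3)) {0..}" by (rule Gamma_integral_real) simp
  then have f: "(?f has_integral Gamma (5 / 3)) {0<..}"
    by (rule has_integral_spike_set_eq[THEN iffD1, rotated 2])
      (auto intro: negligible_subset[of "{0}"])
  have im: "(\<lambda>u. \<kappa> * u ^ 3) ` {0<..} = {0<..}"
  proof safe
    fix y :: real assume "y > 0"
    then have "y = \<kappa> * (root 3 (y / \<kappa>)) ^ 3" "root 3 (y / \<kappa>) > 0" using k by auto
    then show "y \<in> (\<lambda>u. \<kappa> * u ^ 3) ` {0<..}" by blast
  qed (use k in auto)
  have "((\<lambda>x. \<bar>\<kappa> * (3 * x\<^sup>2)\<bar> * ?f (\<kappa> * x ^ 3)) has_integral Gamma (5 / 3)) {0<..}"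
  proof (rule has_integral_substitution_nonneg[where f = ?f and g = "\<lambda>u. \<kappa> * u ^ 3"
        and g' = "\<lambda>u. \<kappa> * (3 * u\<^sup>2)"])
    show "((\<lambda>u. \<kappa> * u ^ 3) has_real_derivative \<kappa> * (3 * x\<^sup>2)) (at x within {0<..})" for x
      by (auto intro!: derivative_eq_intros)
    show "inj_on (\<lambda>u. \<kappa> * u ^ 3) {0<..}"
      using k by (intro inj_onI) (auto simp: power_eq_iff_eq_base)
    show "(?f has_integral Gamma (5 / 3)) ((\<lambda>u. \<kappa> * u ^ 3) ` {0<..})" using f im by simp
  qed auto
  then have "((\<lambda>x. \<kappa> powr (- 2 / 3) / 3 * (\<bar>\<kappa> * (3 * x\<^sup>2)\<bar> * ?f (\<kappa> * x ^ 3))) has_integral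
      \<kappa> powr (- 2 / 3) / 3 * Gamma (5 / 3)) {0<..}"
    by (rule has_integral_mult_right)
  then have "((\<lambda>u. u * xexp (u ^ 3 * \<kappa>)) has_integral \<kappa> powr (- 2 / 3) / 3 * Gamma (5 / 3)) {0<..}"
  proof (rule has_integral_eq[rotated])
    fix x :: real assume "x \<in> {0<..}"
    then have x: "x > 0" by simp
    have "(x ^ 3) powr (2 / 3) = (x powr 3) powr (2 / 3)" using x by simp
    also have "\<dots> = x\<^sup>2" unfolding powr_powr using x by simp
    finally have "(\<kappa> * x ^ 3) powr (2 / 3) = \<kappa> powr (2 / 3) * x\<^sup>2"
      using k x by (simp add: powr_mult)
    then have f: "?f (\<kappa> * x ^ 3) = \<kappa> powr (2 / 3) * x\<^sup>2 * exp (- (\<kappa> * x ^ 3))"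
      by (simp add: exp_minus inverse_eq_divide)
    have p: "\<kappa> powr (- 2 / 3) * \<kappa> powr (2 / 3) = 1"
      using k powr_add[of \<kappa> "- 2 / 3" "2 / 3"] by simp
    have "\<kappa> powr (- 2 / 3) / 3 * (\<bar>\<kappa> * (3 * x\<^sup>2)\<bar> * ?f (\<kappa> * x ^ 3)) =
        (\<kappa> powr (- 2 / 3) * \<kappa> powr (2 / 3)) * (\<kappa> * (x\<^sup>2 * x\<^sup>2) * exp (- (\<kappa> * x ^ 3)))"
      unfolding f using k by (simp add: abs_mult)
    also have "x\<^sup>2 * x\<^sup>2 = x * x ^ 3" by (simp add: eval_nat_numeral)
    finally show "\<kappa> powr (- 2 / 3) / 3 * (\<bar>\<kappa> * (3 * x\<^sup>2)\<bar> * ?f (\<kappa> * x ^ 3)) = x * xexp (x ^ 3 * \<kappa>)"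
      unfolding p by (simp add: xexp_def mult_ac)
  qed
  then show ?thesis by simp
qed

text \<open>The substitution \<open>w = 1 / (1 + z)\<close> maps \<open>z \<ge> 1\<close> onto
  \<open>0 < w \<le> 1 / 2\<close>. Since the two Beta parameters agree, the integrand is symmetric
  about \<open>1 / 2\<close>, and this half interval carries half of the Beta integral.\<close>

lemma has_integral_half_Beta:
  "((\<lambda>z::real. (z * (1 + z) / 2) powr (- 2 / 3)) has_integral 2 powr (2 / 3) * (Beta (1 / 3) (1 / 3) / 2)) {1..}"
proof -
  let ?f = "\<lambda>w::real. w powr (1 / 3 - 1) * (1 - w) powr (1 / 3 - 1)"
  have B: "(?f has_integral Beta (1 / 3) (1 / 3)) {0..1}" by (rule has_integral_Beta_real) auto
  then have i: "?f integrable_on {0..1}" by blast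
  have i1: "?f integrable_on {0..1/2}" and i2: "?f integrable_on {1/2..1}"
    by (rule integrable_on_subinterval[OF i]; simp)+
  define h where "h = integral {1/2..1} ?f"
  have h2: "(?f has_integral h) {1/2..1}" using i2 by (simp add: h_def has_integral_integral)
  have im: "(\<lambda>x. 1 - x) ` {0..1/2} = {1/2..1::real}"
    by (auto simp: image_iff intro!: bexI[of _ "1 - x" for x])
  have "((\<lambda>x. \<bar>- 1\<bar> * ?f (1 - x)) has_integral h) {0..1/2}"
    by (rule has_integral_substitution_nonneg[where f = ?f and g = "\<lambda>x. 1 - x" and g' = "\<lambda>x. - 1"])
      (use h2 im in \<open>auto intro!: derivative_eq_intros inj_onI\<close>)
  then have h1: "(?f has_integral h) {0..1/2}" by (simp add: mult.commute)
  have "(?f has_integral (h + h)) {0..1}"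
    by (rule has_integral_combine[of 0 "1 / 2" 1]) (use h1 h2 in auto)
  then have h: "h = Beta (1 / 3) (1 / 3) / 2" using has_integral_unique[OF B] by simp
  have im: "(\<lambda>z. 1 / (1 + z)) ` {1..} = {0<..1/2::real}"
  proof safe
    fix w :: real assume "w \<in> {0<..1/2}"
    then have "w = 1 / (1 + (1 / w - 1))" "1 / w - 1 \<in> {1..}" by (auto simp: field_simps)
    then show "w \<in> (\<lambda>z. 1 / (1 + z)) ` {1..}" by blast
  qed (auto simp: field_simps)
  have "(?f has_integral h) {0<..1/2}"
    by (rule has_integral_spike_set_eq[THEN iffD1, OF _ _ h1])
      (auto intro: negligible_subset[of "{0}"])
  then have "((\<lambda>z. \<bar>- 1 / (1 + z)\<^sup>2\<bar> * ?f (1 / (1 + z))) has_integral h) {1..}"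
    unfolding im[symmetric]
  proof (intro has_integral_substitution_nonneg[where f = ?f and g = "\<lambda>z. 1 / (1 + z)"
        and g' = "\<lambda>z. - 1 / (1 + z)\<^sup>2"])
    show "((\<lambda>z. 1 / (1 + z)) has_real_derivative - 1 / (1 + z)\<^sup>2) (at z within {1..})" if "z \<in> {1..}" for z :: real
      using that by (auto simp: power2_eq_square intro!: derivative_eq_intros)
    show "inj_on (\<lambda>z::real. 1 / (1 + z)) {1..}" by (intro inj_onI) auto
  qed auto
  then have "((\<lambda>z. 2 powr (2 / 3) * (\<bar>- 1 / (1 + z)\<^sup>2\<bar> * ?f (1 / (1 + z)))) has_integral 2 powr (2 / 3) * h) {1..}"
    by (rule has_integral_mult_right)
  then show ?thesis unfolding h
  proof (rule has_integral_eq[rotated])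
    fix z :: real assume "z \<in> {1..}"
    then have z: "z \<ge> 1" by simp
    have w: "1 - 1 / (1 + z) = z / (1 + z)" using z by (simp add: field_simps)
    have "\<bar>- 1 / (1 + z)\<^sup>2\<bar> * ?f (1 / (1 + z)) =
        (1 + z) powr (- 2) * ((1 + z) powr (2 / 3) * (z powr (- 2 / 3) * (1 + z) powr (2 / 3)))"
    proof -
      have "\<bar>- 1 / (1 + z)\<^sup>2\<bar> = (1 + z) powr (- 2)" using z by (simp add: powr_minus field_simps)
      moreover have "(1 / (1 + z)) powr (1 / 3 - 1) = (1 + z) powr (2 / 3)"
        using z by (simp add: powr_divide powr_minus)
      moreover have "(z / (1 + z)) powr (1 / 3 - 1) = z powr (- 2 / 3) * (1 + z) powr (2 / 3)"
        using z by (simp add: powr_divide powr_minus field_simps)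
      ultimately show ?thesis unfolding w by simp
    qed
    also have "\<dots> = z powr (- 2 / 3) * (1 + z) powr (- 2 + (2 / 3 + 2 / 3))"
      unfolding powr_add using z by (simp add: mult_ac)
    also have "\<dots> = (z * (1 + z)) powr (- 2 / 3)"
      using z by (simp add: powr_mult)
    finally have *: "\<bar>- 1 / (1 + z)\<^sup>2\<bar> * ?f (1 / (1 + z)) = (z * (1 + z)) powr (- 2 / 3)" .
    show "2 powr (2 / 3) * (\<bar>- 1 / (1 + z)\<^sup>2\<bar> * ?f (1 / (1 + z))) = (z * (1 + z) / 2) powr (- 2 / 3)"
    proof -
      have "(z * (1 + z) / 2) powr (- 2 / 3) = 2 powr (2 / 3) * (z * (1 + z)) powr (- 2 / 3)"
        using z by (simp add: powr_divide powr_minus field_simps)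
      with * show ?thesis by simp
    qed
  qed
qed

lemma xexp_measurable [measurable]: "xexp \<in> borel_measurable borel"
  unfolding xexp_def[abs_def] by measurable

text \<open>The row integral with \<open>t = 1\<close> and \<open>j = u\<close>, rescaled by
  \<open>v = u * z\<close>; the constraint \<open>v \<ge> u\<close> becomes
  \<open>z \<ge> 1\<close>, free of \<open>u\<close>, which prepares the exchange of
  integrals.\<close>

lemma nn_integral_kern_row:
  assumes u: "u > 0"
  shows "ennreal (u powr (- 1 / 2) * kern (u powr (3 / 2))) =
    (\<integral>\<^sup>+z. ennreal (u * xexp (u ^ 3 * (z * (1 + z) / 2))) * indicator {1..} z \<partial>lborel)"
proof -
  let ?f = "\<lambda>v. xexp (1 * (u * v * (u + v) / 2))"
  have A: "(\<integral>\<^sup>+v. ennreal (?f v) * indicator {u..} v \<partial>lborel) = ennreal (kern (sqrt (1 * u) * u) / sqrt (1 * u))"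
    by (rule row_nn_integral) (use u in auto)
  have "u powr (3 / 2) = sqrt u * u"
    using u powr_add[of u "1 / 2" 1] by (simp add: powr_half_sqrt)
  moreover have "u powr (- 1 / 2) = 1 / sqrt u" using u powr_minus[of u "1 / 2"] by (simp add: powr_half_sqrt inverse_eq_divide)
  ultimately have "ennreal (u powr (- 1 / 2) * kern (u powr (3 / 2))) =
      (\<integral>\<^sup>+v. ennreal (?f v) * indicator {u..} v \<partial>lborel)"
    unfolding A by simp
  also have "\<dots> = \<bar>u\<bar> * (\<integral>\<^sup>+z. ennreal (?f (0 + u * z)) * indicator {u..} (0 + u * z) \<partial>lborel)"
    using u by (intro nn_integral_real_affine) auto
  also have "\<dots> = (\<integral>\<^sup>+z. ennreal u * (ennreal (?f (0 + u * z)) * indicator {u..} (0 + u * z)) \<partial>lborel)"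
    using u by (subst nn_integral_cmult) auto
  also have "\<dots> = (\<integral>\<^sup>+z. ennreal (u * xexp (u ^ 3 * (z * (1 + z) / 2))) * indicator {1..} z \<partial>lborel)"
  proof (rule nn_integral_cong)
    fix z :: real
    have "1 * (u * (0 + u * z) * (u + (0 + u * z)) / 2) = u ^ 3 * (z * (1 + z) / 2)"
      by (simp add: power3_eq_cube distrib_left mult_ac)
    then have e: "?f (0 + u * z) = xexp (u ^ 3 * (z * (1 + z) / 2))" by (simp only:)
    have "(indicator {u..} (0 + u * z) :: ennreal) = indicator {1..} z"
      using u by (auto simp: indicator_def)
    then show "ennreal u * (ennreal (?f (0 + u * z)) * indicator {u..} (0 + u * z)) =
       ennreal (u * xexp (u ^ 3 * (z * (1 + z) / 2))) * indicator {1..} z"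
      unfolding e using u by (simp add: ennreal_mult' mult.assoc)
  qed
  finally show ?thesis .
qed

definition kern_mass :: real where
  "kern_mass = 2 powr (2 / 3) / 9 * Gamma (1 / 3) ^ 2"

text \<open>\<open>Gamma (5 / 3) = 2 / 3 * Gamma (2 / 3)\<close> and the Beta value has
  \<open>Gamma (2 / 3)\<close> in its denominator, so this factor cancels.\<close>

lemma kern_mass_eq: "Gamma (5 / 3) / 3 * (2 powr (2 / 3) * (Beta (1 / 3) (1 / 3) / 2)) = kern_mass"
proof -
  have "Gamma (2 / 3 + 1 :: real) = 2 / 3 * Gamma (2 / 3)"
    by (rule Gamma_plus1) (auto elim!: nonpos_Ints_cases)
  then have g: "Gamma (5 / 3 :: real) = 2 / 3 * Gamma (2 / 3)" by simp
  have "Gamma (2 / 3 :: real) > 0" by (rule Gamma_real_pos) simp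
  then have "Gamma (2 / 3 :: real) \<noteq> 0" by linarith
  then show ?thesis
    unfolding g by (simp add: kern_mass_def Beta_def power2_eq_square field_simps)
qed

lemma kern_measurable [measurable]: "kern \<in> borel_measurable borel"
proof -
  have "continuous_on UNIV kern"
    using kern_deriv by (intro continuous_at_imp_continuous_on ballI) (blast intro: DERIV_isCont)
  then show ?thesis by (rule borel_measurable_continuous_onI)
qed

text \<open>After Tonelli the integral over \<open>u\<close> is a Gamma integral for each fixed
  \<open>z\<close>, and the remaining power of \<open>z * (1 + z) / 2\<close> is the half Beta
  integral.\<close>

lemma nn_integral_kern:
  "(\<integral>\<^sup>+u. ennreal (u powr (- 1 / 2) * kern (u powr (3 / 2))) * indicator {0<..} u \<partial>lborel) = ennreal kern_mass"
proof -
  let ?G = "\<lambda>u z. ennreal (u * xexp (u ^ 3 * (z * (1 + z) / 2))) * indicator {0<..} u * indicator {1..} z"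
  have "(\<integral>\<^sup>+u. ennreal (u powr (- 1 / 2) * kern (u powr (3 / 2))) * indicator {0<..} u \<partial>lborel) =
      (\<integral>\<^sup>+u. (\<integral>\<^sup>+z. ?G u z \<partial>lborel) \<partial>lborel)"
  proof (rule nn_integral_cong)
    fix u :: real
    show "ennreal (u powr (- 1 / 2) * kern (u powr (3 / 2))) * indicator {0<..} u = (\<integral>\<^sup>+z. ?G u z \<partial>lborel)"
      using nn_integral_kern_row[of u] by (cases "u > 0") auto
  qed
  also have "\<dots> = (\<integral>\<^sup>+z. (\<integral>\<^sup>+u. ?G u z \<partial>lborel) \<partial>lborel)"
    by (rule lborel_pair.Fubini') measurable
  also have "\<dots> = (\<integral>\<^sup>+z. ennreal (Gamma (5 / 3) / 3) * (ennreal ((z * (1 + z) / 2) powr (- 2 / 3)) * indicator {1..} z) \<partial>lborel)"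
  proof (rule nn_integral_cong)
    fix z :: real
    show "(\<integral>\<^sup>+u. ?G u z \<partial>lborel) = ennreal (Gamma (5 / 3) / 3) * (ennreal ((z * (1 + z) / 2) powr (- 2 / 3)) * indicator {1..} z)"
    proof (cases "z \<ge> 1")
      case True
      then have k: "z * (1 + z) / 2 > 0" by simp
      have "(\<integral>\<^sup>+u. ennreal (u * xexp (u ^ 3 * (z * (1 + z) / 2))) * indicator {0<..} u \<partial>lborel) =
          ennreal ((z * (1 + z) / 2) powr (- 2 / 3) * (Gamma (5 / 3) / 3))"
        using k by (intro nn_integral_has_integral_lebesgue' has_integral_cubic_Gamma)
          (auto intro!: mult_nonneg_nonneg xexp_nonneg)
      also have "\<dots> = ennreal (Gamma (5 / 3) / 3) * ennreal ((z * (1 + z) / 2) powr (- 2 / 3))"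
        by (subst mult.commute, rule ennreal_mult) (auto intro!: Gamma_real_nonneg)
      finally show ?thesis using True by simp
    qed simp
  qed
  also have "\<dots> = ennreal (Gamma (5 / 3) / 3) * (\<integral>\<^sup>+z. ennreal ((z * (1 + z) / 2) powr (- 2 / 3)) * indicator {1..} z \<partial>lborel)"
    by (rule nn_integral_cmult) measurable
  also have "(\<integral>\<^sup>+z. ennreal ((z * (1 + z) / 2) powr (- 2 / 3)) * indicator {1..} z \<partial>lborel) =
      ennreal (2 powr (2 / 3) * (Beta (1 / 3) (1 / 3) / 2))"
    by (intro nn_integral_has_integral_lebesgue' has_integral_half_Beta) auto
  also have "ennreal (Gamma (5 / 3) / 3) * ennreal (2 powr (2 / 3) * (Beta (1 / 3) (1 / 3) / 2)) = ennreal kern_mass"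
    by (subst ennreal_mult'[symmetric]) (auto simp: kern_mass_eq[symmetric] intro!: Gamma_real_nonneg)
  finally show ?thesis .
qed

section \<open>Summation over the rows\<close>

text \<open>The row integral \<open>kern (r * j) / r\<close>, with \<open>r = sqrt (t * j)\<close>,
  equals \<open>t powr (- 1 / 3) * kern_fun (t powr (1 / 3) * j)\<close>: in this scale the
  dependence on \<open>t\<close> disappears.\<close>

definition kern_fun :: "real \<Rightarrow> real" where
  "kern_fun u = u powr (- 1 / 2) * kern (u powr (3 / 2))"

definition kern_int :: "real \<Rightarrow> real" where
  "kern_int x = integral {0..x} kern_fun"

lemma kern_fun_nonneg:
  assumes "u \<ge> 0"
  shows "kern_fun u \<ge> 0"
proof (cases "u > 0")
  case True
  have "u powr (3 / 2) = sqrt u * u"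
    using True powr_add[of u "1 / 2" 1] by (simp add: powr_half_sqrt)
  then have "kern (u powr (3 / 2)) \<ge> 0" using row_kern_nonneg[OF zero_less_one True] by simp
  then show ?thesis by (simp add: kern_fun_def)
next
  case False
  then show ?thesis using assms by (simp add: kern_fun_def)
qed

lemma kern_fun_integral:
  "set_integrable lborel {0..} kern_fun" "set_lebesgue_integral lborel {0..} kern_fun = kern_mass"
proof -
  have m: "(\<lambda>u. indicator {0..} u * kern_fun u) \<in> borel_measurable borel"
    unfolding kern_fun_def by measurable
  have "(\<integral>\<^sup>+u. ennreal (indicator {0..} u * kern_fun u) \<partial>lborel) =
      (\<integral>\<^sup>+u. ennreal (u powr (- 1 / 2) * kern (u powr (3 / 2))) * indicator {0<..} u \<partial>lborel)"
    by (rule nn_integral_cong) (auto simp: kern_fun_def indicator_def)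
  also have "\<dots> = ennreal kern_mass" by (rule nn_integral_kern)
  finally have *: "(\<integral>\<^sup>+u. ennreal (indicator {0..} u * kern_fun u) \<partial>lborel) = ennreal kern_mass" .
  have "has_bochner_integral lborel (\<lambda>u. indicator {0..} u * kern_fun u) kern_mass"
    using m kern_fun_nonneg * by (intro has_bochner_integral_nn_integral) (auto simp: kern_mass_def indicator_def)
  then show "set_integrable lborel {0..} kern_fun" "set_lebesgue_integral lborel {0..} kern_fun = kern_mass"
    by (auto simp: set_integrable_def set_lebesgue_integral_def has_bochner_integral_iff)
qed

lemma kern_fun_integrable_on: "kern_fun integrable_on {0..x}"
  by (rule set_borel_integral_eq_integral(1)[OF set_integrable_subset[OF kern_fun_integral(1)]]) auto

lemma kern_int_continuous: "continuous_on {0..x} kern_int"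
  unfolding kern_int_def[abs_def] by (rule indefinite_integral_continuous_1[OF kern_fun_integrable_on])

lemma kern_int_0: "kern_int 0 = 0"
  by (simp add: kern_int_def)

lemma kern_int_tendsto: "(kern_int \<longlongrightarrow> kern_mass) at_top"
proof -
  have "((\<lambda>b. set_lebesgue_integral lborel {0..b} kern_fun) \<longlongrightarrow> set_lebesgue_integral lborel {0..} kern_fun) at_top"
    by (rule tendsto_set_lebesgue_integral_at_top) (auto intro: kern_fun_integral)
  moreover have "set_lebesgue_integral lborel {0..b} kern_fun = kern_int b" for b
    unfolding kern_int_def
    by (rule set_borel_integral_eq_integral(2)[OF set_integrable_subset[OF kern_fun_integral(1)]]) auto
  ultimately show ?thesis by (simp add: kern_fun_integral)
qed

lemma kern_int_deriv:
  assumes x: "x > 0"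
  shows "(kern_int has_real_derivative kern_fun x) (at x)"
proof -
  \<comment> \<open>\<open>kern_fun\<close> blows up like \<open>u powr (- 1 / 2)\<close> at
    \<open>0\<close>, so the fundamental theorem is applied on an interval bounded away from
    \<open>0\<close>, and the part below \<open>x / 2\<close> enters as a constant.\<close>
  let ?a = "x / 2"
  have c: "continuous_on {?a..x + 1} kern_fun"
  proof -
    have "continuous_on UNIV kern"
      using kern_deriv by (intro continuous_at_imp_continuous_on ballI) (blast intro: DERIV_isCont)
    then have "continuous_on {?a..x + 1} (\<lambda>u. kern (u powr (3 / 2)))"
    proof (rule continuous_on_compose2)
      show "continuous_on {?a..x + 1} (\<lambda>u. u powr (3 / 2))"
        using x by (intro continuous_intros) auto
    qed simp
    then show ?thesis unfolding kern_fun_def using x by (intro continuous_intros) auto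
  qed
  have "((\<lambda>y. integral {?a..y} kern_fun) has_real_derivative kern_fun x) (at x within {?a..x + 1})"
    by (rule integral_has_real_derivative[OF c]) (use x in auto)
  moreover have "at x within {?a..x + 1} = at x"
    by (rule at_within_interior) (use x in \<open>auto simp: interior_atLeastAtMost_real\<close>)
  ultimately have "((\<lambda>y. integral {0..?a} kern_fun + integral {?a..y} kern_fun) has_real_derivative kern_fun x) (at x)"
    by (auto intro!: derivative_eq_intros)
  then show ?thesis
  proof (rule has_field_derivative_transform_within_open[of _ _ _ "{?a<..}"])
    fix y assume "y \<in> {?a<..}"
    then show "integral {0..?a} kern_fun + integral {?a..y} kern_fun = kern_int y"
      unfolding kern_int_def using x by (intro Henstock_Kurzweil_Integration.integral_combine kern_fun_integrable_on) auto
  qed (use x in auto)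
qed

text \<open>\<open>J\<close> is the function to be summed over the rows with its singular part
  \<open>kern 0 * x powr (- 1 / 2)\<close> removed; the removed part is what yields the value of
  zeta at \<open>1 / 2\<close>. \<open>G\<close> is the antiderivative of \<open>J\<close> with
  \<open>G 0 = 0\<close>, and \<open>J1\<close>, \<open>J2\<close> are its derivatives of order one
  and two.\<close>

context
  fixes t :: real and J J1 J2 G :: "real \<Rightarrow> real"
  assumes t: "t > 0"
  defines "J \<equiv> \<lambda>x. x powr (- 1 / 2) * (kern (sqrt t * x powr (3 / 2)) - kern 0)"
    and "J1 \<equiv> \<lambda>x. - (1 / 2) * x powr (- 3 / 2) * (kern (sqrt t * x powr (3 / 2)) - kern 0)
           + 3 / 2 * sqrt t * kern1 (sqrt t * x powr (3 / 2))"
    and "J2 \<equiv> \<lambda>x. x powr (- 5 / 2) * (3 / 4 * (kern (sqrt t * x powr (3 / 2)) - kern 0)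
           - 3 / 4 * (sqrt t * x powr (3 / 2)) * kern1 (sqrt t * x powr (3 / 2))
           + 9 / 4 * (sqrt t * x powr (3 / 2))\<^sup>2 * kern2 (sqrt t * x powr (3 / 2)))"
    and "G \<equiv> \<lambda>x. t powr (- 1 / 6) * kern_int (t powr (1 / 3) * x) - 2 * kern 0 * sqrt x"
begin

lemma column_sqrt_arg: "x > 0 \<Longrightarrow> sqrt (sqrt t * x powr (3 / 2)) = t powr (1 / 4) * x powr (3 / 4)"
proof -
  have *: "sqrt (y powr a) = y powr (a / 2)" for y a :: real
    using powr_half_sqrt[of "y powr a"] by (simp add: powr_powr)
  have "sqrt t = t powr (1 / 2)" using t by (simp add: powr_half_sqrt)
  then show ?thesis by (simp only: real_sqrt_mult *) simp
qed

lemma column_deriv: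
  assumes x: "x > 0"
  shows "(G has_real_derivative J x) (at x)"
proof -
  have p: "t powr (1 / 3) * x > 0" using t x by simp
  have "((\<lambda>x. t powr (1 / 3) * x) has_real_derivative t powr (1 / 3)) (at x)"
    by (auto intro!: derivative_eq_intros)
  from DERIV_chain2[OF kern_int_deriv[OF p] this]
  have "((\<lambda>x. kern_int (t powr (1 / 3) * x)) has_real_derivative kern_fun (t powr (1 / 3) * x) * t powr (1 / 3)) (at x)" .
  then have d: "(G has_real_derivative t powr (- 1 / 6) * (kern_fun (t powr (1 / 3) * x) * t powr (1 / 3))
      - 2 * kern 0 * (inverse (sqrt x) / 2)) (at x)"
    unfolding G_def using x by (intro DERIV_diff DERIV_cmult DERIV_real_sqrt) auto
  have a: "(t powr (1 / 3) * x) powr (3 / 2) = sqrt t * x powr (3 / 2)"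
    using t x by (simp add: powr_mult powr_powr powr_half_sqrt)
  have b: "(t powr (1 / 3) * x) powr (- 1 / 2) = t powr (- 1 / 6) * x powr (- 1 / 2)"
    using t x by (simp add: powr_mult powr_powr)
  have c: "t powr (- 1 / 6) * (t powr (- 1 / 6) * t powr (1 / 3)) = 1"
    unfolding powr_add[symmetric] using t by simp
  have "inverse (sqrt x) = x powr (- 1 / 2)"
    using x powr_minus[of x "1 / 2"] by (simp add: powr_half_sqrt)
  then have "t powr (- 1 / 6) * (kern_fun (t powr (1 / 3) * x) * t powr (1 / 3)) - 2 * kern 0 * (inverse (sqrt x) / 2) =
      t powr (- 1 / 6) * (t powr (- 1 / 6) * t powr (1 / 3)) * (x powr (- 1 / 2) * kern (sqrt t * x powr (3 / 2)))
      - kern 0 * x powr (- 1 / 2)"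
    unfolding kern_fun_def a b by simp
  also have "\<dots> = J x" unfolding c J_def by (simp add: algebra_simps)
  finally show ?thesis using d by simp
qed

lemma column_arg_deriv:
  assumes x: "x > 0"
  shows "((\<lambda>x. sqrt t * x powr (3 / 2)) has_real_derivative sqrt t * (3 / 2 * x powr (1 / 2))) (at x)"
  using has_real_derivative_powr[OF x, of "3 / 2"] by (intro DERIV_cmult) simp

lemma column_deriv1:
  assumes x: "x > 0"
  shows "(J has_real_derivative J1 x) (at x)"
proof -
  have k: "((\<lambda>x. kern (sqrt t * x powr (3 / 2)) - kern 0) has_real_derivative
      kern1 (sqrt t * x powr (3 / 2)) * (sqrt t * (3 / 2 * x powr (1 / 2))) - 0) (at x)"
    by (intro DERIV_diff DERIV_chain2[OF kern_deriv column_arg_deriv[OF x]] DERIV_const)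
  have "(J has_real_derivative - 1 / 2 * x powr (- 1 / 2 - 1) * (kern (sqrt t * x powr (3 / 2)) - kern 0) +
      (kern1 (sqrt t * x powr (3 / 2)) * (sqrt t * (3 / 2 * x powr (1 / 2))) - 0) * x powr (- 1 / 2)) (at x)"
    unfolding J_def by (rule DERIV_mult[OF has_real_derivative_powr[OF x] k])
  also have "x powr (- 1 / 2 - 1) = x powr (- 3 / 2)" by simp
  also have "(kern1 (sqrt t * x powr (3 / 2)) * (sqrt t * (3 / 2 * x powr (1 / 2))) - 0) * x powr (- 1 / 2) =
      3 / 2 * sqrt t * kern1 (sqrt t * x powr (3 / 2)) * (x powr (1 / 2) * x powr (- 1 / 2))" by simp
  also have "x powr (1 / 2) * x powr (- 1 / 2) = 1" unfolding powr_add[symmetric] using x by simp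
  finally show ?thesis by (simp add: J1_def)
qed

lemma column_deriv2:
  assumes x: "x > 0"
  shows "(J1 has_real_derivative J2 x) (at x)"
proof -
  let ?s = "sqrt t * x powr (3 / 2)"
  have k: "((\<lambda>x. kern (sqrt t * x powr (3 / 2)) - kern 0) has_real_derivative
      kern1 ?s * (sqrt t * (3 / 2 * x powr (1 / 2))) - 0) (at x)"
    by (intro DERIV_diff DERIV_chain2[OF kern_deriv column_arg_deriv[OF x]] DERIV_const)
  have k1: "((\<lambda>x. kern1 (sqrt t * x powr (3 / 2))) has_real_derivative
      kern2 ?s * (sqrt t * (3 / 2 * x powr (1 / 2)))) (at x)"
    by (rule DERIV_chain2[OF kern1_deriv column_arg_deriv[OF x]])
  define r where "r = sqrt t"
  define d where "d = - (1 / 2) * (- 3 / 2 * x powr (- 3 / 2 - 1)) * (kern ?s - kern 0) +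
      (kern1 ?s * (sqrt t * (3 / 2 * x powr (1 / 2))) - 0) * (- (1 / 2) * x powr (- 3 / 2)) +
      3 / 2 * sqrt t * (kern2 ?s * (sqrt t * (3 / 2 * x powr (1 / 2))))"
  have d: "(J1 has_real_derivative d) (at x)"
    unfolding J1_def d_def
    by (intro DERIV_add DERIV_mult DERIV_cmult k k1 has_real_derivative_powr[OF x])
  have e: "x powr (- 3 / 2 - 1) = x powr (- 5 / 2)" by simp
  have e1: "x powr (1 / 2) * x powr (- 3 / 2) = x powr (- 5 / 2) * x powr (3 / 2)"
    unfolding powr_add[symmetric] by simp
  have e2: "x powr (1 / 2) = x powr (- 5 / 2) * (x powr (3 / 2))\<^sup>2"
    unfolding power2_eq_square powr_add[symmetric] by simp
  have "d = 3 / 4 * x powr (- 5 / 2) * (kern ?s - kern 0) -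
      3 / 4 * sqrt t * kern1 ?s * (x powr (1 / 2) * x powr (- 3 / 2)) +
      9 / 4 * sqrt t * sqrt t * kern2 ?s * x powr (1 / 2)"
    unfolding d_def e by (simp add: algebra_simps)
  also have "\<dots> = 3 / 4 * x powr (- 5 / 2) * (kern ?s - kern 0) -
      3 / 4 * sqrt t * kern1 ?s * (x powr (- 5 / 2) * x powr (3 / 2)) +
      9 / 4 * sqrt t * sqrt t * kern2 ?s * (x powr (- 5 / 2) * (x powr (3 / 2))\<^sup>2)"
    unfolding e1 e2[symmetric] ..
  also have "\<dots> = J2 x"
    unfolding J2_def power_mult_distrib r_def[symmetric] by (simp add: field_simps power2_eq_square)
  finally show ?thesis using d by simp
qed

lemma column_J2_bound:
  assumes x: "x > 0"
  shows "\<bar>J2 x\<bar> \<le> 13000 * t powr (1 / 4) * x powr (- 7 / 4)"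
proof -
  let ?s = "sqrt t * x powr (3 / 2)"
  have "\<bar>J2 x\<bar> \<le> x powr (- 5 / 2) * (13000 * sqrt ?s)"
    unfolding J2_def abs_mult using t
    by (intro mult_mono kern_combination_bound) auto
  also have "\<dots> = 13000 * t powr (1 / 4) * (x powr (- 5 / 2) * x powr (3 / 4))"
    unfolding column_sqrt_arg[OF x] by simp
  also have "x powr (- 5 / 2) * x powr (3 / 4) = x powr (- 7 / 4)"
    unfolding powr_add[symmetric] by simp
  finally show ?thesis .
qed

lemma column_J_bound:
  assumes x: "x > 0"
  shows "\<bar>J x\<bar> \<le> 3600 * t powr (1 / 4) * x powr (1 / 4)"
proof -
  let ?s = "sqrt t * x powr (3 / 2)"
  have "\<bar>J x\<bar> \<le> x powr (- 1 / 2) * (3600 * sqrt ?s)"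
    unfolding J_def abs_mult using t
    by (intro mult_mono kern_diff_bound) auto
  also have "\<dots> = 3600 * t powr (1 / 4) * (x powr (- 1 / 2) * x powr (3 / 4))"
    unfolding column_sqrt_arg[OF x] by simp
  also have "x powr (- 1 / 2) * x powr (3 / 4) = x powr (1 / 4)"
    unfolding powr_add[symmetric] by simp
  finally show ?thesis .
qed

lemma column_G_0: "G 0 = 0"
  by (simp add: G_def kern_int_0)

text \<open>The bound for \<open>J2\<close> blows up at \<open>0\<close>, so the trapezoidal rule
  starts at \<open>1\<close> and the cell \<open>[0, 1]\<close> is estimated directly. This is where
  the subtraction of \<open>kern 0\<close> pays: \<open>J\<close> itself is
  \<open>O(t powr (1 / 4))\<close> there.\<close>

lemma column_first_cell: "\<bar>G 1 - G 0\<bar> \<le> 3600 * t powr (1 / 4)"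
proof -
  have "continuous_on {0..1} (\<lambda>x. kern_int (t powr (1 / 3) * x))"
    by (rule continuous_on_compose2[OF kern_int_continuous[of "t powr (1 / 3)"]])
      (auto intro!: continuous_intros simp: mult_left_le)
  then have "continuous_on {0..1} G"
    unfolding G_def by (intro continuous_intros)
  then obtain l z where z: "0 < z" "z < 1" "DERIV G z :> l" "G 1 - G 0 = (1 - 0) * l"
    using MVT[of 0 1 G] column_deriv 
    by (metis DERIV_isCont zero_less_one real_differentiable_def)
  then have "l = J z" using column_deriv[of z] DERIV_unique by blast
  then have "\<bar>G 1 - G 0\<bar> \<le> 3600 * t powr (1 / 4) * z powr (1 / 4)"
    using z column_J_bound[of z] by simp
  also have "\<dots> \<le> 3600 * t powr (1 / 4) * 1"
    using z by (intro mult_left_mono powr_le1) auto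
  finally show ?thesis by simp
qed

text \<open>The constant \<open>5400\<close> is \<open>3600 / 2\<close> for the half weight of
  \<open>J 1\<close> plus \<open>3600\<close> for the first cell; the zeta value collects the
  trapezoidal errors of the other cells.\<close>

lemma column_partial_bound:
  "\<bar>(\<Sum>i<Suc m. J (real (Suc i))) - J (real (Suc m)) / 2 - G (real (Suc m))\<bar>
     \<le> (5400 + 13000 * zeta_real (7 / 4)) * t powr (1 / 4)"
proof -
  let ?e = "\<lambda>i. (J (real (Suc i)) + J (real (Suc i) + 1)) / 2 - (G (real (Suc i) + 1) - G (real (Suc i)))"
  have e: "\<bar>?e i\<bar> \<le> 13000 * t powr (1 / 4) * real (Suc i) powr (- 7 / 4)" for i
  proof (rule trapezoid_error)
    fix x assume x: "x \<in> {real (Suc i)..real (Suc i) + 1}"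
    then have "x > 0" by auto
    then have "\<bar>J2 x\<bar> \<le> 13000 * t powr (1 / 4) * x powr (- 7 / 4)" by (rule column_J2_bound)
    also have "\<dots> \<le> 13000 * t powr (1 / 4) * real (Suc i) powr (- 7 / 4)"
      using x by (intro mult_left_mono powr_mono2') auto
    finally show "\<bar>J2 x\<bar> \<le> \<dots>" .
  qed (rule column_deriv column_deriv1 column_deriv2; force)+
  have "(\<Sum>i<Suc m. J (real (Suc i))) - J (real (Suc m)) / 2 - G (real (Suc m)) =
      (J 1 / 2 - (G 1 - G 0)) + (\<Sum>i<m. ?e i)"
    by (induction m) (simp_all add: column_G_0 field_simps)
  also have "\<bar>\<dots>\<bar> \<le> \<bar>J 1\<bar> / 2 + \<bar>G 1 - G 0\<bar> + (\<Sum>i<m. \<bar>?e i\<bar>)"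
    using sum_abs[of ?e "{..<m}"] by linarith
  also have "\<dots> \<le> 3600 * t powr (1 / 4) / 2 + 3600 * t powr (1 / 4) +
      13000 * t powr (1 / 4) * zeta_real (7 / 4)"
  proof (intro add_mono column_first_cell)
    show "\<bar>J 1\<bar> / 2 \<le> 3600 * t powr (1 / 4) / 2" using column_J_bound[of 1] by simp
    have "(\<Sum>i<m. \<bar>?e i\<bar>) \<le> (\<Sum>i<m. 13000 * t powr (1 / 4) * real (Suc i) powr (- 7 / 4))"
      by (intro sum_mono e)
    also have "\<dots> = 13000 * t powr (1 / 4) * (\<Sum>i<m. real (Suc i) powr (- 7 / 4))"
      by (simp add: sum_distrib_left)
    also have "\<dots> \<le> 13000 * t powr (1 / 4) * zeta_real (7 / 4)"
    proof (rule mult_left_mono)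
      have z: "(\<lambda>n. real (Suc n) powr (- (7 / 4))) sums zeta_real (7 / 4)" by (rule zeta_real_sums) simp
      have "(\<Sum>i<m. real (Suc i) powr (- (7 / 4))) \<le> (\<Sum>i. real (Suc i) powr (- (7 / 4)))"
        using z by (intro sum_le_suminf) (auto simp: sums_iff)
      then show "(\<Sum>i<m. real (Suc i) powr (- 7 / 4)) \<le> zeta_real (7 / 4)" using z by (simp add: sums_iff)
    qed auto
    finally show "(\<Sum>i<m. \<bar>?e i\<bar>) \<le> 13000 * t powr (1 / 4) * zeta_real (7 / 4)" .
  qed
  finally show ?thesis by (simp add: algebra_simps)
qed

lemma column_summable: "summable (\<lambda>n. real (Suc n) powr (- 1 / 2) * kern (sqrt t * real (Suc n) powr (3 / 2)))"
proof (rule summable_comparison_test'[where N = 0])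
  show "summable (\<lambda>n. 1800 / sqrt t * real (Suc n) powr (- 2))"
    using zeta_real_sums[of 2] by (intro summable_mult) (simp add: sums_iff)
  fix n :: nat
  let ?x = "real (Suc n)" let ?s = "sqrt t * ?x powr (3 / 2)"
  have s: "?s > 0" using t by simp
  \<comment> \<open>One power of \<open>?s\<close> out of the quartic decay already turns
    \<open>x powr (- 1 / 2)\<close> into the summable \<open>x powr (- 2)\<close>.\<close>
  have "1 * ?s \<le> (1 + ?s) ^ 3 * (1 + ?s)" using s by (intro mult_mono one_le_power) auto
  also have "\<dots> = (1 + ?s) ^ 4" by (simp add: eval_nat_numeral)
  finally have le: "?s \<le> (1 + ?s) ^ 4" by simp
  have "\<bar>kern ?s\<bar> \<le> 1800 / (1 + ?s) ^ 4" using s by (intro kern_decay) simp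
  also have "\<dots> \<le> 1800 / ?s" using s le by (intro divide_left_mono) auto
  finally have "\<bar>?x powr (- 1 / 2) * kern ?s\<bar> \<le> ?x powr (- 1 / 2) * (1800 / ?s)"
    unfolding abs_mult by (intro mult_mono) auto
  also have "\<dots> = 1800 / sqrt t * (?x powr (- 1 / 2) * ?x powr (- (3 / 2)))"
    unfolding powr_minus[of _ "3 / 2"] by (simp add: inverse_eq_divide)
  also have "?x powr (- 1 / 2) * ?x powr (- (3 / 2)) = ?x powr (- 2)"
    unfolding powr_add[symmetric] by simp
  finally show "norm (?x powr (- 1 / 2) * kern ?s) \<le> 1800 / sqrt t * ?x powr (- 2)" by simp
qed

text \<open>Let the number of rows tend to infinity in \<open>column_partial_bound\<close>:
  \<open>kern_int\<close> tends to the mass of the kernel, the end term of \<open>J\<close>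
  vanishes, and the subtracted terms \<open>kern 0 * j powr (- 1 / 2)\<close> combine with the term
  \<open>2 * kern 0 * sqrt x\<close> of \<open>G\<close> into the sequence of
  \<open>zeta_half_limit\<close>.\<close>

lemma column_estimate:
  "\<bar>(\<Sum>n. real (Suc n) powr (- 1 / 2) * kern (sqrt t * real (Suc n) powr (3 / 2)))
      - (t powr (- 1 / 6) * kern_mass + kern 0 * zeta_real (1 / 2))\<bar>
     \<le> (5400 + 13000 * zeta_real (7 / 4)) * t powr (1 / 4)"
proof -
  let ?s = "\<lambda>n. real (Suc n) powr (- 1 / 2) * kern (sqrt t * real (Suc n) powr (3 / 2))"
  let ?h = "\<lambda>N. (\<Sum>j=1..N. real j powr (- 1 / 2)) - 2 * sqrt (real N)"
  let ?D = "\<lambda>m. (\<Sum>i<Suc m. J (real (Suc i))) - J (real (Suc m)) / 2 - G (real (Suc m))"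
  have lS: "(\<lambda>m. \<Sum>i<Suc m. ?s i) \<longlonglongrightarrow> (\<Sum>n. ?s n)"
    using LIMSEQ_Suc[OF summable_LIMSEQ[OF column_summable]] .
  have lh: "(\<lambda>m. ?h (Suc m)) \<longlonglongrightarrow> zeta_real (1 / 2)"
    by (rule LIMSEQ_Suc[OF zeta_half_limit])
  have lJ: "(\<lambda>m. J (real (Suc m))) \<longlonglongrightarrow> 0"
  proof (rule Lim_null_comparison)
    show "\<forall>\<^sub>F m in sequentially. norm (J (real (Suc m))) \<le> real (Suc m) powr (- 1 / 2) * 3600"
    proof (intro always_eventually allI)
      fix m
      have "\<bar>kern (sqrt t * real (Suc m) powr (3 / 2)) - kern 0\<bar> \<le> 3600"
        using kern_bound[of "sqrt t * real (Suc m) powr (3 / 2)"] kern_bound[of 0] t by fastforce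
      then show "norm (J (real (Suc m))) \<le> real (Suc m) powr (- 1 / 2) * 3600"
        unfolding J_def real_norm_def abs_mult by (intro mult_mono) auto
    qed
    show "(\<lambda>m. real (Suc m) powr (- 1 / 2) * 3600) \<longlonglongrightarrow> 0" by real_asymp
  qed
  have lK: "(\<lambda>m. kern_int (t powr (1 / 3) * real (Suc m))) \<longlonglongrightarrow> kern_mass"
  proof (rule filterlim_compose[OF kern_int_tendsto])
    have "t powr (1 / 3) > 0" using t by simp
    then show "filterlim (\<lambda>m. t powr (1 / 3) * real (Suc m)) at_top sequentially" by real_asymp
  qed
  have "(\<lambda>m. (\<Sum>i<Suc m. ?s i) - kern 0 * ?h (Suc m) - J (real (Suc m)) / 2 -
      t powr (- 1 / 6) * kern_int (t powr (1 / 3) * real (Suc m))) \<longlonglongrightarrow>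
      (\<Sum>n. ?s n) - kern 0 * zeta_real (1 / 2) - 0 / 2 - t powr (- 1 / 6) * kern_mass"
    by (intro tendsto_intros lS lh lJ lK) auto
  moreover have "(\<Sum>i<Suc m. ?s i) - kern 0 * ?h (Suc m) - J (real (Suc m)) / 2 -
      t powr (- 1 / 6) * kern_int (t powr (1 / 3) * real (Suc m)) = ?D m" for m
  proof -
    have "(\<Sum>i<Suc m. J (real (Suc i))) = (\<Sum>i<Suc m. ?s i) - kern 0 * (\<Sum>i<Suc m. real (Suc i) powr (- 1 / 2))"
      unfolding J_def sum_distrib_left sum_subtractf[symmetric] by (intro sum.cong) (auto simp: algebra_simps)
    moreover have "(\<Sum>i<Suc m. real (Suc i) powr (- 1 / 2)) = (\<Sum>j=1..Suc m. real j powr (- 1 / 2))"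
      by (rule sum.reindex_bij_witness[of _ "\<lambda>j. j - 1" Suc]) auto
    ultimately show ?thesis unfolding G_def by (simp only: algebra_simps)
  qed
  ultimately have "?D \<longlonglongrightarrow> (\<Sum>n. ?s n) - kern 0 * zeta_real (1 / 2) - 0 / 2 - t powr (- 1 / 6) * kern_mass"
    by (simp only:)
  then have "(\<lambda>m. \<bar>?D m\<bar>) \<longlonglongrightarrow> \<bar>(\<Sum>n. ?s n) - kern 0 * zeta_real (1 / 2) - 0 / 2 - t powr (- 1 / 6) * kern_mass\<bar>"
    by (rule tendsto_rabs)
  then have "\<bar>(\<Sum>n. ?s n) - kern 0 * zeta_real (1 / 2) - 0 / 2 - t powr (- 1 / 6) * kern_mass\<bar> \<le>
      (5400 + 13000 * zeta_real (7 / 4)) * t powr (1 / 4)"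
    by (rule tendsto_upperbound) (simp_all only: column_partial_bound always_eventually trivial_limit_sequentially not_False_eq_True simp_thms)
  also have "(\<Sum>n. ?s n) - kern 0 * zeta_real (1 / 2) - 0 / 2 - t powr (- 1 / 6) * kern_mass =
     (\<Sum>n. ?s n) - (t powr (- 1 / 6) * kern_mass + kern 0 * zeta_real (1 / 2))" by simp
  finally show ?thesis .
qed

end

section \<open>The mean\<close>

text \<open>The pairs split into \<open>j \<le> k\<close> and \<open>k < j\<close>; by symmetry the
  second part has the same sum as the strict upper triangle. Nonnegativity turns summability of the
  row sums into unordered summability over the pairs.\<close>

lemma has_sum_pos_pairs_rows:
  fixes f :: "nat \<times> nat \<Rightarrow> real"
  assumes nonneg: "\<And>j k. f (j, k) \<ge> 0" and sym: "\<And>j k. f (j, k) = f (k, j)"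
    and row: "\<And>j. j \<ge> 1 \<Longrightarrow> summable (\<lambda>n. f (j, j + n))"
    and T: "\<And>j. T j = 2 * (\<Sum>n. f (j, j + n)) - f (j, j)"
    and sT: "summable (\<lambda>i. T (Suc i))"
  shows "(f has_sum (\<Sum>i. T (Suc i))) pos_pairs"
proof -
  define R where "R j = (\<Sum>n. f (j, j + n))" for j
  have TR: "T j = 2 * R j - f (j, j)" for j
    unfolding R_def by (rule T)
  have nat_row: "((\<lambda>k. g k) has_sum s) {j..}" if "summable (\<lambda>n. g (j + n))" "(\<Sum>n. g (j + n)) = s" "\<And>k. g k \<ge> 0"
    for g :: "nat \<Rightarrow> real" and j s
  proof -
    have "((\<lambda>n. g (j + n)) has_sum s) UNIV"
      using that by (intro norm_summable_imp_has_sum) (auto simp: sums_iff)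
    also have "?this \<longleftrightarrow> (g has_sum s) {j..}"
      by (rule has_sum_reindex_bij_witness[where i = "\<lambda>n. n - j" and j = "\<lambda>n. j + n"]) auto
    finally show ?thesis .
  qed
  have R1: "((\<lambda>k. f (j, k)) has_sum R j) {j..}" if "j \<in> {1..}" for j
    using row[of j] that nonneg by (intro nat_row) (auto simp: R_def)
  have diag_le: "f (j, j) \<le> R j" if "j \<ge> 1" for j
    using sum_le_suminf[OF row[OF that], of "{0}"] nonneg by (simp add: R_def)
  have R2: "((\<lambda>k. f (j, k)) has_sum (R j - f (j, j))) {Suc j..}" if "j \<in> {1..}" for j
  proof (rule nat_row)
    show "summable (\<lambda>n. f (j, Suc j + n))"
      using summable_ignore_initial_segment[OF row[of j], of 1] that by simp
    show "(\<Sum>n. f (j, Suc j + n)) = R j - f (j, j)"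
      using suminf_split_head[OF row[of j]] that by (simp add: R_def)
  qed (rule nonneg)
  have R0: "R (Suc i) \<ge> 0" for i
    unfolding R_def by (rule suminf_nonneg[OF row nonneg]) simp
  have sR: "summable (\<lambda>i. R (Suc i))"
  proof (rule summable_comparison_test'[OF sT, of 0])
    fix i
    show "norm (R (Suc i)) \<le> T (Suc i)"
      using diag_le[of "Suc i"] TR[of "Suc i"] R0[of i] by simp
  qed
  have sD: "summable (\<lambda>i. R (Suc i) - f (Suc i, Suc i))"
  proof (rule summable_comparison_test'[OF sR, of 0])
    show "norm (R (Suc i) - f (Suc i, Suc i)) \<le> R (Suc i)" for i
      using diag_le[of "Suc i"] nonneg[of "Suc i" "Suc i"] by simp
  qed
  have U: "(f has_sum (\<Sum>i. R (Suc i))) (Sigma {1..} (\<lambda>j. {j..}))"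
  proof (rule has_sum_SigmaI[OF R1])
    have "((\<lambda>i. R (Suc i)) has_sum (\<Sum>i. R (Suc i))) UNIV"
      using sR R0 by (intro norm_summable_imp_has_sum) (auto simp: sums_iff)
    also have "?this \<longleftrightarrow> (R has_sum (\<Sum>i. R (Suc i))) {1..}"
      by (rule has_sum_reindex_bij_witness[where i = "\<lambda>n. n - 1" and j = Suc]) auto
    finally show *: "(R has_sum (\<Sum>i. R (Suc i))) {1..}" .
    show "f summable_on Sigma {1..} (\<lambda>j. {j..})"
      by (rule summable_on_SigmaI[OF R1]) (use * nonneg in \<open>auto simp: summable_on_def\<close>)
  qed
  have L: "(f has_sum (\<Sum>i. R (Suc i) - f (Suc i, Suc i))) (Sigma {1..} (\<lambda>j. {Suc j..}))"
  proof (rule has_sum_SigmaI[OF R2])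
    have "((\<lambda>i. R (Suc i) - f (Suc i, Suc i)) has_sum (\<Sum>i. R (Suc i) - f (Suc i, Suc i))) UNIV"
      using sD diag_le by (intro norm_summable_imp_has_sum) (auto simp: sums_iff)
    also have "?this \<longleftrightarrow> ((\<lambda>j. R j - f (j, j)) has_sum (\<Sum>i. R (Suc i) - f (Suc i, Suc i))) {1..}"
      by (rule has_sum_reindex_bij_witness[where i = "\<lambda>n. n - 1" and j = Suc]) auto
    finally show *: "((\<lambda>j. R j - f (j, j)) has_sum (\<Sum>i. R (Suc i) - f (Suc i, Suc i))) {1..}" .
    show "f summable_on Sigma {1..} (\<lambda>j. {Suc j..})"
      by (rule summable_on_SigmaI[OF R2]) (use * nonneg in \<open>auto simp: summable_on_def\<close>)
  qed
  note L
  also have "(f has_sum (\<Sum>i. R (Suc i) - f (Suc i, Suc i))) (Sigma {1..} (\<lambda>j. {Suc j..})) \<longleftrightarrow>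
      (f has_sum (\<Sum>i. R (Suc i) - f (Suc i, Suc i))) {(k, j). 1 \<le> j \<and> j < k}"
    by (rule has_sum_reindex_bij_witness[where i = "\<lambda>(k, j). (j, k)" and j = "\<lambda>(j, k). (k, j)"])
      (auto simp: sym)
  finally have "(f has_sum (\<Sum>i. R (Suc i) - f (Suc i, Suc i))) {(k, j). 1 \<le> j \<and> j < k}" .
  have "(f has_sum ((\<Sum>i. R (Suc i)) + (\<Sum>i. R (Suc i) - f (Suc i, Suc i))))
      (Sigma {1..} (\<lambda>j. {j..}) \<union> {(k, j). 1 \<le> j \<and> j < k})"
    by (rule has_sum_Un_disjoint[OF U \<open>(f has_sum _) {(k, j). 1 \<le> j \<and> j < k}\<close>]) auto
  also have "Sigma {1..} (\<lambda>j. {j..}) \<union> {(k, j). 1 \<le> j \<and> j < k} = pos_pairs"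
    by (auto simp: pos_pairs_def)
  also have "(\<Sum>i. R (Suc i)) + (\<Sum>i. R (Suc i) - f (Suc i, Suc i)) = (\<Sum>i. T (Suc i))"
    unfolding suminf_add[OF sR sD] by (simp add: TR)
  finally show ?thesis .
qed

text \<open>The dimension of the irreducible representation of SU(3) with labels
  \<open>(j, k)\<close>.\<close>

definition rep_dim :: "nat \<times> nat \<Rightarrow> real" where
  "rep_dim p = real (fst p * snd p * (fst p + snd p)) / 2"

lemma rep_dim_ge_1:
  assumes "p \<in> pos_pairs"
  shows "rep_dim p \<ge> 1"
proof -
  obtain j k where p: "p = (j, k)" "j \<ge> 1" "k \<ge> 1" using assms by (auto simp: pos_pairs_def)
  have "1 * 1 * (1 + 1) \<le> j * k * (j + k)" using p by (intro mult_le_mono add_mono) auto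
  then have "real 2 \<le> real (j * k * (j + k))" unfolding of_nat_le_iff by simp
  then show ?thesis by (simp add: rep_dim_def p)
qed

text \<open>The row errors carry \<open>t powr (- 1 / 4) * j powr (- 3 / 2)\<close> and add up over
  the rows. The main term of a row is \<open>2 * t powr (- 1 / 2)\<close> times the summand of
  \<open>column_estimate\<close>, whose error \<open>t powr (1 / 4)\<close> is thereby raised to the
  same order.\<close>

lemma xexp_pair_sum:
  obtains C where "C \<ge> 0" and "\<And>t. t > 0 \<Longrightarrow> \<exists>S. ((\<lambda>p. xexp (t * rep_dim p)) has_sum S) pos_pairs \<and>
    \<bar>S - (2 * kern_mass * t powr (- 2 / 3) + 2 * kern 0 * zeta_real (1 / 2) * t powr (- 1 / 2))\<bar> \<le> C * t powr (- 1 / 4)"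
proof -
  define C1 where "C1 = 28000 * zeta_real (5 / 4)"
  define C2 where "C2 = 5400 + 13000 * zeta_real (7 / 4)"
  have C0: "C1 \<ge> 0" "C2 \<ge> 0" "zeta_real (3 / 2) > 0"
    using zeta_real_pos[of "5 / 4"] zeta_real_pos[of "7 / 4"] zeta_real_pos[of "3 / 2"] by (auto simp: C1_def C2_def)
  show ?thesis
  proof (rule that[of "C1 * zeta_real (3 / 2) + 2 * C2"])
    show "C1 * zeta_real (3 / 2) + 2 * C2 \<ge> 0" using C0 by simp
    fix t :: real assume t: "t > 0"
    define f where "f p = xexp (t * rep_dim p)" for p
    define T where "T j = 2 * (\<Sum>n. f (j, j + n)) - f (j, j)" for j
    define s where "s i = real (Suc i) powr (- 1 / 2) * kern (sqrt t * real (Suc i) powr (3 / 2))" for i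
    have f_eq: "f (j, j + n) = xexp (t * (real j * (real j + real n) * (real j + (real j + real n)) / 2))" for j n
      by (simp add: f_def rep_dim_def)
    have row: "summable (\<lambda>n. f (j, j + n))" if "j \<ge> 1" for j
      unfolding f_eq by (rule row_summable) (use t that in auto)
    have Tb: "\<bar>T (Suc i) - 2 * t powr (- 1 / 2) * s i\<bar> \<le> C1 * t powr (- 1 / 4) * real (Suc i) powr (- (3 / 2))" for i
    proof -
      let ?j = "real (Suc i)"
      have "\<bar>2 * (\<Sum>n. f (Suc i, Suc i + n)) - f (Suc i, Suc i + 0) - 2 * kern (sqrt (t * ?j) * ?j) / sqrt (t * ?j)\<bar>
          \<le> C1 * t powr (- 1 / 4) * ?j powr (- 3 / 2)"
        unfolding f_eq C1_def using row_estimate[of t ?j] t by simp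
      moreover have "sqrt (t * ?j) * ?j = sqrt t * ?j powr (3 / 2)"
        using powr_add[of ?j "1 / 2" 1] by (simp add: real_sqrt_mult powr_half_sqrt)
      moreover have "2 * x / sqrt (t * ?j) = 2 * t powr (- 1 / 2) * (?j powr (- 1 / 2) * x)" for x
      proof -
        have r: "y powr (- 1 / 2) = 1 / sqrt y" if "y > 0" for y :: real
          using powr_minus_divide[of y "1 / 2"] that by (simp add: powr_half_sqrt)
        show ?thesis unfolding r[OF t] r[OF of_nat_0_less_iff[THEN iffD2, OF zero_less_Suc]]
          by (simp add: real_sqrt_mult del: of_nat_Suc)
      qed
      ultimately show ?thesis by (simp add: T_def s_def del: of_nat_Suc)
    qed
    have z: "(\<lambda>i. real (Suc i) powr (- (3 / 2))) sums zeta_real (3 / 2)" by (rule zeta_real_sums) simp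
    have ss: "summable s" unfolding s_def by (rule column_summable[OF t])
    have sb: "summable (\<lambda>i. C1 * t powr (- 1 / 4) * real (Suc i) powr (- (3 / 2)))"
      using z by (intro summable_mult) (simp add: sums_iff)
    have sd: "summable (\<lambda>i. T (Suc i) - 2 * t powr (- 1 / 2) * s i)"
      by (rule summable_comparison_test'[OF sb, of 0]) (use Tb in simp)
    have sT: "summable (\<lambda>i. T (Suc i))"
      using summable_add[OF sd summable_mult[OF ss, of "2 * t powr (- 1 / 2)"]] by simp
    have hs: "(f has_sum (\<Sum>i. T (Suc i))) pos_pairs"
      by (rule has_sum_pos_pairs_rows[OF _ _ row T_def sT])
        (use t in \<open>auto simp: f_def rep_dim_def mult_ac add_ac intro!: xexp_nonneg\<close>)
    have "\<bar>(\<Sum>i. T (Suc i)) - 2 * t powr (- 1 / 2) * (\<Sum>i. s i)\<bar> = \<bar>\<Sum>i. T (Suc i) - 2 * t powr (- 1 / 2) * s i\<bar>"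
      using sT ss by (simp add: suminf_diff[symmetric] suminf_mult summable_mult)
    also have "\<dots> \<le> (\<Sum>i. C1 * t powr (- 1 / 4) * real (Suc i) powr (- (3 / 2)))"
      using norm_suminf_le[OF _ sb, of "\<lambda>i. T (Suc i) - 2 * t powr (- 1 / 2) * s i"] Tb by simp
    also have "\<dots> = C1 * zeta_real (3 / 2) * t powr (- 1 / 4)"
      using z by (simp add: suminf_mult sums_iff)
    finally have 1: "\<bar>(\<Sum>i. T (Suc i)) - 2 * t powr (- 1 / 2) * (\<Sum>i. s i)\<bar> \<le> C1 * zeta_real (3 / 2) * t powr (- 1 / 4)" .
    let ?m = "t powr (- 1 / 6) * kern_mass + kern 0 * zeta_real (1 / 2)"
    have "\<bar>(\<Sum>i. s i) - ?m\<bar> \<le> C2 * t powr (1 / 4)"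
      unfolding s_def C2_def by (rule column_estimate[OF t])
    then have "2 * t powr (- 1 / 2) * \<bar>(\<Sum>i. s i) - ?m\<bar> \<le> 2 * t powr (- 1 / 2) * (C2 * t powr (1 / 4))"
      by (intro mult_left_mono) auto
    also have "\<dots> = 2 * C2 * (t powr (- 1 / 2) * t powr (1 / 4))" by simp
    also have "t powr (- 1 / 2) * t powr (1 / 4) = t powr (- 1 / 4)" unfolding powr_add[symmetric] by simp
    also have "2 * t powr (- 1 / 2) * \<bar>(\<Sum>i. s i) - ?m\<bar> = \<bar>2 * t powr (- 1 / 2) * (\<Sum>i. s i) - 2 * t powr (- 1 / 2) * ?m\<bar>"
      unfolding right_diff_distrib[symmetric] abs_mult by simp
    finally have 2: "\<bar>2 * t powr (- 1 / 2) * (\<Sum>i. s i) - 2 * t powr (- 1 / 2) * ?m\<bar> \<le> 2 * C2 * t powr (- 1 / 4)" .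
    have "t powr (- 1 / 2) * t powr (- 1 / 6) = t powr (- 2 / 3)" unfolding powr_add[symmetric] by simp
    then have 3: "2 * t powr (- 1 / 2) * ?m = 2 * kern_mass * t powr (- 2 / 3) + 2 * kern 0 * zeta_real (1 / 2) * t powr (- 1 / 2)"
      by (simp add: distrib_left mult.assoc[symmetric])
    show "\<exists>S. ((\<lambda>p. xexp (t * rep_dim p)) has_sum S) pos_pairs \<and>
      \<bar>S - (2 * kern_mass * t powr (- 2 / 3) + 2 * kern 0 * zeta_real (1 / 2) * t powr (- 1 / 2))\<bar>
        \<le> (C1 * zeta_real (3 / 2) + 2 * C2) * t powr (- 1 / 4)"
    proof (intro exI conjI)
      show "((\<lambda>p. xexp (t * rep_dim p)) has_sum (\<Sum>i. T (Suc i))) pos_pairs" using hs unfolding f_def .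
      show "\<bar>(\<Sum>i. T (Suc i)) - (2 * kern_mass * t powr (- 2 / 3) + 2 * kern 0 * zeta_real (1 / 2) * t powr (- 1 / 2))\<bar>
        \<le> (C1 * zeta_real (3 / 2) + 2 * C2) * t powr (- 1 / 4)"
        using 1 2 unfolding 3 distrib_right by linarith
    qed
  qed
qed

section \<open>From the sum of \<open>x * exp (- x)\<close> to the mean\<close>

definition bose :: "real \<Rightarrow> real" where
  "bose x = 1 / (exp x - 1)"

text \<open>A geometric series in which each term \<open>x * exp (- (m + 1) * x)\<close> is written
  through \<open>xexp\<close>. The \<open>m\<close>-th term then belongs to the pair sum at the
  parameter \<open>(m + 1) * t\<close>, with the weight \<open>1 / (m + 1)\<close>.\<close>

lemma bose_sums:
  assumes "x > 0"
  shows "(\<lambda>m. xexp (real (Suc m) * x) / real (Suc m)) sums (x * bose x)"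
proof -
  have "(\<lambda>m. exp (- x) ^ m) sums (1 / (1 - exp (- x)))"
    by (rule geometric_sums) (use assms in auto)
  then have "(\<lambda>m. x * exp (- x) * exp (- x) ^ m) sums (x * exp (- x) * (1 / (1 - exp (- x))))"
    by (rule sums_mult)
  moreover have "x * exp (- x) * exp (- x) ^ m = xexp (real (Suc m) * x) / real (Suc m)" for m
  proof -
    have "xexp (real (Suc m) * x) / real (Suc m) = x * exp (- (real (Suc m) * x))"
      by (simp add: xexp_def del: of_nat_Suc)
    also have "- (real (Suc m) * x) = - x + real m * (- x)" by (simp add: algebra_simps)
    finally show ?thesis unfolding exp_add exp_of_nat_mult by (simp add: mult.assoc)
  qed
  moreover have "x * exp (- x) * (1 / (1 - exp (- x))) = x * bose x"
    using assms by (simp add: bose_def exp_minus field_simps)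
  ultimately show ?thesis by simp
qed

lemma const_X_powr: "const_X powr (10 / 3) = 1 / 9 * Gamma (1 / 3) ^ 2 * zeta_real (5 / 3)"
  using zeta_real_pos[of "5 / 3"] by (simp add: const_X_def powr_powr)

lemma const_X_pos: "const_X > 0"
proof -
  have "Gamma (1 / 3 :: real) > 0" by (rule Gamma_real_pos) simp
  then have "Gamma (1 / 3 :: real) \<noteq> 0" by linarith
  then show ?thesis using zeta_real_pos[of "5 / 3"] by (simp add: const_X_def)
qed

definition mean_N :: "real \<Rightarrow> real" where
  "mean_N t = (\<Sum>\<^sub>\<infinity>p\<in>pos_pairs. rep_dim p * bose (t * rep_dim p))"

text \<open>Inserting \<open>xexp_pair_sum\<close> at \<open>(m + 1) * t\<close> with weight
  \<open>1 / (m + 1)\<close> lowers the exponents of \<open>m + 1\<close> to \<open>- 5 / 3\<close>,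
  \<open>- 3 / 2\<close> and \<open>- 5 / 4\<close>; all three are below \<open>- 1\<close>, so main
  terms and error can be summed over \<open>m\<close>. The final division by \<open>t\<close> turns
  \<open>x * bose x\<close> into the terms of the mean.\<close>

theorem mean_N_asymptotics:
  obtains C where "\<And>t. t > 0 \<Longrightarrow> (\<lambda>p. rep_dim p * bose (t * rep_dim p)) summable_on pos_pairs"
    "\<And>t. t > 0 \<Longrightarrow> \<bar>mean_N t - (2 powr (5 / 3) * const_X powr (10 / 3) * t powr (- 5 / 3)
        - const_Y / sqrt 2 * t powr (- 3 / 2))\<bar> \<le> C * t powr (- 5 / 4)"
proof -
  define a where "a = 2 * kern_mass"
  define b where "b = 2 * kern 0 * zeta_real (1 / 2)"
  obtain C where C: "C \<ge> 0" "\<And>t. t > 0 \<Longrightarrow> \<exists>S. ((\<lambda>p. xexp (t * rep_dim p)) has_sum S) pos_pairs \<and>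
    \<bar>S - (a * t powr (- 2 / 3) + b * t powr (- 1 / 2))\<bar> \<le> C * t powr (- 1 / 4)"
    unfolding a_def b_def using xexp_pair_sum by blast
  have a: "a * zeta_real (5 / 3) = 2 powr (5 / 3) * const_X powr (10 / 3)"
    using powr_add[of 2 1 "2 / 3 :: real"] unfolding const_X_powr by (simp add: a_def kern_mass_def)
  have b: "b * zeta_real (3 / 2) = - (const_Y / sqrt 2)"
    by (simp add: b_def kern_0 const_Y_def real_sqrt_divide)
  have main: "(\<lambda>p. rep_dim p * bose (t * rep_dim p)) summable_on pos_pairs \<and>
     \<bar>mean_N t - (a * zeta_real (5 / 3) * t powr (- 5 / 3) + b * zeta_real (3 / 2) * t powr (- 3 / 2))\<bar>
       \<le> C * zeta_real (5 / 4) * t powr (- 5 / 4)" if t: "t > 0" for t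
  proof -
    define S where "S s = (\<Sum>\<^sub>\<infinity>p\<in>pos_pairs. xexp (s * rep_dim p))" for s
    have hS: "((\<lambda>p. xexp (s * rep_dim p)) has_sum S s) pos_pairs"
      and eS: "\<bar>S s - (a * s powr (- 2 / 3) + b * s powr (- 1 / 2))\<bar> \<le> C * s powr (- 1 / 4)" if "s > 0" for s
      using C(2)[OF that] by (auto simp: S_def dest: infsumI has_sum_infsum[OF has_sum_imp_summable])
    let ?x = "\<lambda>m. real (Suc m)"
    have x: "?x m > 0" for m by simp
    define g where "g m = S (?x m * t) / ?x m" for m
    have z: "(\<lambda>m. ?x m powr (- c)) sums zeta_real c" if "c > 1" for c
      using that by (rule zeta_real_sums)
    have split: "(?x m * t) powr (- c) / ?x m = t powr (- c) * ?x m powr (- (c + 1))" for m c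
    proof -
      have "?x m powr (- (c + 1)) = ?x m powr (- c) / ?x m"
        using powr_diff[of "?x m" "- c" 1] by simp
      then show ?thesis using t by (simp add: powr_mult)
    qed
    define g0 where "g0 m = a * (t powr (- (2 / 3)) * ?x m powr (- (2 / 3 + 1))) + b * (t powr (- (1 / 2)) * ?x m powr (- (1 / 2 + 1)))" for m
    have e: "\<bar>g m - g0 m\<bar> \<le> C * (t powr (- (1 / 4)) * ?x m powr (- (1 / 4 + 1)))" for m
    proof -
      have "g m - g0 m = (S (?x m * t) - (a * (?x m * t) powr (- 2 / 3) + b * (?x m * t) powr (- 1 / 2))) / ?x m"
        unfolding g_def g0_def split[symmetric] by (simp add: diff_divide_distrib add_divide_distrib)
      also have "\<bar>\<dots>\<bar> \<le> C * (?x m * t) powr (- 1 / 4) / ?x m"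
        unfolding abs_divide using eS[of "?x m * t"] t by (simp add: divide_right_mono del: of_nat_Suc)
      finally show ?thesis unfolding split[symmetric] by simp
    qed
    have s0: "g0 sums (a * (t powr (- (2 / 3)) * zeta_real (2 / 3 + 1)) + b * (t powr (- (1 / 2)) * zeta_real (1 / 2 + 1)))"
      unfolding g0_def by (intro sums_add sums_mult z) auto
    have se: "(\<lambda>m. C * (t powr (- (1 / 4)) * ?x m powr (- (1 / 4 + 1)))) sums (C * (t powr (- (1 / 4)) * zeta_real (1 / 4 + 1)))"
      by (intro sums_mult z) auto
    have sd: "summable (\<lambda>m. g m - g0 m)"
      by (rule summable_comparison_test'[OF sums_summable[OF se], of 0]) (use e in simp)
    have sg: "summable g" using summable_add[OF sd sums_summable[OF s0]] by simp
    have "\<bar>(\<Sum>m. g m) - (\<Sum>m. g0 m)\<bar> = \<bar>\<Sum>m. g m - g0 m\<bar>"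
      using sg sums_summable[OF s0] by (simp add: suminf_diff)
    also have "\<dots> \<le> (\<Sum>m. C * (t powr (- (1 / 4)) * ?x m powr (- (1 / 4 + 1))))"
      using norm_suminf_le[OF _ sums_summable[OF se], of "\<lambda>m. g m - g0 m"] e by simp
    also have "\<dots> = C * (t powr (- (1 / 4)) * zeta_real (1 / 4 + 1))" using se by (simp add: sums_iff)
    also have "(\<Sum>m. g0 m) = a * (t powr (- (2 / 3)) * zeta_real (2 / 3 + 1)) + b * (t powr (- (1 / 2)) * zeta_real (1 / 2 + 1))"
      using s0 by (simp add: sums_iff)
    finally have est: "\<bar>(\<Sum>m. g m) - (a * zeta_real (5 / 3) * t powr (- (2 / 3)) + b * zeta_real (3 / 2) * t powr (- (1 / 2)))\<bar>
       \<le> C * zeta_real (5 / 4) * t powr (- (1 / 4))" by (simp add: mult_ac)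
    have g_nonneg: "g m \<ge> 0" for m
      unfolding g_def using t by (intro divide_nonneg_nonneg has_sum_nonneg[OF hS] xexp_nonneg)
        (auto simp: rep_dim_def)
    have 1: "((\<lambda>p. xexp (?x m * (t * rep_dim p)) / ?x m) has_sum g m) pos_pairs" for m
      using has_sum_cmult_left[OF hS[of "?x m * t"], of "1 / ?x m"] t x[of m]
      by (simp add: g_def mult.assoc del: of_nat_Suc)
    have 2: "(g has_sum (\<Sum>m. g m)) UNIV"
      using sg g_nonneg by (intro norm_summable_imp_has_sum) (auto simp: sums_iff)
    \<comment> \<open>All terms are nonnegative, so summability of the iterated sum gives
      summability over the product, and the order of summation may be reversed.\<close>
    have 3: "((\<lambda>(m, p). xexp (?x m * (t * rep_dim p)) / ?x m) has_sum (\<Sum>m. g m)) (UNIV \<times> pos_pairs)"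
    proof (rule has_sum_SigmaI[OF _ 2])
      show "(\<lambda>(m, p). xexp (?x m * (t * rep_dim p)) / ?x m) summable_on (UNIV \<times> pos_pairs)"
        by (rule summable_on_SigmaI[where g = g])
          (use 1 2 t in \<open>auto simp: summable_on_def rep_dim_def intro!: divide_nonneg_nonneg xexp_nonneg mult_nonneg_nonneg\<close>)
    qed (use 1 in auto)
    have 4: "((\<lambda>p. t * rep_dim p * bose (t * rep_dim p)) has_sum (\<Sum>m. g m)) pos_pairs"
    proof (rule has_sum_SigmaD)
      show "((\<lambda>(p, m). xexp (?x m * (t * rep_dim p)) / ?x m) has_sum (\<Sum>m. g m)) (pos_pairs \<times> UNIV)"
        using 3 by (subst has_sum_swap) (simp add: case_prod_unfold)
      fix p assume "p \<in> pos_pairs"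
      then have p: "t * rep_dim p > 0" using rep_dim_ge_1[of p] t by simp
      show "((\<lambda>m. case (p, m) of (p, m) \<Rightarrow> xexp (?x m * (t * rep_dim p)) / ?x m) has_sum t * rep_dim p * bose (t * rep_dim p)) UNIV"
        using bose_sums[OF p] p
        by (auto intro!: norm_summable_imp_has_sum simp: sums_iff xexp_nonneg abs_of_nonneg simp del: of_nat_Suc)
    qed
    have 5: "((\<lambda>p. rep_dim p * bose (t * rep_dim p)) has_sum (\<Sum>m. g m) / t) pos_pairs"
      using has_sum_cmult_right[OF 4, of "1 / t"] t by simp
    then have m: "mean_N t = (\<Sum>m. g m) / t" unfolding mean_N_def by (rule infsumI)
    have pw: "t powr c / t = t powr (c - 1)" for c using t by (simp add: powr_diff)
    have "\<bar>(\<Sum>m. g m) - (a * zeta_real (5 / 3) * t powr (- (2 / 3)) + b * zeta_real (3 / 2) * t powr (- (1 / 2)))\<bar> / t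
       \<le> C * zeta_real (5 / 4) * t powr (- (1 / 4)) / t"
      using est t by (intro divide_right_mono) auto
    also have "\<dots> = C * zeta_real (5 / 4) * t powr (- 5 / 4)"
      using pw[of "- (1 / 4)"] unfolding times_divide_eq_right[symmetric] by simp
    also have "\<bar>(\<Sum>m. g m) - (a * zeta_real (5 / 3) * t powr (- (2 / 3)) + b * zeta_real (3 / 2) * t powr (- (1 / 2)))\<bar> / t =
       \<bar>((\<Sum>m. g m) - (a * zeta_real (5 / 3) * t powr (- (2 / 3)) + b * zeta_real (3 / 2) * t powr (- (1 / 2)))) / t\<bar>"
      using t by (simp add: abs_divide)
    also have "((\<Sum>m. g m) - (a * zeta_real (5 / 3) * t powr (- (2 / 3)) + b * zeta_real (3 / 2) * t powr (- (1 / 2)))) / t =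
       mean_N t - (a * zeta_real (5 / 3) * t powr (- 5 / 3) + b * zeta_real (3 / 2) * t powr (- 3 / 2))"
      unfolding m diff_divide_distrib add_divide_distrib times_divide_eq_right[symmetric] pw by simp
    finally show ?thesis using 5 by (auto simp: summable_on_def)
  qed
  show ?thesis
    by (rule that[of "C * zeta_real (5 / 4)"]) (use main in \<open>auto simp: a b\<close>)
qed

section \<open>The variance and the sequence of parameters\<close>

text \<open>\<open>bose x\<close> and \<open>bose2 x\<close> are the mean and the variance of a
  geometric variable with ratio \<open>exp (- x)\<close>; moreover \<open>bose2\<close> is minus the
  derivative of \<open>bose\<close>, which links variance and mean.\<close>

definition bose2 :: "real \<Rightarrow> real" where
  "bose2 x = bose x + (bose x)\<^sup>2"

lemma bose_pos: "x > 0 \<Longrightarrow> bose x > 0"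
  by (simp add: bose_def)

lemma bose2_pos: "x > 0 \<Longrightarrow> bose2 x > 0"
  using bose_pos[of x] by (simp add: bose2_def add_pos_pos)

lemma bose_deriv:
  assumes "x > 0"
  shows "(bose has_real_derivative - bose2 x) (at x)"
proof -
  have e: "exp x - 1 > 0" using assms by simp
  have "(bose has_real_derivative - exp x / (exp x - 1)\<^sup>2) (at x)"
    unfolding bose_def[abs_def] using e
    by (auto intro!: derivative_eq_intros simp: power2_eq_square)
  also have "- exp x / (exp x - 1)\<^sup>2 = - bose2 x"
  proof -
    have "(u + 1) / u\<^sup>2 = 1 / u + (1 / u)\<^sup>2" if "u > 0" for u :: real
      using that by (simp add: field_simps power2_eq_square)
    from this[OF e] show ?thesis by (simp add: bose2_def bose_def)
  qed
  finally show ?thesis .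
qed

lemma bose_antimono: "0 < x \<Longrightarrow> x \<le> y \<Longrightarrow> bose y \<le> bose x"
  unfolding bose_def by (intro divide_left_mono) auto

lemma bose2_antimono: "0 < x \<Longrightarrow> x \<le> y \<Longrightarrow> bose2 y \<le> bose2 x"
  unfolding bose2_def using bose_pos[of y] by (intro add_mono power_mono bose_antimono) auto

lemma bose_diff_bounds:
  assumes "0 < x" "x \<le> y"
  shows "(y - x) * bose2 y \<le> bose x - bose y" "bose x - bose y \<le> (y - x) * bose2 x"
proof -
  have "(y - x) * bose2 y \<le> bose x - bose y \<and> bose x - bose y \<le> (y - x) * bose2 x"
  proof (cases "x = y")
    case False
    then have xy: "x < y" using assms by simp
    obtain z where z: "x < z" "z < y" "bose y - bose x = (y - x) * - bose2 z"
      using MVT2[OF xy, of bose "\<lambda>z. - bose2 z"] bose_deriv assms by (metis less_le_trans)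
    have "bose2 y \<le> bose2 z" "bose2 z \<le> bose2 x" using z assms by (auto intro!: bose2_antimono)
    then have "(y - x) * bose2 y \<le> (y - x) * bose2 z" "(y - x) * bose2 z \<le> (y - x) * bose2 x"
      using xy by (auto intro!: mult_left_mono)
    then show ?thesis using z(3) by simp
  qed simp
  then show "(y - x) * bose2 y \<le> bose x - bose y" "bose x - bose y \<le> (y - x) * bose2 x" by auto
qed

definition var_N :: "real \<Rightarrow> real" where
  "var_N t = (\<Sum>\<^sub>\<infinity>p\<in>pos_pairs. (rep_dim p)\<^sup>2 * bose2 (t * rep_dim p))"

lemma mean_N_summable: "t > 0 \<Longrightarrow> (\<lambda>p. rep_dim p * bose (t * rep_dim p)) summable_on pos_pairs"
  using mean_N_asymptotics by blast

lemma rep_dim_pos: "p \<in> pos_pairs \<Longrightarrow> rep_dim p > 0"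
  using rep_dim_ge_1[of p] by simp

text \<open>The decrease of \<open>bose\<close> from \<open>t / 2 * d\<close> to
  \<open>t * d\<close> dominates \<open>t / 2 * d * bose2 (t * d)\<close>, so the series is
  dominated by the one for the mean at \<open>t / 2\<close>.\<close>

lemma var_N_summable:
  assumes "t > 0"
  shows "(\<lambda>p. (rep_dim p)\<^sup>2 * bose2 (t * rep_dim p)) summable_on pos_pairs"
proof (rule summable_on_comparison_test)
  show "(\<lambda>p. rep_dim p * bose (t / 2 * rep_dim p) * (2 / t)) summable_on pos_pairs"
    using mean_N_summable[of "t / 2"] assms by (intro summable_on_cmult_left) auto
  fix p assume "p \<in> pos_pairs"
  then have d: "rep_dim p > 0" by (rule rep_dim_pos)
  have "(t * rep_dim p - t / 2 * rep_dim p) * bose2 (t * rep_dim p) \<le> bose (t / 2 * rep_dim p) - bose (t * rep_dim p)"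
    using d assms by (intro bose_diff_bounds) auto
  also have "\<dots> \<le> bose (t / 2 * rep_dim p)" using d assms bose_pos[of "t * rep_dim p"] by simp
  finally have "rep_dim p * bose2 (t * rep_dim p) \<le> bose (t / 2 * rep_dim p) * (2 / t)"
    using assms by (simp add: field_simps)
  then have "rep_dim p * (rep_dim p * bose2 (t * rep_dim p)) \<le> rep_dim p * (bose (t / 2 * rep_dim p) * (2 / t))"
    using d by (intro mult_left_mono) auto
  then show "(rep_dim p)\<^sup>2 * bose2 (t * rep_dim p) \<le> rep_dim p * bose (t / 2 * rep_dim p) * (2 / t)"
    by (simp add: power2_eq_square mult_ac)
  show "0 \<le> (rep_dim p)\<^sup>2 * bose2 (t * rep_dim p)" using d assms bose2_pos[of "t * rep_dim p"] by simp
qed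

text \<open>Replaces differentiation of the series for the mean: since \<open>bose2\<close> is
  decreasing, the difference quotient of each term lies between the variance terms at the two
  ends.\<close>

lemma mean_N_diff_bounds:
  assumes "0 < s" "s \<le> t"
  shows "(t - s) * var_N t \<le> mean_N s - mean_N t" "mean_N s - mean_N t \<le> (t - s) * var_N s"
proof -
  have m: "((\<lambda>p. rep_dim p * bose (s * rep_dim p) - rep_dim p * bose (t * rep_dim p)) has_sum (mean_N s - mean_N t)) pos_pairs"
    using assms unfolding mean_N_def 
    unfolding diff_conv_add_uminus
    by (intro has_sum_add has_sum_uminusI has_sum_infsum mean_N_summable) auto
  have v: "((\<lambda>p. (t - s) * ((rep_dim p)\<^sup>2 * bose2 (u * rep_dim p))) has_sum ((t - s) * var_N u)) pos_pairs" if "u > 0" for u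
    unfolding var_N_def using that by (intro has_sum_cmult_right has_sum_infsum var_N_summable)
  have b: "(t - s) * ((rep_dim p)\<^sup>2 * bose2 (t * rep_dim p)) \<le> rep_dim p * bose (s * rep_dim p) - rep_dim p * bose (t * rep_dim p)
     \<and> rep_dim p * bose (s * rep_dim p) - rep_dim p * bose (t * rep_dim p) \<le> (t - s) * ((rep_dim p)\<^sup>2 * bose2 (s * rep_dim p))"
    if "p \<in> pos_pairs" for p
  proof -
    have d: "rep_dim p > 0" using that by (rule rep_dim_pos)
    have "0 < s * rep_dim p" "s * rep_dim p \<le> t * rep_dim p" using d assms by auto
    from bose_diff_bounds[OF this]
    have "rep_dim p * ((t * rep_dim p - s * rep_dim p) * bose2 (t * rep_dim p)) \<le> rep_dim p * (bose (s * rep_dim p) - bose (t * rep_dim p))"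
      "rep_dim p * (bose (s * rep_dim p) - bose (t * rep_dim p)) \<le> rep_dim p * ((t * rep_dim p - s * rep_dim p) * bose2 (s * rep_dim p))"
      using d by (auto intro!: mult_left_mono)
    then show ?thesis by (simp add: power2_eq_square algebra_simps)
  qed
  show "(t - s) * var_N t \<le> mean_N s - mean_N t"
    by (rule has_sum_mono[OF v m]) (use b assms in auto)
  show "mean_N s - mean_N t \<le> (t - s) * var_N s"
    by (rule has_sum_mono[OF m v]) (use b assms in auto)
qed

definition mean_coeff :: real where
  "mean_coeff = 2 powr (5 / 3) * const_X powr (10 / 3)"

lemma mean_coeff_pos: "mean_coeff > 0"
  using const_X_pos by (simp add: mean_coeff_def)

lemma mean_N_leading: "((\<lambda>t. t powr (5 / 3) * mean_N t) \<longlongrightarrow> mean_coeff) (at_right 0)"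
proof -
  obtain C where C: "\<And>t. t > 0 \<Longrightarrow> \<bar>mean_N t - (mean_coeff * t powr (- 5 / 3)
        - const_Y / sqrt 2 * t powr (- 3 / 2))\<bar> \<le> C * t powr (- 5 / 4)"
    using mean_N_asymptotics unfolding mean_coeff_def by blast
  define b where "b = const_Y / sqrt 2"
  have "((\<lambda>t. t powr (5 / 3) * mean_N t - mean_coeff) \<longlongrightarrow> 0) (at_right 0)"
  proof (rule Lim_null_comparison)
    have "((\<lambda>t. \<bar>b\<bar> * t powr (1 / 6) + \<bar>C\<bar> * t powr (5 / 12)) \<longlongrightarrow> \<bar>b\<bar> * 0 + \<bar>C\<bar> * 0) (at_right 0)"
      by (intro tendsto_intros; real_asymp)
    then show "((\<lambda>t. \<bar>b\<bar> * t powr (1 / 6) + \<bar>C\<bar> * t powr (5 / 12)) \<longlongrightarrow> 0) (at_right 0)" by simp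
    show "\<forall>\<^sub>F t in at_right 0. norm (t powr (5 / 3) * mean_N t - mean_coeff) \<le> \<bar>b\<bar> * t powr (1 / 6) + \<bar>C\<bar> * t powr (5 / 12)"
      unfolding eventually_at_right_field
    proof (intro exI[of _ 1] conjI allI impI)
      fix t :: real assume t: "0 < t" "t < 1"
      have p: "t powr (5 / 3) * t powr (- 5 / 3) = 1" "t powr (5 / 3) * t powr (- 3 / 2) = t powr (1 / 6)"
        "t powr (5 / 3) * t powr (- 5 / 4) = t powr (5 / 12)"
        using t unfolding powr_add[symmetric] by auto
      have "t powr (5 / 3) * \<bar>mean_N t - (mean_coeff * t powr (- 5 / 3) - b * t powr (- 3 / 2))\<bar> \<le>
          t powr (5 / 3) * (\<bar>C\<bar> * t powr (- 5 / 4))"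
      proof (rule mult_left_mono)
        have "C * t powr (- 5 / 4) \<le> \<bar>C\<bar> * t powr (- 5 / 4)" by (intro mult_right_mono) auto
        then show "\<bar>mean_N t - (mean_coeff * t powr (- 5 / 3) - b * t powr (- 3 / 2))\<bar> \<le> \<bar>C\<bar> * t powr (- 5 / 4)"
          using C[OF t(1)] unfolding b_def by linarith
      qed auto
      also have "\<dots> = \<bar>C\<bar> * t powr (5 / 12)" unfolding p(3)[symmetric] by simp
      also have "t powr (5 / 3) * \<bar>mean_N t - (mean_coeff * t powr (- 5 / 3) - b * t powr (- 3 / 2))\<bar> =
          \<bar>t powr (5 / 3) * (mean_N t - (mean_coeff * t powr (- 5 / 3) - b * t powr (- 3 / 2)))\<bar>"
        by (simp add: abs_mult)
      also have "t powr (5 / 3) * (mean_N t - (mean_coeff * t powr (- 5 / 3) - b * t powr (- 3 / 2))) =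
          t powr (5 / 3) * mean_N t - mean_coeff * (t powr (5 / 3) * t powr (- 5 / 3)) + b * (t powr (5 / 3) * t powr (- 3 / 2))"
        by (simp add: algebra_simps)
      also have "\<dots> = t powr (5 / 3) * mean_N t - mean_coeff + b * t powr (1 / 6)" unfolding p by simp
      finally have "\<bar>t powr (5 / 3) * mean_N t - mean_coeff + b * t powr (1 / 6)\<bar> \<le> \<bar>C\<bar> * t powr (5 / 12)" .
      moreover have "\<bar>b * t powr (1 / 6)\<bar> = \<bar>b\<bar> * t powr (1 / 6)" by (simp add: abs_mult)
      ultimately show "norm (t powr (5 / 3) * mean_N t - mean_coeff) \<le> \<bar>b\<bar> * t powr (1 / 6) + \<bar>C\<bar> * t powr (5 / 12)"
        unfolding real_norm_def by linarith
    qed simp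
  qed
  then show ?thesis by (simp add: LIM_zero_iff)
qed

lemma mean_N_leading_scaled:
  assumes "c > 0"
  shows "((\<lambda>t. t powr (5 / 3) * mean_N (c * t)) \<longlongrightarrow> c powr (- 5 / 3) * mean_coeff) (at_right 0)"
proof -
  have "filterlim (\<lambda>t. c * t) (at_right 0) (at_right 0)"
    using assms by real_asymp
  from tendsto_mult[OF tendsto_const[of "c powr (- 5 / 3)"] filterlim_compose[OF mean_N_leading this]]
  have "((\<lambda>t. c powr (- 5 / 3) * ((c * t) powr (5 / 3) * mean_N (c * t))) \<longlongrightarrow> c powr (- 5 / 3) * mean_coeff) (at_right 0)" .
  moreover have "\<forall>\<^sub>F t in at_right 0. c powr (- 5 / 3) * ((c * t) powr (5 / 3) * mean_N (c * t)) = t powr (5 / 3) * mean_N (c * t)"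
    unfolding eventually_at_right_field
  proof (intro exI[of _ 1] conjI allI impI)
    fix t :: real assume t: "0 < t" "t < 1"
    have "c powr (- 5 / 3) * c powr (5 / 3) = 1" using assms unfolding powr_add[symmetric] by simp
    then show "c powr (- 5 / 3) * ((c * t) powr (5 / 3) * mean_N (c * t)) = t powr (5 / 3) * mean_N (c * t)"
      using assms t by (simp add: powr_mult mult.assoc[symmetric])
  qed simp
  ultimately show ?thesis by (rule Lim_transform_eventually)
qed

text \<open>An asymptotic formula cannot be differentiated in general, but here the variance is
  squeezed by difference quotients of the mean between \<open>t\<close> and
  \<open>(1 + e) * t\<close> or \<open>(1 - e) * t\<close>. For fixed \<open>e\<close> these
  converge after scaling, and their limits tend to \<open>5 / 3 * mean_coeff\<close> as
  \<open>e\<close> tends to \<open>0\<close>; so \<open>e\<close> is chosen before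
  \<open>t\<close>.\<close>

lemma var_N_leading: "((\<lambda>t. t powr (8 / 3) * var_N t) \<longlongrightarrow> 5 / 3 * mean_coeff) (at_right 0)"
proof (rule order_tendstoI)
  have p: "t powr (8 / 3) = t * t powr (5 / 3)" if "t > 0" for t :: real
    using powr_add[of t 1 "5 / 3"] that by simp
  {
    fix a assume a: "a < 5 / 3 * mean_coeff"
    have "((\<lambda>e::real. (1 - (1 + e) powr (- 5 / 3)) / e) \<longlongrightarrow> 5 / 3) (at_right 0)" by real_asymp
    then have "((\<lambda>e. (1 - (1 + e) powr (- 5 / 3)) / e * mean_coeff) \<longlongrightarrow> 5 / 3 * mean_coeff) (at_right 0)"
      by (rule tendsto_mult[OF _ tendsto_const])
    from order_tendstoD(1)[OF this a] have "\<forall>\<^sub>F e in at_right 0. a < (1 - (1 + e) powr (- 5 / 3)) / e * mean_coeff" .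
    then obtain e where e: "e > 0" "a < (1 - (1 + e) powr (- 5 / 3)) / e * mean_coeff"
      unfolding eventually_at_right_field by (metis dense)
    have "((\<lambda>t. (t powr (5 / 3) * mean_N t - t powr (5 / 3) * mean_N ((1 + e) * t)) / e) \<longlongrightarrow>
        (mean_coeff - (1 + e) powr (- 5 / 3) * mean_coeff) / e) (at_right 0)"
      using e by (intro tendsto_intros mean_N_leading mean_N_leading_scaled) auto
    also have "(mean_coeff - (1 + e) powr (- 5 / 3) * mean_coeff) / e = (1 - (1 + e) powr (- 5 / 3)) / e * mean_coeff"
      by (simp add: algebra_simps)
    finally have "\<forall>\<^sub>F t in at_right 0. a < (t powr (5 / 3) * mean_N t - t powr (5 / 3) * mean_N ((1 + e) * t)) / e"
      by (rule order_tendstoD(1)[OF _ e(2)])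
    moreover have "\<forall>\<^sub>F t in at_right (0::real). t > 0" by (rule eventually_at_right_less)
    ultimately show "\<forall>\<^sub>F t in at_right 0. a < t powr (8 / 3) * var_N t"
    proof eventually_elim
      case (elim t)
      have "mean_N t - mean_N ((1 + e) * t) \<le> ((1 + e) * t - t) * var_N t"
        using elim e by (intro mean_N_diff_bounds) auto
      then have "t powr (5 / 3) * (mean_N t - mean_N ((1 + e) * t)) \<le> t powr (5 / 3) * (e * t * var_N t)"
        by (intro mult_left_mono) (auto simp: algebra_simps)
      then have "(t powr (5 / 3) * mean_N t - t powr (5 / 3) * mean_N ((1 + e) * t)) / e \<le> t powr (8 / 3) * var_N t"
        using e elim by (simp add: p field_simps)
      then show ?case using elim by linarith
    qed
  next
    fix a assume a: "a > 5 / 3 * mean_coeff"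
    have "((\<lambda>e::real. ((1 - e) powr (- 5 / 3) - 1) / e) \<longlongrightarrow> 5 / 3) (at_right 0)" by real_asymp
    then have "((\<lambda>e. ((1 - e) powr (- 5 / 3) - 1) / e * mean_coeff) \<longlongrightarrow> 5 / 3 * mean_coeff) (at_right 0)"
      by (rule tendsto_mult[OF _ tendsto_const])
    from order_tendstoD(2)[OF this a] have "\<forall>\<^sub>F e in at_right 0. a > ((1 - e) powr (- 5 / 3) - 1) / e * mean_coeff" .
    moreover have "\<forall>\<^sub>F e in at_right (0::real). e < 1"
      unfolding eventually_at_right_field by (rule exI[of _ 1]) auto
    ultimately have "\<forall>\<^sub>F e in at_right 0. a > ((1 - e) powr (- 5 / 3) - 1) / e * mean_coeff \<and> e < 1"
      by eventually_elim auto
    then obtain e where e: "e > 0" "e < 1" "a > ((1 - e) powr (- 5 / 3) - 1) / e * mean_coeff"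
      unfolding eventually_at_right_field by (metis dense)
    have "((\<lambda>t. (t powr (5 / 3) * mean_N ((1 - e) * t) - t powr (5 / 3) * mean_N t) / e) \<longlongrightarrow>
        ((1 - e) powr (- 5 / 3) * mean_coeff - mean_coeff) / e) (at_right 0)"
      using e by (intro tendsto_intros mean_N_leading mean_N_leading_scaled) auto
    also have "((1 - e) powr (- 5 / 3) * mean_coeff - mean_coeff) / e = ((1 - e) powr (- 5 / 3) - 1) / e * mean_coeff"
      by (simp add: algebra_simps)
    finally have "\<forall>\<^sub>F t in at_right 0. a > (t powr (5 / 3) * mean_N ((1 - e) * t) - t powr (5 / 3) * mean_N t) / e"
      by (rule order_tendstoD(2)[OF _ e(3)])
    moreover have "\<forall>\<^sub>F t in at_right (0::real). t > 0" by (rule eventually_at_right_less)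
    ultimately show "\<forall>\<^sub>F t in at_right 0. a > t powr (8 / 3) * var_N t"
    proof eventually_elim
      case (elim t)
      have "(t - (1 - e) * t) * var_N t \<le> mean_N ((1 - e) * t) - mean_N t"
        using elim e by (intro mean_N_diff_bounds) auto
      then have "t powr (5 / 3) * (e * t * var_N t) \<le> t powr (5 / 3) * (mean_N ((1 - e) * t) - mean_N t)"
        by (intro mult_left_mono) (auto simp: algebra_simps)
      then have "t powr (8 / 3) * var_N t \<le> (t powr (5 / 3) * mean_N ((1 - e) * t) - t powr (5 / 3) * mean_N t) / e"
        using e elim by (simp add: p field_simps)
      then show ?case using elim by linarith
    qed
  }
qed

section \<open>Mean and variance along the sequence of parameters\<close>

lemma tau1_pos: "tau1 > 0"
  using const_X_pos by (simp add: tau1_def)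

lemma t_seq_asymp: "(\<lambda>n. t_seq n / real n powr (- 3 / 5)) \<longlonglongrightarrow> tau1"
proof -
  have "(\<lambda>n. tau1 - tau2 * real n powr (- 1 / 10) - tau3 * real n powr (- 1 / 5)) \<longlonglongrightarrow> tau1 - tau2 * 0 - tau3 * 0"
    by (intro tendsto_intros; real_asymp)
  then have "(\<lambda>n. tau1 - tau2 * real n powr (- 1 / 10) - tau3 * real n powr (- 1 / 5)) \<longlonglongrightarrow> tau1" by simp
  then show ?thesis
  proof (rule Lim_transform_eventually)
    show "\<forall>\<^sub>F n in sequentially. tau1 - tau2 * real n powr (- 1 / 10) - tau3 * real n powr (- 1 / 5) = t_seq n / real n powr (- 3 / 5)"
      using eventually_gt_at_top[of 0]
    proof eventually_elim
      case (elim n)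
      have "real n powr (- 7 / 10) = real n powr (- 1 / 10) * real n powr (- 3 / 5)"
        "real n powr (- 4 / 5) = real n powr (- 1 / 5) * real n powr (- 3 / 5)"
        unfolding powr_add[symmetric] by auto
      moreover have "real n powr (- 3 / 5) > 0" using elim by simp
      ultimately show ?case unfolding t_seq_def by (simp add: field_simps)
    qed
  qed
qed

lemma t_seq_pos: "\<forall>\<^sub>F n in sequentially. t_seq n > 0"
proof -
  have "\<forall>\<^sub>F n in sequentially. t_seq n / real n powr (- 3 / 5) > 0"
    by (rule order_tendstoD(1)[OF t_seq_asymp tau1_pos])
  then show ?thesis using eventually_gt_at_top[of 0] by eventually_elim (simp add: zero_less_divide_iff)
qed

lemma t_seq_at_right_0: "filterlim t_seq (at_right 0) sequentially"
  unfolding filterlim_at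
proof
  have "(\<lambda>n. t_seq n / real n powr (- 3 / 5) * real n powr (- 3 / 5)) \<longlonglongrightarrow> tau1 * 0"
    by (intro tendsto_mult t_seq_asymp) real_asymp
  moreover have "\<forall>\<^sub>F n in sequentially. t_seq n / real n powr (- 3 / 5) * real n powr (- 3 / 5) = t_seq n"
    using eventually_gt_at_top[of 0] by eventually_elim simp
  ultimately show "t_seq \<longlonglongrightarrow> 0" by (auto dest: Lim_transform_eventually)
  show "\<forall>\<^sub>F n in sequentially. t_seq n \<in> {0<..} \<and> t_seq n \<noteq> 0"
    using t_seq_pos by eventually_elim auto
qed

lemma var_seq_asymp: "(\<lambda>n. var_N (t_seq n) / real n powr (8 / 5)) \<longlonglongrightarrow> 5 / (6 * const_X\<^sup>2)"
proof -
  have "(\<lambda>n. (t_seq n powr (8 / 3) * var_N (t_seq n)) * (t_seq n / real n powr (- 3 / 5)) powr (- 8 / 3)) \<longlonglongrightarrow>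
      (5 / 3 * mean_coeff) * tau1 powr (- 8 / 3)"
    using tau1_pos by (intro tendsto_intros filterlim_compose[OF var_N_leading t_seq_at_right_0] t_seq_asymp) auto
  also have "(5 / 3 * mean_coeff) * tau1 powr (- 8 / 3) = 5 / (6 * const_X\<^sup>2)"
  proof -
    have "tau1 powr (- 8 / 3) = 2 powr (- 8 / 3) * (const_X powr 2) powr (- 8 / 3)"
      unfolding tau1_def using const_X_pos by (simp add: powr_mult)
    also have "\<dots> = 2 powr (- 8 / 3) * const_X powr (- 16 / 3)" by (simp add: powr_powr)
    finally have "(5 / 3 * mean_coeff) * tau1 powr (- 8 / 3) =
       5 / 3 * (2 powr (5 / 3) * 2 powr (- 8 / 3)) * (const_X powr (10 / 3) * const_X powr (- 16 / 3))"
      by (simp add: mean_coeff_def)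
    also have "2 powr (5 / 3) * 2 powr (- 8 / 3) = (1 / 2 :: real)" unfolding powr_add[symmetric] by (simp add: powr_minus)
    also have "const_X powr (10 / 3) * const_X powr (- 16 / 3) = 1 / const_X\<^sup>2"
      unfolding powr_add[symmetric] using const_X_pos by (simp add: powr_minus inverse_eq_divide)
    finally show ?thesis by simp
  qed
  finally show ?thesis
  proof (rule Lim_transform_eventually)
    show "\<forall>\<^sub>F n in sequentially. (t_seq n powr (8 / 3) * var_N (t_seq n)) * (t_seq n / real n powr (- 3 / 5)) powr (- 8 / 3) =
        var_N (t_seq n) / real n powr (8 / 5)"
      using t_seq_pos eventually_gt_at_top[of 0]
    proof eventually_elim
      case (elim n)
      have "(t_seq n / real n powr (- 3 / 5)) powr (- 8 / 3) = t_seq n powr (- 8 / 3) / real n powr (8 / 5)"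
        using elim by (simp add: powr_divide powr_powr)
      moreover have "t_seq n powr (8 / 3) * t_seq n powr (- 8 / 3) = 1"
        unfolding powr_add[symmetric] using elim by simp
      ultimately show ?case by (simp add: mult_ac)
    qed
  qed
qed

text \<open>With \<open>z = const_Y / const_X ^ 3 * n powr (- 1 / 10)\<close>, the factor \<open>1 - 3 / 20 * z - 3 / 800 * z\<^sup>2\<close> is
  \<open>t_seq n / (tau1 * n powr (- 3 / 5))\<close>: \<open>tau2\<close> and \<open>tau3\<close> are the values that cancel the
  coefficients of \<open>z\<close> and \<open>z\<^sup>2\<close>.\<close>

lemma numeric_expansion:
  "((\<lambda>z::real. ((1 - 3 / 20 * z - 3 / 800 * z\<^sup>2) powr (- 5 / 3) - 1
      - z / 4 * (1 - 3 / 20 * z - 3 / 800 * z\<^sup>2) powr (- 3 / 2)) / z\<^sup>2) \<longlongrightarrow> 0) (at 0)"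
  by real_asymp

text \<open>With \<open>t_seq n = tau1 * n powr (- 3 / 5) * w n\<close> the two main terms of the
  mean become \<open>n * w powr (- 5 / 3)\<close> and \<open>n * z / 4 * w powr (- 3 / 2)\<close>.
  Since \<open>n powr (4 / 5) = n * (n powr (- 1 / 10))\<^sup>2\<close>, agreement with
  \<open>n\<close> is needed up to \<open>o(z\<^sup>2)\<close>, which
  \<open>numeric_expansion\<close> supplies.\<close>

lemma mean_seq_asymp: "(\<lambda>n. (mean_N (t_seq n) - real n) / real n powr (4 / 5)) \<longlonglongrightarrow> 0"
proof -
  obtain C where C: "\<And>t. t > 0 \<Longrightarrow> \<bar>mean_N t - (mean_coeff * t powr (- 5 / 3)
        - const_Y / sqrt 2 * t powr (- 3 / 2))\<bar> \<le> C * t powr (- 5 / 4)"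
    using mean_N_asymptotics unfolding mean_coeff_def by blast
  define y where "y = const_Y / const_X ^ 3"
  define z where "z n = y * real n powr (- 1 / 10)" for n :: nat
  define w where "w n = 1 - 3 / 20 * z n - 3 / 800 * (z n)\<^sup>2" for n
  have X: "const_X > 0" by (rule const_X_pos)
  have tw: "t_seq n = tau1 * real n powr (- 3 / 5) * w n" if "n > 0" for n
  proof -
    have p: "real n powr (- 7 / 10) = real n powr (- 1 / 10) * real n powr (- 3 / 5)"
      "real n powr (- 4 / 5) = (real n powr (- 1 / 10))\<^sup>2 * real n powr (- 3 / 5)"
      unfolding power2_eq_square powr_add[symmetric] by auto
    have t2: "tau2 = tau1 * (3 / 20 * y)"
      using X by (simp add: tau2_def tau1_def y_def powr_minus field_simps eval_nat_numeral)
    have t3: "tau3 = tau1 * (3 / 800 * y\<^sup>2)"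
    proof -
      have "const_X powr (- 4) = 1 / const_X ^ 4" using X by (simp add: powr_minus inverse_eq_divide)
      then show ?thesis using X by (simp add: tau3_def tau1_def y_def field_simps eval_nat_numeral)
    qed
    show ?thesis unfolding t_seq_def w_def z_def p t2 t3 power_mult_distrib
      by (simp add: algebra_simps)
  qed
  have c1: "mean_coeff * tau1 powr (- 5 / 3) = 1"
  proof -
    have "tau1 powr (- 5 / 3) = 2 powr (- 5 / 3) * (const_X powr 2) powr (- 5 / 3)"
      unfolding tau1_def using X by (simp add: powr_mult)
    also have "\<dots> = 2 powr (- 5 / 3) * const_X powr (- 10 / 3)" by (simp add: powr_powr)
    finally have "mean_coeff * tau1 powr (- 5 / 3) =
       (2 powr (5 / 3) * 2 powr (- 5 / 3)) * (const_X powr (10 / 3) * const_X powr (- 10 / 3))"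
      by (simp add: mean_coeff_def)
    then show ?thesis unfolding powr_add[symmetric] using X by simp
  qed
  have c2: "const_Y / sqrt 2 * tau1 powr (- 3 / 2) = y / 4"
  proof -
    have "tau1 powr (- 3 / 2) = 2 powr (- 3 / 2) * (const_X powr 2) powr (- 3 / 2)"
      unfolding tau1_def using X by (simp add: powr_mult)
    also have "\<dots> = 2 powr (- 3 / 2) * const_X powr (- 3)" by (simp add: powr_powr)
    also have "const_X powr (- 3) = 1 / const_X ^ 3" using X by (simp add: powr_minus inverse_eq_divide)
    also have "2 powr (- 3 / 2) = 1 / (2 * sqrt 2 :: real)"
      using powr_add[of "2::real" "- 1" "- (1 / 2)"] powr_minus_divide[of "2::real" "1 / 2"]
      by (simp add: powr_half_sqrt powr_minus_divide)
    finally show ?thesis by (simp add: y_def)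
  qed
  have main: "(\<lambda>n. (w n powr (- 5 / 3) - 1 - z n / 4 * w n powr (- 3 / 2)) / (real n powr (- 1 / 10))\<^sup>2) \<longlonglongrightarrow> 0"
  \<comment> \<open>For \<open>y = 0\<close> the sequence \<open>z\<close> is identically
    \<open>0\<close>, so it does not approach \<open>0\<close> through nonzero values as the limit
    in \<open>numeric_expansion\<close> requires; but then \<open>w\<close> is \<open>1\<close> and
    the numerator vanishes.\<close>
  proof (cases "y = 0")
    case True
    then show ?thesis by (simp add: w_def z_def)
  next
    case False
    have "filterlim z (at 0) sequentially"
      unfolding filterlim_at
    proof
      show "\<forall>\<^sub>F n in sequentially. z n \<in> UNIV \<and> z n \<noteq> 0"
        using eventually_gt_at_top[of 0] by eventually_elim (use False in \<open>simp add: z_def\<close>)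
      have "(\<lambda>n. y * real n powr (- 1 / 10)) \<longlonglongrightarrow> y * 0" by (intro tendsto_intros) real_asymp
      then show "z \<longlonglongrightarrow> 0" unfolding z_def by simp
    qed
    from tendsto_mult[OF tendsto_const[of "y\<^sup>2"] filterlim_compose[OF numeric_expansion this]]
    have "(\<lambda>n. y\<^sup>2 * ((w n powr (- 5 / 3) - 1 - z n / 4 * w n powr (- 3 / 2)) / (z n)\<^sup>2)) \<longlonglongrightarrow> 0"
      unfolding w_def by simp
    moreover have "y\<^sup>2 * (u / (z n)\<^sup>2) = u / (real n powr (- 1 / 10))\<^sup>2" for u n
      using False by (simp add: z_def power_mult_distrib)
    ultimately show ?thesis by simp
  qed
  define e where "e t = mean_N t - (mean_coeff * t powr (- 5 / 3) - const_Y / sqrt 2 * t powr (- 3 / 2))" for t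
  \<comment> \<open>The error \<open>t powr (- 5 / 4)\<close> has order
    \<open>n powr (3 / 4)\<close>, which leaves the factor \<open>n powr (- 1 / 20)\<close>.\<close>
  have err: "(\<lambda>n. e (t_seq n) / real n powr (4 / 5)) \<longlonglongrightarrow> 0"
  proof (rule Lim_null_comparison)
    have "(\<lambda>n. \<bar>C\<bar> * (t_seq n / real n powr (- 3 / 5)) powr (- 5 / 4) * real n powr (- 1 / 20)) \<longlonglongrightarrow>
        \<bar>C\<bar> * tau1 powr (- 5 / 4) * 0"
      using tau1_pos by (intro tendsto_intros t_seq_asymp) (auto, real_asymp)
    then show "(\<lambda>n. \<bar>C\<bar> * (t_seq n / real n powr (- 3 / 5)) powr (- 5 / 4) * real n powr (- 1 / 20)) \<longlonglongrightarrow> 0" by simp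
    show "\<forall>\<^sub>F n in sequentially. norm (e (t_seq n) / real n powr (4 / 5)) \<le>
        \<bar>C\<bar> * (t_seq n / real n powr (- 3 / 5)) powr (- 5 / 4) * real n powr (- 1 / 20)"
      using t_seq_pos eventually_gt_at_top[of 0]
    proof eventually_elim
      case (elim n)
      have "\<bar>e (t_seq n)\<bar> \<le> C * t_seq n powr (- 5 / 4)" unfolding e_def by (rule C[OF elim(1)])
      also have "\<dots> \<le> \<bar>C\<bar> * t_seq n powr (- 5 / 4)" by (intro mult_right_mono) auto
      finally have "\<bar>e (t_seq n)\<bar> / real n powr (4 / 5) \<le> \<bar>C\<bar> * t_seq n powr (- 5 / 4) / real n powr (4 / 5)"
        by (intro divide_right_mono) auto
      also have "(t_seq n / real n powr (- 3 / 5)) powr (- 5 / 4) = t_seq n powr (- 5 / 4) / real n powr (3 / 4)"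
        using elim by (simp add: powr_divide powr_powr)
      then have "\<bar>C\<bar> * t_seq n powr (- 5 / 4) / real n powr (4 / 5) =
          \<bar>C\<bar> * (t_seq n / real n powr (- 3 / 5)) powr (- 5 / 4) * (real n powr (3 / 4) / real n powr (4 / 5))"
        using elim by simp
      also have "real n powr (3 / 4) / real n powr (4 / 5) = real n powr (- 1 / 20)"
        unfolding powr_diff[symmetric] by simp
      finally show ?case by (simp add: abs_divide)
    qed
  qed
  have "(\<lambda>n. (w n powr (- 5 / 3) - 1 - z n / 4 * w n powr (- 3 / 2)) / (real n powr (- 1 / 10))\<^sup>2
      + e (t_seq n) / real n powr (4 / 5)) \<longlonglongrightarrow> 0 + 0"
    by (intro tendsto_add main err)
  then have "(\<lambda>n. (w n powr (- 5 / 3) - 1 - z n / 4 * w n powr (- 3 / 2)) / (real n powr (- 1 / 10))\<^sup>2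
      + e (t_seq n) / real n powr (4 / 5)) \<longlonglongrightarrow> 0" by simp
  then show ?thesis
  proof (rule Lim_transform_eventually)
    show "\<forall>\<^sub>F n in sequentially. (w n powr (- 5 / 3) - 1 - z n / 4 * w n powr (- 3 / 2)) / (real n powr (- 1 / 10))\<^sup>2
      + e (t_seq n) / real n powr (4 / 5) = (mean_N (t_seq n) - real n) / real n powr (4 / 5)"
      using t_seq_pos eventually_gt_at_top[of 0]
    proof eventually_elim
      case (elim n)
      have "tau1 * real n powr (- 3 / 5) > 0" using elim tau1_pos by simp
      then have wpos: "w n > 0"
        using elim(1) unfolding tw[OF elim(2)] by (rule zero_less_mult_pos[rotated])
      have pw: "t_seq n powr c = tau1 powr c * (real n powr (- 3 / 5 * c) * w n powr c)" for c
        unfolding tw[OF elim(2)] using tau1_pos wpos by (simp add: powr_mult powr_powr)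
      have a: "mean_coeff * t_seq n powr (- 5 / 3) = real n * w n powr (- 5 / 3)"
        unfolding pw mult.assoc[symmetric] c1 using elim by simp
      have "real n powr (9 / 10) = real n powr 1 * real n powr (- 1 / 10)"
        unfolding powr_add[symmetric] by simp
      then have r: "real n powr (9 / 10) = real n * real n powr (- 1 / 10)" using elim by simp
      have b: "const_Y / sqrt 2 * t_seq n powr (- 3 / 2) = real n * (z n / 4 * w n powr (- 3 / 2))"
        unfolding pw mult.assoc[symmetric] c2 z_def using r by simp
      have "real n powr (4 / 5) = real n powr 1 * (real n powr (- 1 / 10) * real n powr (- 1 / 10))"
        unfolding powr_add[symmetric] by simp
      then have s: "real n powr (4 / 5) = real n * (real n powr (- 1 / 10))\<^sup>2"
        using elim by (simp add: power2_eq_square)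
      have "(mean_N (t_seq n) - real n) / real n powr (4 / 5) =
          (real n * (w n powr (- 5 / 3) - 1 - z n / 4 * w n powr (- 3 / 2)) + e (t_seq n)) / real n powr (4 / 5)"
        unfolding e_def a b by (simp add: algebra_simps)
      also have "\<dots> = (w n powr (- 5 / 3) - 1 - z n / 4 * w n powr (- 3 / 2)) / (real n powr (- 1 / 10))\<^sup>2
          + e (t_seq n) / real n powr (4 / 5)"
        unfolding add_divide_distrib s using elim by simp
      finally show ?case by simp
    qed
  qed
qed

section \<open>The random variable and its characteristic function\<close>

text \<open>Dominated by the geometric series differentiated twice, whose coefficients are
  \<open>(m + 1) * (m + 2)\<close>.\<close>

lemma summable_square_geometric:
  assumes "0 \<le> q" "q < (1::real)"
  shows "summable (\<lambda>m. (real m)\<^sup>2 * q ^ m)"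
proof (rule summable_comparison_test'[where N = 0])
  have "summable (\<lambda>n. 1 * x ^ n)" if "norm x < 1" for x :: real
    using that by (simp add: summable_geometric)
  then have "summable (\<lambda>n. diffs (\<lambda>_. 1) n * x ^ n)" if "norm x < 1" for x :: real
    using that by (intro termdiff_converges[of x 1]) auto
  then show "summable (\<lambda>n. diffs (diffs (\<lambda>_. 1)) n * q ^ n)"
    using assms by (intro termdiff_converges[of q 1]) auto
  fix m
  have "(real m)\<^sup>2 \<le> real (Suc m) * real (Suc (Suc m))"
    unfolding power2_eq_square by (intro mult_mono) auto
  then have "(real m)\<^sup>2 * q ^ m \<le> real (Suc m) * real (Suc (Suc m)) * q ^ m"
    using assms by (intro mult_right_mono) auto
  then show "norm ((real m)\<^sup>2 * q ^ m) \<le> diffs (diffs (\<lambda>_. 1)) m * q ^ m"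
    using assms by (simp add: diffs_def)
qed

locale geometric_family = prob_space M for M :: "'a measure" +
  fixes X :: "nat \<times> nat \<Rightarrow> 'a \<Rightarrow> nat" and t :: real
  assumes t_pos: "t > 0"
    and indep_X: "indep_vars (\<lambda>_. count_space UNIV) X pos_pairs"
    and prob_X: "\<And>p m. p \<in> pos_pairs \<Longrightarrow> prob {\<omega> \<in> space M. X p \<omega> = m} =
          (1 - exp (- (t * rep_dim p))) * exp (- (t * rep_dim p)) ^ m"
begin

lemma X_measurable: "p \<in> pos_pairs \<Longrightarrow> X p \<in> M \<rightarrow>\<^sub>M count_space UNIV"
  using indep_X by (auto simp: indep_vars_def)

definition q :: "nat \<times> nat \<Rightarrow> real" where
  "q p = exp (- (t * rep_dim p))"

definition r :: "nat \<times> nat \<Rightarrow> real" where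
  "r p = bose (t * rep_dim p)"

lemma q_bounds: "p \<in> pos_pairs \<Longrightarrow> 0 < q p \<and> q p < 1"
  using t_pos rep_dim_pos[of p] by (simp add: q_def)

lemma r_pos: "p \<in> pos_pairs \<Longrightarrow> r p > 0"
  unfolding r_def using t_pos rep_dim_pos[of p] by (intro bose_pos) simp

lemma r_eq: "p \<in> pos_pairs \<Longrightarrow> r p = q p / (1 - q p)"
  using q_bounds[of p] by (simp add: r_def q_def bose_def exp_minus field_simps)

lemma distr_X:
  assumes p: "p \<in> pos_pairs"
  shows "distr M (count_space UNIV) (X p) = density (count_space UNIV) (\<lambda>m. (1 - q p) * q p ^ m)"
proof -
  have q: "0 < 1 - q p" "1 - q p \<le> 1" using q_bounds[OF p] by auto
  have "distr M (count_space UNIV) (X p) = measure_pmf (geometric_pmf (1 - q p))"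
  proof (rule measure_eqI_countable[of _ UNIV])
    fix m :: nat
    have "emeasure (distr M (count_space UNIV) (X p)) {m} = emeasure M (X p -` {m} \<inter> space M)"
      using X_measurable[OF p] by (subst emeasure_distr) auto
    also have "X p -` {m} \<inter> space M = {\<omega> \<in> space M. X p \<omega> = m}" by auto
    also have "emeasure M {\<omega> \<in> space M. X p \<omega> = m} = ennreal ((1 - q p) * q p ^ m)"
      unfolding emeasure_eq_measure prob_X[OF p] q_def ..
    also have "\<dots> = emeasure (measure_pmf (geometric_pmf (1 - q p))) {m}"
      using q by (simp add: emeasure_pmf_single mult.commute)
    finally show "emeasure (distr M (count_space UNIV) (X p)) {m} = emeasure (measure_pmf (geometric_pmf (1 - q p))) {m}" .
  qed auto
  also have "\<dots> = density (count_space UNIV) (\<lambda>m. (1 - q p) * q p ^ m)"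
    unfolding measure_pmf_eq_density using q by (simp add: mult.commute)
  finally show ?thesis .
qed

lemma has_integral_X:
  fixes h :: "nat \<Rightarrow> 'b :: {banach, second_countable_topology}"
  assumes p: "p \<in> pos_pairs" and h: "summable (\<lambda>m. norm (h m) * q p ^ m)"
  shows "integrable M (\<lambda>\<omega>. h (X p \<omega>))"
    and "(\<lambda>m. ((1 - q p) * q p ^ m) *\<^sub>R h m) sums (\<integral>\<omega>. h (X p \<omega>) \<partial>M)"
proof -
  have q: "0 < 1 - q p" "0 < q p" using q_bounds[OF p] by auto
  have s: "summable (\<lambda>m. norm (((1 - q p) * q p ^ m) *\<^sub>R h m))"
    using summable_mult[OF h, of "1 - q p"] q by (simp add: mult_ac)
  then have i: "integrable (count_space UNIV) (\<lambda>m. ((1 - q p) * q p ^ m) *\<^sub>R h m)"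
    by (simp add: integrable_count_space_nat_iff)
  have "integrable (distr M (count_space UNIV) (X p)) h"
    unfolding distr_X[OF p] using q i by (subst integrable_density) auto
  then show "integrable M (\<lambda>\<omega>. h (X p \<omega>))"
    using X_measurable[OF p] by (subst (asm) integrable_distr_eq) auto
  have "(\<integral>\<omega>. h (X p \<omega>) \<partial>M) = integral\<^sup>L (distr M (count_space UNIV) (X p)) h"
    using X_measurable[OF p] by (subst integral_distr) auto
  also have "\<dots> = (\<integral>m. ((1 - q p) * q p ^ m) *\<^sub>R h m \<partial>count_space UNIV)"
    unfolding distr_X[OF p] using q by (subst integral_density) auto
  finally show "(\<lambda>m. ((1 - q p) * q p ^ m) *\<^sub>R h m) sums (\<integral>\<omega>. h (X p \<omega>) \<partial>M)"
    using sums_integral_count_space_nat[OF i] by simp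
qed

lemma summable_powers_X:
  assumes p: "p \<in> pos_pairs"
  shows "summable (\<lambda>m. norm (real m) * q p ^ m)" "summable (\<lambda>m. norm ((real m)\<^sup>2) * q p ^ m)"
proof -
  have q: "0 < q p" "q p < 1" using q_bounds[OF p] by auto
  show 2: "summable (\<lambda>m. norm ((real m)\<^sup>2) * q p ^ m)"
    using summable_square_geometric[of "q p"] q by simp
  show "summable (\<lambda>m. norm (real m) * q p ^ m)"
  proof (rule summable_comparison_test'[OF 2, of 0])
    fix m :: nat
    have "m \<le> m\<^sup>2" by (simp add: power2_eq_square)
    then have "real m \<le> (real m)\<^sup>2" by (metis of_nat_le_iff of_nat_power)
    then show "norm (norm (real m) * q p ^ m) \<le> norm ((real m)\<^sup>2) * q p ^ m"
      using q by (simp add: abs_mult)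
  qed
qed

text \<open>Shifting the index by one in the moment series gives the linear equations
  \<open>e1 = q * (e1 + 1)\<close> and \<open>e2 = q * (e2 + 2 * e1 + 1)\<close>, which determine
  both moments once convergence is known.\<close>

lemma moments_X:
  assumes p: "p \<in> pos_pairs"
  shows "integrable M (\<lambda>\<omega>. real (X p \<omega>))" "expectation (\<lambda>\<omega>. real (X p \<omega>)) = r p"
    "integrable M (\<lambda>\<omega>. (real (X p \<omega>))\<^sup>2)" "expectation (\<lambda>\<omega>. (real (X p \<omega>))\<^sup>2) = r p + 2 * (r p)\<^sup>2"
proof -
  have q: "0 < q p" "q p < 1" using q_bounds[OF p] by auto
  note s = summable_powers_X[OF p]
  note 1 = has_integral_X[of p real, OF p s(1)] and 2 = has_integral_X[of p "\<lambda>m. (real m)\<^sup>2", OF p s(2)]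
  show "integrable M (\<lambda>\<omega>. real (X p \<omega>))" "integrable M (\<lambda>\<omega>. (real (X p \<omega>))\<^sup>2)"
    using 1 2 by auto
  define e1 where "e1 = expectation (\<lambda>\<omega>. real (X p \<omega>))"
  define e2 where "e2 = expectation (\<lambda>\<omega>. (real (X p \<omega>))\<^sup>2)"
  have s0: "(\<lambda>m. (1 - q p) * q p ^ m) sums 1"
    using sums_mult[OF geometric_sums[of "q p"], of "1 - q p"] q by simp
  have s1: "(\<lambda>m. (1 - q p) * q p ^ m * real m) sums e1"
    and s2: "(\<lambda>m. (1 - q p) * q p ^ m * (real m)\<^sup>2) sums e2"
    using 1 2 by (auto simp: e1_def e2_def)
  have a: "(\<lambda>m. (1 - q p) * q p ^ Suc m * real (Suc m)) sums e1"
    using s1 by (subst sums_Suc_iff) simp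
  have b: "(\<lambda>m. q p * ((1 - q p) * q p ^ m * real m + (1 - q p) * q p ^ m)) sums (q p * (e1 + 1))"
    by (intro sums_mult sums_add s0 s1)
  have e: "(1 - q p) * q p ^ Suc m * real (Suc m) = q p * ((1 - q p) * q p ^ m * real m + (1 - q p) * q p ^ m)" for m
    by (simp add: algebra_simps)
  have "e1 = q p * (e1 + 1)" using a b unfolding e by (rule sums_unique2)
  then have e1: "e1 = r p" unfolding r_eq[OF p] using q by (simp add: field_simps)
  then show "expectation (\<lambda>\<omega>. real (X p \<omega>)) = r p" by (simp add: e1_def)
  have a2: "(\<lambda>m. (1 - q p) * q p ^ Suc m * (real (Suc m))\<^sup>2) sums e2"
    using s2 by (subst sums_Suc_iff) simp
  have b2: "(\<lambda>m. q p * ((1 - q p) * q p ^ m * (real m)\<^sup>2 + 2 * ((1 - q p) * q p ^ m * real m) + (1 - q p) * q p ^ m)) sums (q p * (e2 + 2 * e1 + 1))"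
    by (intro sums_mult sums_add s0 s1 s2)
  have c2: "(1 - q p) * q p ^ Suc m * (real (Suc m))\<^sup>2 =
      q p * ((1 - q p) * q p ^ m * (real m)\<^sup>2 + 2 * ((1 - q p) * q p ^ m * real m) + (1 - q p) * q p ^ m)" for m
    by (simp add: algebra_simps power2_eq_square)
  have "e2 = q p * (e2 + 2 * e1 + 1)" using a2 b2 unfolding c2 by (rule sums_unique2)
  then have "e2 * (1 - q p) = q p * (2 * r p + 1)" unfolding e1 by (simp add: algebra_simps)
  then have "e2 = q p * (2 * r p + 1) / (1 - q p)" using q by (simp add: eq_divide_eq)
  also have "\<dots> = q p / (1 - q p) * (2 * r p + 1)" by simp
  finally have "e2 = r p * (2 * r p + 1)" unfolding r_eq[OF p, symmetric] .
  then show "expectation (\<lambda>\<omega>. (real (X p \<omega>))\<^sup>2) = r p + 2 * (r p)\<^sup>2"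
    by (simp add: e2_def power2_eq_square algebra_simps)
qed

definition char_factor :: "nat \<times> nat \<Rightarrow> real \<Rightarrow> complex" where
  "char_factor p \<theta> = of_real (1 - q p) / (1 - of_real (q p) * iexp (\<theta> * rep_dim p))"

lemma char_X:
  assumes p: "p \<in> pos_pairs"
  shows "(CLINT \<omega>|M. iexp (\<theta> * (rep_dim p * real (X p \<omega>)))) = char_factor p \<theta>"
proof -
  have q: "0 < q p" "q p < 1" using q_bounds[OF p] by auto
  have "summable (\<lambda>m. norm (iexp (\<theta> * (rep_dim p * real m))) * q p ^ m)"
    using q by (simp add: summable_geometric)
  from has_integral_X(2)[of p "\<lambda>m. iexp (\<theta> * (rep_dim p * real m))", OF p this]
  have "(\<lambda>m. ((1 - q p) * q p ^ m) *\<^sub>R iexp (\<theta> * (rep_dim p * real m))) sums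
      (CLINT \<omega>|M. iexp (\<theta> * (rep_dim p * real (X p \<omega>))))" .
  moreover have "((1 - q p) * q p ^ m) *\<^sub>R iexp (\<theta> * (rep_dim p * real m)) =
      of_real (1 - q p) * (of_real (q p) * iexp (\<theta> * rep_dim p)) ^ m" for m
  proof -
    have "iexp (\<theta> * (rep_dim p * real m)) = iexp (\<theta> * rep_dim p) ^ m"
      by (simp add: exp_of_nat_mult[symmetric] mult_ac)
    then show ?thesis by (simp add: scaleR_conv_of_real power_mult_distrib)
  qed
  moreover have "(\<lambda>m. of_real (1 - q p) * (of_real (q p) * iexp (\<theta> * rep_dim p)) ^ m) sums
      (of_real (1 - q p) * (1 / (1 - of_real (q p) * iexp (\<theta> * rep_dim p))))"
    using q by (intro sums_mult geometric_sums) (simp add: norm_mult)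
  ultimately show ?thesis by (simp add: sums_iff char_factor_def)
qed

section \<open>Truncation to finite squares of pairs\<close>

definition box :: "nat \<Rightarrow> (nat \<times> nat) set" where
  "box K = {1..K} \<times> {1..K}"

lemma box_finite: "finite (box K)" and box_subset: "box K \<subseteq> pos_pairs"
  by (auto simp: box_def pos_pairs_def)

text \<open>The squares are cofinal among the finite sets of pairs, so unordered sums become limits
  of sequences and the convergence theorems for integrals apply.\<close>

lemma box_filterlim: "filterlim box (finite_subsets_at_top pos_pairs) sequentially"
  unfolding filterlim_finite_subsets_at_top
proof safe
  fix A assume A: "finite A" "A \<subseteq> pos_pairs"
  define K where "K = Max (insert 0 ((\<lambda>p. max (fst p) (snd p)) ` A))"
  have "max (fst p) (snd p) \<le> K" if "p \<in> A" for p
    unfolding K_def using A that by (intro Max_ge) auto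
  then have "A \<subseteq> box k" if "k \<ge> K" for k
    using that A by (fastforce simp: box_def pos_pairs_def)
  then show "\<forall>\<^sub>F k in sequentially. finite (box k) \<and> A \<subseteq> box k \<and> box k \<subseteq> pos_pairs"
    using box_finite box_subset unfolding eventually_sequentially by blast
qed

definition S :: "nat \<Rightarrow> 'a \<Rightarrow> real" where
  "S K \<omega> = (\<Sum>p\<in>box K. rep_dim p * real (X p \<omega>))"

lemma S_measurable [measurable]: "S K \<in> borel_measurable M"
  unfolding S_def
proof (intro borel_measurable_sum borel_measurable_times borel_measurable_const)
  fix p assume "p \<in> box K"
  then have "p \<in> pos_pairs" using box_subset by auto
  from X_measurable[OF this] have [measurable]: "X p \<in> M \<rightarrow>\<^sub>M count_space UNIV" .
  show "(\<lambda>\<omega>. real (X p \<omega>)) \<in> borel_measurable M" by measurable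
qed

lemma indep_scaled: "indep_vars (\<lambda>_. borel) (\<lambda>p \<omega>. rep_dim p * real (X p \<omega>)) (box K)"
  by (rule indep_vars_compose2[OF indep_vars_subset[OF indep_X box_subset],
        where Y = "\<lambda>p m. rep_dim p * real m" and N = "\<lambda>_. borel"]) simp

lemma char_S: "(CLINT \<omega>|M. iexp (\<theta> * S K \<omega>)) = (\<Prod>p\<in>box K. char_factor p \<theta>)"
proof -
  have m: "(\<lambda>\<omega>. rep_dim p * real (X p \<omega>)) \<in> borel_measurable M" if "p \<in> box K" for p
    using indep_scaled[of K] that by (auto simp: indep_vars_def)
  have "(CLINT \<omega>|M. iexp (\<theta> * S K \<omega>)) = char (distr M borel (S K)) \<theta>"
    by (simp add: char_def integral_distr)
  also have "\<dots> = (\<Prod>p\<in>box K. char (distr M borel (\<lambda>\<omega>. rep_dim p * real (X p \<omega>))) \<theta>)"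
    unfolding S_def[abs_def] by (rule char_distr_sum[OF indep_scaled])
  also have "\<dots> = (\<Prod>p\<in>box K. char_factor p \<theta>)"
    using m box_subset[of K] by (intro prod.cong) (auto simp: char_def integral_distr char_X[symmetric])
  finally show ?thesis .
qed

text \<open>The second moment is computed rather than the variance because
  \<open>(S K)\<^sup>2\<close> increases with \<open>K\<close>, so that monotone convergence carries
  it over to \<open>N\<close>.\<close>

lemma moments_S:
  "integrable M (S K)" "expectation (S K) = (\<Sum>p\<in>box K. rep_dim p * r p)"
  "integrable M (\<lambda>\<omega>. (S K \<omega>)\<^sup>2)"
  "expectation (\<lambda>\<omega>. (S K \<omega>)\<^sup>2) = (\<Sum>p\<in>box K. (rep_dim p)\<^sup>2 * bose2 (t * rep_dim p)) + (\<Sum>p\<in>box K. rep_dim p * r p)\<^sup>2"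
proof -
  have main: "integrable M (\<lambda>\<omega>. \<Sum>p\<in>A. rep_dim p * real (X p \<omega>)) \<and>
     expectation (\<lambda>\<omega>. \<Sum>p\<in>A. rep_dim p * real (X p \<omega>)) = (\<Sum>p\<in>A. rep_dim p * r p) \<and>
     integrable M (\<lambda>\<omega>. (\<Sum>p\<in>A. rep_dim p * real (X p \<omega>))\<^sup>2) \<and>
     expectation (\<lambda>\<omega>. (\<Sum>p\<in>A. rep_dim p * real (X p \<omega>))\<^sup>2) =
       (\<Sum>p\<in>A. (rep_dim p)\<^sup>2 * bose2 (t * rep_dim p)) + (\<Sum>p\<in>A. rep_dim p * r p)\<^sup>2"
    if "finite A" "A \<subseteq> box K" for A
    using that
  proof (induction A rule: finite_induct)
    case (insert p A)
    let ?Y = "\<lambda>p \<omega>. rep_dim p * real (X p \<omega>)"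
    have p: "p \<in> pos_pairs" using insert.prems box_subset by auto
    note IH = insert.IH[OF insert_subset[THEN iffD1, OF insert.prems, THEN conjunct2]]
    have iv: "indep_var borel (?Y p) borel (\<lambda>\<omega>. \<Sum>p\<in>A. ?Y p \<omega>)"
      using insert.hyps insert.prems indep_vars_subset[OF indep_scaled]
      by (intro indep_vars_sum) auto
    note m = moments_X[OF p]
    have iY: "integrable M (?Y p)" using m by simp
    have iY2: "integrable M (\<lambda>\<omega>. (?Y p \<omega>)\<^sup>2)" using m by (simp add: power_mult_distrib)
    have eY: "expectation (?Y p) = rep_dim p * r p" using m by simp
    have eY2: "expectation (\<lambda>\<omega>. (?Y p \<omega>)\<^sup>2) = (rep_dim p)\<^sup>2 * (r p + 2 * (r p)\<^sup>2)"
      using m by (simp add: power_mult_distrib)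
    have iP: "integrable M (\<lambda>\<omega>. ?Y p \<omega> * (\<Sum>p\<in>A. ?Y p \<omega>))"
      by (rule indep_var_integrable[OF iv iY]) (use IH in simp)
    have eP: "expectation (\<lambda>\<omega>. ?Y p \<omega> * (\<Sum>p\<in>A. ?Y p \<omega>)) = rep_dim p * r p * (\<Sum>p\<in>A. rep_dim p * r p)"
      using indep_var_lebesgue_integral[OF iv iY] IH eY by simp
    have sq: "(\<Sum>p\<in>insert p A. ?Y p \<omega>)\<^sup>2 = (?Y p \<omega>)\<^sup>2 + 2 * (?Y p \<omega> * (\<Sum>p\<in>A. ?Y p \<omega>)) + (\<Sum>p\<in>A. ?Y p \<omega>)\<^sup>2" for \<omega>
      using insert.hyps by (simp add: power2_sum mult_ac)
    have i2: "integrable M (\<lambda>\<omega>. (\<Sum>p\<in>insert p A. ?Y p \<omega>)\<^sup>2)"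
      unfolding sq using IH iY2 iP by (intro Bochner_Integration.integrable_add integrable_mult_right) auto
    have "expectation (\<lambda>\<omega>. (\<Sum>p\<in>insert p A. ?Y p \<omega>)\<^sup>2) =
        (rep_dim p)\<^sup>2 * (r p + 2 * (r p)\<^sup>2) + 2 * (rep_dim p * r p * (\<Sum>p\<in>A. rep_dim p * r p)) +
        ((\<Sum>p\<in>A. (rep_dim p)\<^sup>2 * bose2 (t * rep_dim p)) + (\<Sum>p\<in>A. rep_dim p * r p)\<^sup>2)"
      unfolding sq using IH iY2 iP eY2 eP by simp
    also have "\<dots> = (\<Sum>p\<in>insert p A. (rep_dim p)\<^sup>2 * bose2 (t * rep_dim p)) + (\<Sum>p\<in>insert p A. rep_dim p * r p)\<^sup>2"
      using insert.hyps by (simp add: bose2_def r_def power2_sum power_mult_distrib algebra_simps)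
    finally have e2: "expectation (\<lambda>\<omega>. (\<Sum>p\<in>insert p A. ?Y p \<omega>)\<^sup>2) = \<dots>" .
    have s: "(\<lambda>\<omega>. \<Sum>p\<in>insert p A. ?Y p \<omega>) = (\<lambda>\<omega>. ?Y p \<omega> + (\<Sum>p\<in>A. ?Y p \<omega>))"
      using insert.hyps by simp
    have "integrable M (\<lambda>\<omega>. \<Sum>p\<in>insert p A. ?Y p \<omega>)"
      unfolding s using IH iY by (intro Bochner_Integration.integrable_add) auto
    moreover have "expectation (\<lambda>\<omega>. \<Sum>p\<in>insert p A. ?Y p \<omega>) = (\<Sum>p\<in>insert p A. rep_dim p * r p)"
      unfolding s using IH iY eY insert.hyps by (subst Bochner_Integration.integral_add) auto
    ultimately show ?case using i2 e2 by blast
  qed (simp add: prob_space)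
  show "integrable M (S K)" "expectation (S K) = (\<Sum>p\<in>box K. rep_dim p * r p)"
    "integrable M (\<lambda>\<omega>. (S K \<omega>)\<^sup>2)"
    "expectation (\<lambda>\<omega>. (S K \<omega>)\<^sup>2) = (\<Sum>p\<in>box K. (rep_dim p)\<^sup>2 * bose2 (t * rep_dim p)) + (\<Sum>p\<in>box K. rep_dim p * r p)\<^sup>2"
    using main[OF box_finite order.refl] unfolding S_def[abs_def] by auto
qed

lemma S_nonneg: "S K \<omega> \<ge> 0"
  unfolding S_def rep_dim_def by (intro sum_nonneg) auto

lemma S_mono: "K \<le> L \<Longrightarrow> S K \<omega> \<le> S L \<omega>"
  unfolding S_def by (rule sum_mono2[OF box_finite]) (auto simp: box_def rep_dim_def)

lemma N_sum_tendsto: "(\<lambda>K. ennreal (S K \<omega>)) \<longlonglongrightarrow> N_sum X \<omega>"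
proof -
  let ?f = "\<lambda>(j, k). ennreal (1 / 2 * real (j * k * (j + k)) * real (X (j, k) \<omega>))"
  have "(?f has_sum infsum ?f pos_pairs) pos_pairs"
    by (intro has_sum_infsum nonneg_summable_on_complete) auto
  then have "(\<lambda>K. sum ?f (box K)) \<longlonglongrightarrow> infsum ?f pos_pairs"
    unfolding has_sum_def by (rule filterlim_compose[OF _ box_filterlim])
  moreover have "sum ?f (box K) = ennreal (S K \<omega>)" for K
    unfolding S_def by (subst sum_ennreal[symmetric]) (auto simp: rep_dim_def case_prod_unfold intro!: sum.cong)
  ultimately show ?thesis by (simp add: N_sum_def)
qed

lemma N_sum_measurable [measurable]: "N_sum X \<in> borel_measurable M"
  by (rule borel_measurable_LIMSEQ_order[OF N_sum_tendsto]) measurable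

lemma N_sum_eq_SUP: "N_sum X \<omega> = (SUP K. ennreal (S K \<omega>))"
proof (rule LIMSEQ_unique[OF N_sum_tendsto])
  show "(\<lambda>K. ennreal (S K \<omega>)) \<longlonglongrightarrow> (SUP K. ennreal (S K \<omega>))"
    by (rule LIMSEQ_SUP) (auto simp: incseq_def intro!: ennreal_leI S_mono)
qed

lemma sum_box_tendsto:
  assumes "f summable_on pos_pairs"
  shows "(\<lambda>K. sum f (box K)) \<longlonglongrightarrow> infsum f pos_pairs"
  using has_sum_infsum[OF assms] unfolding has_sum_def by (rule filterlim_compose[OF _ box_filterlim])

lemma mean_limit: "(\<lambda>K. expectation (S K)) \<longlonglongrightarrow> mean_N t"
  unfolding moments_S mean_N_def r_def
  by (rule sum_box_tendsto[OF mean_N_summable[OF t_pos]])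

lemma square_limit: "(\<lambda>K. expectation (\<lambda>\<omega>. (S K \<omega>)\<^sup>2)) \<longlonglongrightarrow> var_N t + (mean_N t)\<^sup>2"
  unfolding moments_S
proof (intro tendsto_intros)
  show "(\<lambda>K. \<Sum>p\<in>box K. (rep_dim p)\<^sup>2 * bose2 (t * rep_dim p)) \<longlonglongrightarrow> var_N t"
    unfolding var_N_def by (rule sum_box_tendsto[OF var_N_summable[OF t_pos]])
  show "(\<lambda>K. \<Sum>p\<in>box K. rep_dim p * r p) \<longlonglongrightarrow> mean_N t"
    using mean_limit unfolding moments_S .
qed

text \<open>Monotone convergence in the extended reals. Finiteness of this integral is what makes
  \<open>N\<close> finite almost surely.\<close>

lemma nn_integral_N: "(\<integral>\<^sup>+\<omega>. N_sum X \<omega> \<partial>M) = ennreal (mean_N t)"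
proof -
  have "(\<integral>\<^sup>+\<omega>. N_sum X \<omega> \<partial>M) = (SUP K. \<integral>\<^sup>+\<omega>. ennreal (S K \<omega>) \<partial>M)"
    unfolding N_sum_eq_SUP
    by (rule nn_integral_monotone_convergence_SUP)
      (auto simp: incseq_def le_fun_def intro!: ennreal_leI S_mono)
  also have "(\<lambda>K. \<integral>\<^sup>+\<omega>. ennreal (S K \<omega>) \<partial>M) = (\<lambda>K. ennreal (expectation (S K)))"
    using moments_S S_nonneg by (intro ext nn_integral_eq_integral) auto
  also have "(SUP K. ennreal (expectation (S K))) = ennreal (mean_N t)"
  proof (rule LIMSEQ_unique)
    show "(\<lambda>K. ennreal (expectation (S K))) \<longlonglongrightarrow> (SUP K. ennreal (expectation (S K)))"
      by (rule LIMSEQ_SUP) (auto simp: incseq_def intro!: ennreal_leI integral_mono[OF moments_S(1) moments_S(1)] S_mono)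
    show "(\<lambda>K. ennreal (expectation (S K))) \<longlonglongrightarrow> ennreal (mean_N t)"
      by (intro tendsto_ennrealI mean_limit)
  qed
  finally show ?thesis .
qed

lemma N_sum_finite: "AE \<omega> in M. N_sum X \<omega> < \<infinity>"
  using nn_integral_PInf_AE[of "N_sum X" M] nn_integral_N by (auto simp: less_top)

definition N :: "'a \<Rightarrow> real" where
  "N \<omega> = enn2real (N_sum X \<omega>)"

lemma N_measurable [measurable]: "N \<in> borel_measurable M"
  unfolding N_def[abs_def] by measurable

lemma N_limit:
  assumes "N_sum X \<omega> < \<infinity>"
  shows "(\<lambda>K. S K \<omega>) \<longlonglongrightarrow> N \<omega>"
proof -
  have "(\<lambda>K. enn2real (ennreal (S K \<omega>))) \<longlonglongrightarrow> enn2real (N_sum X \<omega>)"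
    using assms N_sum_tendsto by (intro tendsto_enn2real) (auto simp: less_top)
  then show ?thesis by (simp add: N_def S_nonneg)
qed

lemma N_limit_AE: "AE \<omega> in M. (\<lambda>K. S K \<omega>) \<longlonglongrightarrow> N \<omega>"
  using N_sum_finite by eventually_elim (rule N_limit)

lemma moments_N:
  "integrable M N" "expectation N = mean_N t"
  "integrable M (\<lambda>\<omega>. (N \<omega>)\<^sup>2)" "expectation (\<lambda>\<omega>. (N \<omega>)\<^sup>2) = var_N t + (mean_N t)\<^sup>2"
proof -
  have mono: "AE \<omega> in M. mono (\<lambda>K. S K \<omega>)" "AE \<omega> in M. mono (\<lambda>K. (S K \<omega>)\<^sup>2)"
    by (auto simp: mono_def intro!: S_mono power_mono S_nonneg)
  have sq: "AE \<omega> in M. (\<lambda>K. (S K \<omega>)\<^sup>2) \<longlonglongrightarrow> (N \<omega>)\<^sup>2"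
    using N_limit_AE by eventually_elim (intro tendsto_intros)
  show "integrable M (\<lambda>\<omega>. (N \<omega>)\<^sup>2)"
    by (rule integrable_monotone_convergence[OF moments_S(3) mono(2) sq square_limit]) measurable
  show "expectation (\<lambda>\<omega>. (N \<omega>)\<^sup>2) = var_N t + (mean_N t)\<^sup>2"
    by (rule integral_monotone_convergence[OF moments_S(3) mono(2) sq square_limit]) measurable
  show "integrable M N"
    by (rule integrable_monotone_convergence[OF moments_S(1) mono(1) N_limit_AE mean_limit]) measurable
  show "expectation N = mean_N t"
    by (rule integral_monotone_convergence[OF moments_S(1) mono(1) N_limit_AE mean_limit]) measurable
qed

lemma variance_N: "N_variance M X = var_N t"
  using variance_eq[OF moments_N(1,3)] moments_N unfolding N_variance_def N_def by simp

lemma S_Nats: "S K \<omega> \<in> \<nat>"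
proof -
  have "rep_dim p * real (X p \<omega>) = real (fst p * snd p * (fst p + snd p) div 2 * X p \<omega>)" for p
  proof -
    \<comment> \<open>If both labels are odd, their sum is even; so the halves are integers and
      \<open>N\<close> is integer valued.\<close>
    have "even (fst p * snd p * (fst p + snd p))"
      by (cases "even (fst p)"; cases "even (snd p)") auto
    then have "real (fst p * snd p * (fst p + snd p) div 2) = real (fst p * snd p * (fst p + snd p)) / real 2"
      by (rule real_of_nat_div)
    then have "rep_dim p = real (fst p * snd p * (fst p + snd p) div 2)"
      unfolding rep_dim_def by (simp only: of_nat_numeral)
    then show ?thesis by (simp only: of_nat_mult)
  qed
  then have "S K \<omega> = real (\<Sum>p\<in>box K. fst p * snd p * (fst p + snd p) div 2 * X p \<omega>)"
    unfolding S_def by (simp only: of_nat_sum)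
  then show ?thesis by (simp only: of_nat_in_Nats)
qed

lemma N_Nats: "AE \<omega> in M. N \<omega> \<in> \<nat>"
  using N_limit_AE
proof eventually_elim
  case (elim \<omega>)
  show ?case
    by (rule Lim_in_closed_set[OF closed_Nats _ _ elim]) (auto simp: S_Nats)
qed

section \<open>Characteristic function and Fourier inversion\<close>

definition phi :: "real \<Rightarrow> complex" where
  "phi \<theta> = (CLINT \<omega>|M. iexp (\<theta> * N \<omega>))"

lemma phi_limit: "(\<lambda>K. \<Prod>p\<in>box K. char_factor p \<theta>) \<longlonglongrightarrow> phi \<theta>"
  unfolding char_S[symmetric] phi_def
proof (rule integral_dominated_convergence[where w = "\<lambda>_. 1"])
  show "AE \<omega> in M. (\<lambda>K. iexp (\<theta> * S K \<omega>)) \<longlonglongrightarrow> iexp (\<theta> * N \<omega>)"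
    using N_limit_AE by eventually_elim (intro tendsto_intros)
qed auto

lemma phi_measurable [measurable]: "phi \<in> borel_measurable borel"
  by (rule borel_measurable_LIMSEQ_metric[OF _ phi_limit]) (simp add: char_factor_def)

text \<open>For fixed \<omega> the integral of \<open>iexp (\<theta> * (N \<omega> - n))\<close>
  over a full period is \<open>2 * pi\<close> or \<open>0\<close>, because \<open>N \<omega>\<close>
  is almost surely an integer. The integrand is bounded on a set of finite measure, so Fubini allows
  taking the expectation inside.\<close>

lemma inversion_N:
  "complex_of_real (2 * pi * prob {\<omega> \<in> space M. N_sum X \<omega> = of_nat n}) =
     (CLINT \<theta>|lborel. indicator {- pi..pi} \<theta> * (phi \<theta> * iexp (- (\<theta> * real n))))"
proof -
  interpret P: pair_sigma_finite M lborel ..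
  let ?F = "\<lambda>\<omega> \<theta>. indicator {- pi..pi} \<theta> * iexp (\<theta> * (N \<omega> - real n))"
  have k: "(CLINT \<theta>|lborel. ?F \<omega> \<theta>) = 2 * pi * indicator {\<omega>. N \<omega> = real n} \<omega>" if N: "N \<omega> \<in> \<nat>" for \<omega>
  proof -
    obtain m where m: "N \<omega> = real m" using N by (auto elim: Nats_cases)
    define c where "c = real m - real n"
    have "(CLINT \<theta>|lborel. ?F \<omega> \<theta>) = (CLINT \<theta>:{-pi..pi}|lborel. iexp (\<theta> * c))"
      unfolding set_lebesgue_integral_def m c_def by (simp add: scaleR_conv_of_real of_real_indicator)
    also have "\<dots> = (CLBINT \<theta>=-pi..pi. iexp (\<theta> * c))"
      by (subst interval_integral_Icc) auto
    also have "\<dots> = 2 * pi * indicator {\<omega>. N \<omega> = real n} \<omega>"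
    proof (cases "m = n")
      case True
      then have "(CLBINT \<theta>=-pi..pi. iexp (\<theta> * c)) = (CLBINT \<theta>=-pi..pi. 1)" by (simp add: c_def)
      also have "\<dots> = 2 * pi"
        by (subst interval_integral_Icc) (auto simp: set_lebesgue_integral_def scaleR_conv_of_real)
      finally show ?thesis using m True by simp
    next
      case False
      then have c: "c \<noteq> 0" by (simp add: c_def)
      have "(CLBINT \<theta>=-pi..pi. iexp (\<theta> * c)) = iexp (pi * c) / (\<i> * c) - iexp (- pi * c) / (\<i> * c)"
      proof (rule interval_integral_FTC_finite)
        show "continuous_on {min (- pi) pi..max (- pi) pi} (\<lambda>\<theta>. iexp (\<theta> * c))"
          by (intro continuous_intros)
        fix \<theta> :: real assume "min (- pi) pi \<le> \<theta>" "\<theta> \<le> max (- pi) pi"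
        define k where "k = \<i> * complex_of_real c"
        have k: "k \<noteq> 0" using c by (simp add: k_def)
        have "((\<lambda>z. exp (k * z) / k) has_field_derivative exp (k * of_real \<theta>)) (at (of_real \<theta>))"
          using k by (auto intro!: derivative_eq_intros)
        from has_vector_derivative_real_field[OF this]
        have "((\<lambda>\<theta>. exp (k * of_real \<theta>) / k) has_vector_derivative exp (k * of_real \<theta>))
            (at \<theta> within {min (- pi) pi..max (- pi) pi})" .
        moreover have "exp (k * of_real \<theta>) = iexp (\<theta> * c)" for \<theta> by (simp add: k_def mult_ac)
        ultimately show "((\<lambda>\<theta>. iexp (\<theta> * c) / (\<i> * c)) has_vector_derivative iexp (\<theta> * c)) (at \<theta> within {min (- pi) pi..max (- pi) pi})"
          by (simp add: k_def)
      qed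
      also have "iexp (pi * c) = iexp (- pi * c)"
      proof -
        have "iexp (pi * c) = iexp (- pi * c) * exp (2 * of_int (int m - int n) * of_real pi * \<i>)"
          by (simp add: c_def exp_add[symmetric] algebra_simps)
        also have "exp (2 * of_int (int m - int n) * of_real pi * \<i>) = 1"
          using exp_integer_2pi[of "of_int (int m - int n)"] by simp
        finally show ?thesis by simp
      qed
      finally show ?thesis using False m by simp
    qed
    finally show ?thesis .
  qed
  have i: "integrable (M \<Otimes>\<^sub>M lborel) (case_prod ?F)"
  proof (rule P.Fubini_integrable)
    show "case_prod ?F \<in> borel_measurable (M \<Otimes>\<^sub>M lborel)" by measurable
    have ni: "norm (?F \<omega> \<theta>) = indicator {- pi..pi} \<theta>" for \<omega> \<theta>
      by (simp add: norm_mult indicator_def)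
    show "integrable M (\<lambda>\<omega>. LINT \<theta>|lborel. norm (case (\<omega>, \<theta>) of (\<omega>, \<theta>) \<Rightarrow> ?F \<omega> \<theta>))"
      unfolding prod.case ni by simp
    show "AE \<omega> in M. integrable lborel (\<lambda>\<theta>. case (\<omega>, \<theta>) of (\<omega>, \<theta>) \<Rightarrow> ?F \<omega> \<theta>)"
    proof (rule AE_I2)
      fix \<omega> assume "\<omega> \<in> space M"
      show "integrable lborel (\<lambda>\<theta>. case (\<omega>, \<theta>) of (\<omega>, \<theta>) \<Rightarrow> ?F \<omega> \<theta>)"
        unfolding prod.case
      proof (rule Bochner_Integration.integrable_bound)
        show "integrable lborel (\<lambda>\<theta>. indicator {- pi..pi} \<theta> :: real)" by simp
        show "AE \<theta> in lborel. norm (?F \<omega> \<theta>) \<le> norm (indicator {- pi..pi} \<theta> :: real)"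
          unfolding ni by simp
      qed measurable
    qed
  qed
  \<comment> \<open>\<open>enn2real\<close> sends infinity to \<open>0\<close>, so for
    \<open>n = 0\<close> the two events may differ, but only on the null event where the sum
    diverges.\<close>
  have "prob {\<omega> \<in> space M. N_sum X \<omega> = of_nat n} = prob {\<omega> \<in> space M. N \<omega> = real n}"
  proof (rule finite_measure_eq_AE)
    show "AE \<omega> in M. (\<omega> \<in> {\<omega> \<in> space M. N_sum X \<omega> = of_nat n}) = (\<omega> \<in> {\<omega> \<in> space M. N \<omega> = real n})"
      using N_sum_finite
    proof eventually_elim
      case (elim \<omega>)
      then have "N_sum X \<omega> = ennreal (N \<omega>)" by (simp add: N_def less_top)
      then have "N_sum X \<omega> = of_nat n \<longleftrightarrow> N \<omega> = real n"
        by (simp add: N_def flip: ennreal_of_nat_eq_real_of_nat)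
           (metis enn2real_nonneg ennreal_inj ennreal_of_nat_eq_real_of_nat of_nat_0_le_iff)
      then show ?case by simp
    qed
  qed measurable
  also have "2 * pi * prob {\<omega> \<in> space M. N \<omega> = real n} = (LINT \<omega>|M. 2 * pi * indicator {\<omega>. N \<omega> = real n} \<omega>)"
    by (subst integral_mult_right_zero, subst Bochner_Integration.integral_indicator) (auto simp: Int_def conj_commute)
  finally have "complex_of_real (2 * pi * prob {\<omega> \<in> space M. N_sum X \<omega> = of_nat n}) =
      of_real (LINT \<omega>|M. 2 * pi * indicator {\<omega>. N \<omega> = real n} \<omega>)" by simp
  also have "\<dots> = (CLINT \<omega>|M. of_real (2 * pi * indicator {\<omega>. N \<omega> = real n} \<omega>))"
    by (rule integral_complex_of_real[symmetric])
  also have "\<dots> = (CLINT \<omega>|M. (CLINT \<theta>|lborel. ?F \<omega> \<theta>))"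
  proof (rule integral_cong_AE)
    show "AE \<omega> in M. of_real (2 * pi * indicator {\<omega>. N \<omega> = real n} \<omega>) = (CLINT \<theta>|lborel. ?F \<omega> \<theta>)"
      using N_Nats
    proof eventually_elim
      case (elim \<omega>)
      show ?case unfolding k[OF elim] by (simp add: indicator_def)
    qed
  qed measurable
  also have "\<dots> = (CLINT \<theta>|lborel. (CLINT \<omega>|M. ?F \<omega> \<theta>))"
    by (rule P.Fubini_integral[OF i, symmetric])
  also have "\<dots> = (CLINT \<theta>|lborel. indicator {- pi..pi} \<theta> * (phi \<theta> * iexp (- (\<theta> * real n))))"
  proof (rule Bochner_Integration.integral_cong[OF refl])
    fix \<theta> :: real
    have "(CLINT \<omega>|M. ?F \<omega> \<theta>) = (CLINT \<omega>|M. iexp (\<theta> * N \<omega>) * (indicator {- pi..pi} \<theta> * iexp (- (\<theta> * real n))))"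
    proof (rule Bochner_Integration.integral_cong[OF refl])
      fix \<omega>
      have "iexp (\<theta> * (N \<omega> - real n)) = iexp (\<theta> * N \<omega>) * iexp (- (\<theta> * real n))"
        by (simp add: exp_add[symmetric] algebra_simps)
      then show "?F \<omega> \<theta> = iexp (\<theta> * N \<omega>) * (indicator {- pi..pi} \<theta> * iexp (- (\<theta> * real n)))"
        by (simp only: mult_ac)
    qed
    also have "\<dots> = phi \<theta> * (indicator {- pi..pi} \<theta> * iexp (- (\<theta> * real n)))"
      unfolding phi_def by (rule integral_mult_left_zero)
    finally show "(CLINT \<omega>|M. ?F \<omega> \<theta>) = indicator {- pi..pi} \<theta> * (phi \<theta> * iexp (- (\<theta> * real n)))"
      by (simp add: mult_ac)
  qed
  finally show ?thesis .
qed

end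

section \<open>Bounds for the characteristic function\<close>

lemma sin_ge_half:
  assumes "0 \<le> y" "y \<le> (1::real)"
  shows "sin y \<ge> y / 2"
proof -
  have "sin 0 - 0 / 2 \<le> sin y - y / 2"
  proof (rule DERIV_nonneg_imp_nondecreasing[OF assms(1)])
    fix x assume x: "0 \<le> x" "x \<le> y"
    \<comment> \<open>The interval \<open>[0, 1]\<close> lies inside \<open>[0, pi / 3]\<close>,
      where the cosine is at least \<open>1 / 2\<close>.\<close>
    have "cos (pi / 3) \<le> cos x"
      using x assms pi_gt3 by (intro cos_monotone_0_pi_le) auto
    moreover have "((\<lambda>x. sin x - x / 2) has_real_derivative cos x - 1 / 2) (at x)"
      by (auto intro!: derivative_eq_intros)
    ultimately show "\<exists>l. ((\<lambda>x. sin x - x / 2) has_real_derivative l) (at x) \<and> 0 \<le> l"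
      by (intro exI[of _ "cos x - 1 / 2"]) (simp add: cos_60)
  qed
  then show ?thesis by simp
qed

lemma sin_square_ge:
  assumes "\<bar>y\<bar> \<le> (1::real)"
  shows "(sin y)\<^sup>2 \<ge> (y / 2)\<^sup>2"
proof -
  have "\<bar>y\<bar> / 2 \<le> sin \<bar>y\<bar>" using assms by (intro sin_ge_half) auto
  then have "(\<bar>y\<bar> / 2)\<^sup>2 \<le> (sin \<bar>y\<bar>)\<^sup>2" by (intro power_mono) auto
  then show ?thesis by (auto simp: power_divide abs_if split: if_splits)
qed

lemma sin_square_add_le: "(sin (x + y))\<^sup>2 \<le> 2 * (sin x)\<^sup>2 + 2 * (sin (y::real))\<^sup>2"
proof -
  have "\<bar>sin (x + y)\<bar> \<le> \<bar>sin x\<bar> * \<bar>cos y\<bar> + \<bar>cos x\<bar> * \<bar>sin y\<bar>"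
    unfolding sin_add using abs_triangle_ineq[of "sin x * cos y" "cos x * sin y"] by (simp add: abs_mult)
  also have "\<dots> \<le> \<bar>sin x\<bar> * 1 + 1 * \<bar>sin y\<bar>"
    by (intro add_mono mult_mono) auto
  finally have "\<bar>sin (x + y)\<bar>\<^sup>2 \<le> (\<bar>sin x\<bar> + \<bar>sin y\<bar>)\<^sup>2" by (intro power_mono) auto
  also have "\<dots> \<le> 2 * \<bar>sin x\<bar>\<^sup>2 + 2 * \<bar>sin y\<bar>\<^sup>2"
    using sum_squares_ge_zero[of "\<bar>sin x\<bar> - \<bar>sin y\<bar>" 0] by (simp add: power2_eq_square algebra_simps)
  finally show ?thesis by simp
qed

text \<open>If the sine is small at three points, it is small at their second difference, written
  here as \<open>(x - y) + (z - y)\<close>. Read in the other direction, this bounds the three sines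
  from below.\<close>

lemma sin_square_second_difference:
  "(sin (x - 2 * y + z))\<^sup>2 \<le> 4 * ((sin x)\<^sup>2 + 2 * (sin y)\<^sup>2 + (sin (z::real))\<^sup>2)"
proof -
  have "(sin ((x - y) + (z - y)))\<^sup>2 \<le> 2 * (sin (x - y))\<^sup>2 + 2 * (sin (z - y))\<^sup>2"
    by (rule sin_square_add_le)
  also have "\<dots> \<le> 2 * (2 * (sin x)\<^sup>2 + 2 * (sin y)\<^sup>2) + 2 * (2 * (sin z)\<^sup>2 + 2 * (sin y)\<^sup>2)"
    using sin_square_add_le[of x "- y"] sin_square_add_le[of z "- y"] by simp
  finally show ?thesis by (simp add: algebra_simps)
qed

text \<open>Triangular numbers have constant second differences, so they cannot all be close to multiples of
  \<open>2 * pi / \<theta>\<close>.\<close>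

lemma sum_sin_square_triangular:
  "real L * (sin (real (m\<^sup>2) * \<theta> / 2))\<^sup>2 \<le> 16 * (\<Sum>k=1..2*m+L. (sin (real (k * (k + 1)) * \<theta> / 4))\<^sup>2)"
proof -
  define s where "s k = (sin (real (k * (k + 1)) * \<theta> / 4))\<^sup>2" for k :: nat
  let ?A = "\<Sum>k=1..2*m+L. s k"
  have shift: "(\<Sum>k=1..L. s (k + i)) \<le> ?A" if "i \<le> 2 * m" for i
  proof -
    have "(\<Sum>k=1..L. s (k + i)) = (\<Sum>k=1+i..L+i. s k)"
      by (rule sum.shift_bounds_cl_nat_ivl[symmetric])
    also have "\<dots> \<le> ?A" using that by (intro sum_mono2) (auto simp: s_def)
    finally show ?thesis .
  qed
  have "real L * (sin (real (m\<^sup>2) * \<theta> / 2))\<^sup>2 = (\<Sum>k=1..L. (sin (real (m\<^sup>2) * \<theta> / 2))\<^sup>2)" by simp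
  also have "\<dots> \<le> (\<Sum>k=1..L. 4 * (s (k + 2 * m) + 2 * s (k + m) + s (k + 0)))"
  proof (rule sum_mono)
    fix k
    \<comment> \<open>The second difference of \<open>k * (k + 1)\<close> with step \<open>m\<close>
      is \<open>2 * m\<^sup>2\<close>, independent of \<open>k\<close>.\<close>
    have "real (m\<^sup>2) * \<theta> / 2 = real ((k + 2 * m) * (k + 2 * m + 1)) * \<theta> / 4
        - 2 * (real ((k + m) * (k + m + 1)) * \<theta> / 4) + real (k * (k + 1)) * \<theta> / 4"
      by (simp add: field_simps power2_eq_square)
    then show "(sin (real (m\<^sup>2) * \<theta> / 2))\<^sup>2 \<le> 4 * (s (k + 2 * m) + 2 * s (k + m) + s (k + 0))"
      unfolding s_def add_0_right by (simp only: sin_square_second_difference)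
  qed
  also have "\<dots> = 4 * ((\<Sum>k=1..L. s (k + 2 * m)) + 2 * (\<Sum>k=1..L. s (k + m)) + (\<Sum>k=1..L. s (k + 0)))"
    by (simp only: sum_distrib_left[symmetric] sum.distrib)
  \<comment> \<open>Three shifted windows with weights \<open>1\<close>, \<open>2\<close>,
    \<open>1\<close>, each inside the full range; with the factor \<open>4\<close> this makes
    \<open>16\<close>.\<close>
  also have "\<dots> \<le> 4 * (?A + 2 * ?A + ?A)"
    by (intro mult_left_mono add_mono shift) auto
  finally show ?thesis by (simp add: s_def)
qed

section \<open>Elementary bounds for \<open>bose\<close> and \<open>bose2\<close>\<close>

lemma exp_half_le:
  assumes "0 \<le> u" "u \<le> (1::real)"
  shows "exp (u / 2) \<le> 1 + u"
proof -
  have "exp (u / 2) \<le> 1 + u / 2 + (u / 2)\<^sup>2" using assms by (intro exp_bound) auto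
  also have "(u / 2)\<^sup>2 \<le> u / 2"
    using assms mult_left_mono[of u 1 u] by (simp add: power2_eq_square)
  finally show ?thesis by simp
qed

lemma bose_ge:
  assumes "0 < x" "x \<le> 1"
  shows "bose x \<ge> 1 / (2 * x)"
proof -
  have "exp x \<le> 1 + x + x\<^sup>2" using assms by (intro exp_bound) auto
  also have "x\<^sup>2 \<le> x" using assms mult_left_mono[of x 1 x] by (simp add: power2_eq_square)
  finally show ?thesis unfolding bose_def using assms by (intro divide_left_mono) auto
qed

lemma bose2_ge:
  assumes "0 < x" "x \<le> 1"
  shows "bose2 x \<ge> 1 / (4 * x\<^sup>2)"
proof -
  have "(1 / (2 * x))\<^sup>2 \<le> (bose x)\<^sup>2" using assms by (intro power_mono bose_ge) auto
  then show ?thesis using bose_pos[of x] assms by (simp add: bose2_def power_divide power_mult_distrib)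
qed

lemma bose_le: "x > 0 \<Longrightarrow> x * bose x \<le> 1"
proof -
  assume "x > 0"
  moreover have "x \<le> exp x - 1" using exp_ge_add_one_self[of x] by linarith
  ultimately show ?thesis by (simp add: bose_def divide_le_eq)
qed

lemma bose2_le:
  assumes "x > 0"
  shows "x\<^sup>2 * bose2 x \<le> 3"
proof -
  have "1 + x + x\<^sup>2 / 2 \<le> exp x" using assms by (intro exp_lower_Taylor_quadratic) auto
  then have "x\<^sup>2 \<le> 2 * (exp x - 1)" using assms by simp
  then have "x\<^sup>2 * bose x \<le> 2" using assms by (simp add: bose_def divide_le_eq)
  moreover have "x\<^sup>2 * (bose x)\<^sup>2 \<le> 1"
    using power_mono[OF bose_le[OF assms], of 2] assms bose_pos[OF assms] by (simp add: power_mult_distrib)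
  ultimately show ?thesis by (simp add: bose2_def distrib_left)
qed

text \<open>For large \<open>x\<close> the left side is about \<open>x * exp (- x)\<close>, which no
  multiple of \<open>bose2 x\<close> dominates; halving the argument absorbs the factor
  \<open>x\<close>. It rests on \<open>exp x - 1 = (exp (x / 2) - 1) * (exp (x / 2) + 1)\<close>.
  Cubic error terms can thus be summed as a variance at \<open>t / 2\<close>.\<close>

lemma bose_le_bose2_half:
  assumes "x > 0"
  shows "x * bose x \<le> 2 * bose2 (x / 2)"
proof -
  have e: "exp x = exp (x / 2) * exp (x / 2)" by (simp flip: exp_add)
  have p: "exp (x / 2) - 1 > 0" using assms by simp
  have "bose x = bose (x / 2) * (1 / (exp (x / 2) + 1))"
    unfolding bose_def e using p by (simp add: field_simps)
  then have "x * bose x = bose (x / 2) * (x / (exp (x / 2) + 1))" by simp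
  also have "\<dots> \<le> bose (x / 2) * 2"
  proof (rule mult_left_mono)
    have "1 + x / 2 \<le> exp (x / 2)" by (rule exp_ge_add_one_self)
    then have "2 * (1 + x / 2) \<le> 2 * exp (x / 2)" by (rule mult_left_mono) simp
    then have "x \<le> 2 * (exp (x / 2) + 1)" by (simp add: distrib_left)
    then show "x / (exp (x / 2) + 1) \<le> 2" by (simp add: divide_le_eq add_pos_pos)
  qed (use bose_pos[of "x / 2"] assms in simp)
  also have "\<dots> \<le> 2 * bose2 (x / 2)" by (simp add: bose2_def)
  finally show ?thesis .
qed

lemma abs_cube: "\<bar>x\<bar> ^ 3 = \<bar>x\<bar> * (x::real)\<^sup>2"
  by (simp add: power3_eq_cube power2_eq_square)

text \<open>Both functions are compared with their common second-order polynomial \<open>c\<close>.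
  Most errors are of the form \<eta> times the variance contribution
  \<open>v * \<alpha>\<^sup>2\<close>. The term \<open>r * \<bar>\<alpha>\<bar> ^ 3\<close> stays
  separate: when \<open>r\<close> is small, \<open>\<bar>\<alpha>\<bar>\<close> may be much larger
  than \<eta>.\<close>

lemma geometric_char_expansion:
  fixes r \<alpha> \<eta> :: real
  defines "v \<equiv> r + r\<^sup>2"
  assumes r: "r > 0" and \<eta>: "r * \<bar>\<alpha>\<bar> \<le> \<eta>" "\<eta> \<le> 1" and v: "v * \<alpha>\<^sup>2 \<le> 3 * \<eta>\<^sup>2"
  shows "norm (1 / (1 - of_real r * (iexp \<alpha> - 1)) - exp (\<i> * of_real (r * \<alpha>) - of_real (v * \<alpha>\<^sup>2 / 2)))
     \<le> 15 * \<eta> * (v * \<alpha>\<^sup>2) + r * \<bar>\<alpha>\<bar> ^ 3"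
proof -
  define E where "E = iexp \<alpha>"
  define z where "z = of_real r * (E - 1)"
  define w where "w = \<i> * of_real (r * \<alpha>) - complex_of_real (v * \<alpha>\<^sup>2 / 2)"
  \<comment> \<open>In \<open>exp w\<close> the quadratic terms are
    \<open>- v * \<alpha>\<^sup>2 / 2\<close> from \<open>w\<close> and
    \<open>- r\<^sup>2 * \<alpha>\<^sup>2 / 2\<close> from \<open>w\<^sup>2 / 2\<close>; with
    \<open>v = r + r\<^sup>2\<close> they combine to those of
    \<open>1 + z + z\<^sup>2\<close>.\<close>
  define c where "c = 1 + \<i> * of_real (r * \<alpha>) - of_real (r * \<alpha>\<^sup>2 / 2) - complex_of_real (r\<^sup>2 * \<alpha>\<^sup>2)"
  have v0: "v > 0" "v * \<alpha>\<^sup>2 \<ge> 0" using r by (auto simp: v_def intro!: add_pos_pos)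
  have \<eta>0: "\<eta> \<ge> 0" using \<eta>(1) r by (meson abs_ge_zero mult_nonneg_nonneg less_imp_le order_trans)
  have r2: "r\<^sup>2 * \<alpha>\<^sup>2 \<le> v * \<alpha>\<^sup>2" using r by (simp add: v_def mult_right_mono)
  have A1: "norm (E - 1) \<le> \<bar>\<alpha>\<bar>" using iexp_approx1[of \<alpha> 0] by (simp add: E_def)
  have A2: "norm (E - 1 - \<i> * \<alpha>) \<le> \<alpha>\<^sup>2 / 2"
    using iexp_approx1[of \<alpha> 1] by (simp add: E_def numeral_2_eq_2 algebra_simps)
  have A3: "norm (E - (1 + \<i> * \<alpha> - \<alpha>\<^sup>2 / 2)) \<le> \<bar>\<alpha>\<bar> ^ 3 / 6"
    using iexp_approx1[of \<alpha> 2]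
    by (simp add: E_def numeral_2_eq_2 numeral_3_eq_3 power2_eq_square algebra_simps fact_reduce)
  have A4: "norm ((E - 1)\<^sup>2 + \<alpha>\<^sup>2) \<le> \<bar>\<alpha>\<bar> ^ 3"
  proof -
    have "(E - 1)\<^sup>2 + \<alpha>\<^sup>2 = (E - 1 - \<i> * \<alpha>) * (E - 1 + \<i> * \<alpha>)"
      by (simp add: power2_eq_square algebra_simps)
    also have "norm \<dots> \<le> \<alpha>\<^sup>2 / 2 * (\<bar>\<alpha>\<bar> + \<bar>\<alpha>\<bar>)"
      unfolding norm_mult
    proof (intro mult_mono A2)
      show "norm (E - 1 + \<i> * \<alpha>) \<le> \<bar>\<alpha>\<bar> + \<bar>\<alpha>\<bar>"
        using norm_triangle_ineq[of "E - 1" "\<i> * \<alpha>"] A1 by (simp add: norm_mult)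
    qed auto
    also have "\<dots> = \<bar>\<alpha>\<bar> ^ 3" by (simp add: abs_cube)
    finally show ?thesis .
  qed
  \<comment> \<open>The real part of \<open>1 - z\<close> is at least \<open>1\<close>, so the
    geometric remainder \<open>z ^ 3 / (1 - z)\<close> is bounded by its numerator.\<close>
  have z1: "norm (1 - z) \<ge> 1"
  proof -
    have "Re (1 - z) = 1 + r * (1 - cos \<alpha>)" by (simp add: z_def E_def Re_exp algebra_simps)
    then have "Re (1 - z) \<ge> 1" using r cos_le_one[of \<alpha>] by simp
    then show ?thesis using complex_Re_le_cmod[of "1 - z"] by linarith
  qed
  have nz: "norm z \<le> r * \<bar>\<alpha>\<bar>" unfolding z_def norm_mult using A1 r by (simp add: mult_left_mono)
  have f1: "norm (1 / (1 - z) - (1 + z + z\<^sup>2)) \<le> (r * \<bar>\<alpha>\<bar>) ^ 3"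
  proof -
    have "1 - z \<noteq> 0" using z1 by auto
    then have "1 / (1 - z) - (1 + z + z\<^sup>2) = z ^ 3 / (1 - z)"
      by (simp add: field_simps power2_eq_square power3_eq_cube)
    also have "norm \<dots> \<le> norm z ^ 3 / 1"
      unfolding norm_divide norm_power using z1 by (intro divide_left_mono) auto
    also have "\<dots> \<le> (r * \<bar>\<alpha>\<bar>) ^ 3" using nz by (simp add: power_mono)
    finally show ?thesis .
  qed
  have f2: "norm ((1 + z + z\<^sup>2) - c) \<le> r * (\<bar>\<alpha>\<bar> ^ 3 / 6) + r\<^sup>2 * \<bar>\<alpha>\<bar> ^ 3"
  proof -
    have "(1 + z + z\<^sup>2) - c = of_real r * (E - (1 + \<i> * \<alpha> - \<alpha>\<^sup>2 / 2)) + of_real (r\<^sup>2) * ((E - 1)\<^sup>2 + \<alpha>\<^sup>2)"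
      by (simp add: z_def c_def power2_eq_square algebra_simps)
    also have "norm \<dots> \<le> r * norm (E - (1 + \<i> * \<alpha> - \<alpha>\<^sup>2 / 2)) + r\<^sup>2 * norm ((E - 1)\<^sup>2 + \<alpha>\<^sup>2)"
      using r by (intro norm_triangle_mono) (auto simp: norm_mult norm_power)
    also have "\<dots> \<le> r * (\<bar>\<alpha>\<bar> ^ 3 / 6) + r\<^sup>2 * \<bar>\<alpha>\<bar> ^ 3"
      using r by (intro add_mono mult_left_mono A3 A4) auto
    finally show ?thesis .
  qed
  have f: "norm (1 / (1 - z) - c) \<le> \<eta> * (v * \<alpha>\<^sup>2) + r * \<bar>\<alpha>\<bar> ^ 3"
  proof -
    have "norm (1 / (1 - z) - c) \<le> (r * \<bar>\<alpha>\<bar>) ^ 3 + (r * (\<bar>\<alpha>\<bar> ^ 3 / 6) + r\<^sup>2 * \<bar>\<alpha>\<bar> ^ 3)"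
      using norm_triangle_ineq[of "1 / (1 - z) - (1 + z + z\<^sup>2)" "(1 + z + z\<^sup>2) - c"] f1 f2 by simp
    also have "\<dots> = (r * \<bar>\<alpha>\<bar>) * (v * \<alpha>\<^sup>2) + r * (\<bar>\<alpha>\<bar> ^ 3 / 6)"
    proof -
      show ?thesis by (simp add: abs_cube v_def power_mult_distrib algebra_simps power3_eq_cube power2_eq_square)
    qed
    also have "\<dots> \<le> \<eta> * (v * \<alpha>\<^sup>2) + r * \<bar>\<alpha>\<bar> ^ 3"
      using r v0 \<eta> by (intro add_mono mult_right_mono mult_left_mono) auto
    finally show ?thesis .
  qed
  have va: "v * \<alpha>\<^sup>2 * \<eta>\<^sup>2 \<le> v * \<alpha>\<^sup>2 * \<eta>"
  proof (rule mult_left_mono[OF _ v0(2)])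
    show "\<eta>\<^sup>2 \<le> \<eta>" using \<eta> \<eta>0 by (simp add: power2_eq_square mult_left_le)
  qed
  have vv: "(v * \<alpha>\<^sup>2)\<^sup>2 \<le> 3 * (v * \<alpha>\<^sup>2 * \<eta>\<^sup>2)"
    using mult_left_mono[OF v v0(2)] by (simp add: power2_eq_square)
  have vv': "(v * \<alpha>\<^sup>2)\<^sup>2 \<le> 3 * (v * \<alpha>\<^sup>2 * \<eta>)"
    using vv va by linarith
  have g1: "norm (exp w - (1 + w + w\<^sup>2 / 2)) \<le> 13 * \<eta> * (v * \<alpha>\<^sup>2)"
  proof -
    have Rew: "\<bar>Re w\<bar> \<le> 3 / 2"
    proof -
      have "\<eta>\<^sup>2 \<le> 1" using \<eta> \<eta>0 by (simp add: power_le_one)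
      then show ?thesis using v v0 by (simp add: w_def)
    qed
    have "exp \<bar>Re w\<bar> \<le> exp (3 / 2)" using Rew by simp
    also have "exp (3 / 2 :: real) \<le> 5"
    proof -
      have "exp (3 / 2 :: real) ^ 2 = exp 1 ^ 3" by (simp flip: exp_of_nat_mult)
      also have "\<dots> \<le> (272 / 100) ^ 3" using e_less_272 by (intro power_mono) auto
      also have "\<dots> \<le> (5::real)\<^sup>2" by (simp add: power3_eq_cube power2_eq_square)
      finally show ?thesis by (rule power2_le_imp_le) simp
    qed
    finally have ex: "exp \<bar>Re w\<bar> \<le> 5" .
    have w1: "norm w \<le> 5 / 2 * \<eta>"
    proof -
      have "norm w \<le> \<bar>r * \<alpha>\<bar> + \<bar>v * \<alpha>\<^sup>2 / 2\<bar>"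
        unfolding w_def using norm_triangle_ineq4[of "\<i> * of_real (r * \<alpha>)" "complex_of_real (v * \<alpha>\<^sup>2 / 2)"]
        by (simp only: norm_mult norm_ii norm_of_real mult_1)
      also have "\<dots> \<le> \<eta> + 3 * \<eta>\<^sup>2 / 2" using \<eta> v v0 r by (simp add: abs_mult)
      also have "\<eta>\<^sup>2 \<le> \<eta>" using \<eta> \<eta>0 by (simp add: power2_eq_square mult_left_le)
      finally show ?thesis by simp
    qed
    have w2: "(norm w)\<^sup>2 \<le> 2 * (v * \<alpha>\<^sup>2)"
    proof -
      have "(norm w)\<^sup>2 = r\<^sup>2 * \<alpha>\<^sup>2 + (v * \<alpha>\<^sup>2)\<^sup>2 / 4"
        by (simp add: cmod_power2 w_def power_mult_distrib power_divide)
      also have "\<dots> \<le> v * \<alpha>\<^sup>2 + 3 * (v * \<alpha>\<^sup>2 * \<eta>\<^sup>2) / 4"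
        using r2 vv by (intro add_mono divide_right_mono) auto
      also have "v * \<alpha>\<^sup>2 * \<eta>\<^sup>2 \<le> v * \<alpha>\<^sup>2 * 1"
        using \<eta> \<eta>0 v0 by (intro mult_left_mono power_le_one) auto
      finally show ?thesis using v0 by linarith
    qed
    have "norm (exp w - (\<Sum>k\<le>2. w ^ k / fact k)) \<le> exp \<bar>Re w\<bar> * norm w ^ Suc 2 / fact 2"
      by (rule Taylor_exp)
    also have "(\<Sum>k\<le>2. w ^ k / fact k) = 1 + w + w\<^sup>2 / 2"
      by (simp add: numeral_2_eq_2)
    also have "exp \<bar>Re w\<bar> * norm w ^ Suc 2 / fact 2 = exp \<bar>Re w\<bar> * (norm w * (norm w)\<^sup>2) / 2"
      by (simp add: power2_eq_square power3_eq_cube)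
    also have "\<dots> \<le> 5 * (5 / 2 * \<eta> * (2 * (v * \<alpha>\<^sup>2))) / 2"
      using ex w1 w2 \<eta>0 by (intro divide_right_mono mult_mono) auto
    also have "\<dots> \<le> 13 * \<eta> * (v * \<alpha>\<^sup>2)" using \<eta>0 v0 by simp
    finally show ?thesis .
  qed
  have g2: "norm ((1 + w + w\<^sup>2 / 2) - c) \<le> \<eta> * (v * \<alpha>\<^sup>2)"
  proof -
    have "(1 + w + w\<^sup>2 / 2) - c = of_real ((v * \<alpha>\<^sup>2)\<^sup>2 / 8) - \<i> * of_real (r * \<alpha> * (v * \<alpha>\<^sup>2) / 2)"
      by (simp add: w_def c_def v_def power2_eq_square field_simps)
    also have "norm \<dots> \<le> (v * \<alpha>\<^sup>2)\<^sup>2 / 8 + r * \<bar>\<alpha>\<bar> * (v * \<alpha>\<^sup>2) / 2"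
    proof (rule order_trans[OF norm_triangle_ineq4])
      show "norm (complex_of_real ((v * \<alpha>\<^sup>2)\<^sup>2 / 8)) + norm (\<i> * complex_of_real (r * \<alpha> * (v * \<alpha>\<^sup>2) / 2))
         \<le> (v * \<alpha>\<^sup>2)\<^sup>2 / 8 + r * \<bar>\<alpha>\<bar> * (v * \<alpha>\<^sup>2) / 2"
        unfolding norm_mult norm_ii norm_of_real using r v0 by (simp add: abs_mult)
    qed
    also have "\<dots> \<le> 3 * (v * \<alpha>\<^sup>2 * \<eta>) / 8 + \<eta> * (v * \<alpha>\<^sup>2) / 2"
      using vv' \<eta> v0 by (intro add_mono divide_right_mono mult_right_mono) auto
    also have "\<dots> \<le> \<eta> * (v * \<alpha>\<^sup>2)" using \<eta>0 v0 by simp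
    finally show ?thesis .
  qed
  have "norm (1 / (1 - z) - exp w) \<le> norm (1 / (1 - z) - c) + (norm ((1 + w + w\<^sup>2 / 2) - c) + norm (exp w - (1 + w + w\<^sup>2 / 2)))"
    using norm_triangle_ineq4[of "1 / (1 - z) - c" "exp w - c"]
      norm_triangle_ineq[of "exp w - (1 + w + w\<^sup>2 / 2)" "(1 + w + w\<^sup>2 / 2) - c"] by simp
  also have "\<dots> \<le> (\<eta> * (v * \<alpha>\<^sup>2) + r * \<bar>\<alpha>\<bar> ^ 3) + (\<eta> * (v * \<alpha>\<^sup>2) + 13 * \<eta> * (v * \<alpha>\<^sup>2))"
    by (intro add_mono f g1 g2)
  also have "\<dots> = 15 * \<eta> * (v * \<alpha>\<^sup>2) + r * \<bar>\<alpha>\<bar> ^ 3" by simp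
  finally show ?thesis unfolding z_def w_def E_def .
qed

context geometric_family
begin

lemma char_factor_eq:
  assumes p: "p \<in> pos_pairs"
  shows "char_factor p \<theta> = 1 / (1 - of_real (r p) * (iexp (\<theta> * rep_dim p) - 1))"
proof -
  have q: "0 < q p" "q p < 1" using q_bounds[OF p] by auto
  then have c: "complex_of_real (1 - q p) \<noteq> 0" by (simp only: of_real_eq_0_iff)
  have "1 - of_real (r p) * (iexp (\<theta> * rep_dim p) - 1) = (1 - of_real (q p) * iexp (\<theta> * rep_dim p)) / of_real (1 - q p)"
    unfolding r_eq[OF p] using c by (simp add: field_simps)
  then show ?thesis by (simp add: char_factor_def)
qed

text \<open>An exact formula in which \<open>bose2\<close> is the variance of \<open>X p\<close>:
  the modulus is small as soon as the variance is not small and \<open>\<theta> * d / 2\<close> is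
  away from the multiples of \<open>pi\<close>.\<close>

lemma norm_char_factor:
  assumes p: "p \<in> pos_pairs"
  shows "(norm (char_factor p \<theta>))\<^sup>2 = 1 / (1 + 4 * bose2 (t * rep_dim p) * (sin (\<theta> * rep_dim p / 2))\<^sup>2)"
proof -
  let ?\<alpha> = "\<theta> * rep_dim p"
  have "cos ?\<alpha> = 1 - 2 * (sin (?\<alpha> / 2))\<^sup>2"
    using cos_double_sin[of "?\<alpha> / 2"] by simp
  moreover have "(norm (1 - of_real (r p) * (iexp ?\<alpha> - 1)))\<^sup>2 = (1 + r p * (1 - cos ?\<alpha>))\<^sup>2 + (r p * sin ?\<alpha>)\<^sup>2"
    unfolding cmod_power2 by (simp add: Re_exp Im_exp algebra_simps power2_eq_square)
  moreover have "(1 + r p * (1 - cos ?\<alpha>))\<^sup>2 + (r p * sin ?\<alpha>)\<^sup>2 = 1 + 2 * (r p + (r p)\<^sup>2) * (1 - cos ?\<alpha>)"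
    unfolding power_mult_distrib sin_squared_eq by (simp add: power2_eq_square algebra_simps)
  ultimately have "(norm (1 - of_real (r p) * (iexp ?\<alpha> - 1)))\<^sup>2 = 1 + 4 * bose2 (t * rep_dim p) * (sin (?\<alpha> / 2))\<^sup>2"
    by (simp add: bose2_def r_def)
  then show ?thesis unfolding char_factor_eq[OF p] norm_divide power_divide by simp
qed

lemma bose2_dim_pos: "p \<in> pos_pairs \<Longrightarrow> bose2 (t * rep_dim p) > 0"
  using t_pos rep_dim_pos[of p] by (intro bose2_pos) simp

lemma norm_char_factor_le_1: "p \<in> pos_pairs \<Longrightarrow> norm (char_factor p \<theta>) \<le> 1"
proof -
  assume p: "p \<in> pos_pairs"
  have "(norm (char_factor p \<theta>))\<^sup>2 \<le> 1\<^sup>2"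
    unfolding norm_char_factor[OF p] using bose2_dim_pos[OF p] by (simp add: divide_le_eq add_pos_nonneg)
  then show ?thesis by (rule power2_le_imp_le) simp
qed

lemma norm_char_factor_le_exp:
  assumes p: "p \<in> pos_pairs" and u: "0 \<le> u" "u \<le> 1" "u \<le> 4 * bose2 (t * rep_dim p) * (sin (\<theta> * rep_dim p / 2))\<^sup>2"
  shows "(norm (char_factor p \<theta>))\<^sup>2 \<le> exp (- (u / 2))"
proof -
  have "(norm (char_factor p \<theta>))\<^sup>2 \<le> 1 / exp (u / 2)"
    unfolding norm_char_factor[OF p]
  proof (intro divide_left_mono mult_pos_pos)
    show "0 < 1 + 4 * bose2 (t * rep_dim p) * (sin (\<theta> * rep_dim p / 2))\<^sup>2" using u by linarith
    show "exp (u / 2) \<le> 1 + 4 * bose2 (t * rep_dim p) * (sin (\<theta> * rep_dim p / 2))\<^sup>2"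
      using exp_half_le[OF u(1,2)] u(3) by linarith
  qed auto
  then show ?thesis by (simp add: exp_minus inverse_eq_divide)
qed

text \<open>Every factor has modulus at most \<open>1\<close>, so any finite set of pairs may be
  singled out and the others dropped. The cap \<open>u p \<le> 1\<close> is what allows
  \<open>1 + u \<ge> exp (u / 2)\<close>; passing from squared moduli to moduli halves the exponent
  once more.\<close>

lemma norm_phi_le_exp:
  assumes A: "A \<subseteq> box m"
    and u: "\<And>p. p \<in> A \<Longrightarrow> 0 \<le> u p \<and> u p \<le> 1 \<and> u p \<le> 4 * bose2 (t * rep_dim p) * (sin (\<theta> * rep_dim p / 2))\<^sup>2"
    and s: "s \<le> (\<Sum>p\<in>A. u p)"
  shows "norm (phi \<theta>) \<le> exp (- (s / 4))"
proof -
  have "norm (\<Prod>p\<in>box K. char_factor p \<theta>) \<le> exp (- (s / 4))" if "K \<ge> m" for K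
  proof -
    have sub: "A \<subseteq> box K" using A that by (auto simp: box_def)
    have "(norm (\<Prod>p\<in>box K. char_factor p \<theta>))\<^sup>2 = (\<Prod>p\<in>box K. (norm (char_factor p \<theta>))\<^sup>2)"
      by (simp add: prod_norm[symmetric] prod_power_distrib)
    also have "\<dots> = (\<Prod>p\<in>A. (norm (char_factor p \<theta>))\<^sup>2) * (\<Prod>p\<in>box K - A. (norm (char_factor p \<theta>))\<^sup>2)"
      using prod.subset_diff[OF sub box_finite] by (simp add: mult.commute)
    also have "\<dots> \<le> (\<Prod>p\<in>A. exp (- (u p / 2))) * 1"
    proof (intro mult_mono prod_mono prod_le_1 conjI prod_nonneg)
      fix p
      show "(norm (char_factor p \<theta>))\<^sup>2 \<le> exp (- (u p / 2))" if "p \<in> A"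
        using u[OF that] that sub box_subset by (intro norm_char_factor_le_exp) auto
      show "(norm (char_factor p \<theta>))\<^sup>2 \<le> 1" if "p \<in> box K - A"
        using that box_subset norm_char_factor_le_1[of p \<theta>] by (auto intro!: power_le_one)
    qed auto
    also have "\<dots> = exp (- ((\<Sum>p\<in>A. u p) / 2))"
      using finite_subset[OF A box_finite] by (simp add: exp_sum[symmetric] sum_negf sum_divide_distrib)
    also have "\<dots> \<le> exp (- (s / 2))" using s by simp
    also have "\<dots> = (exp (- (s / 4)))\<^sup>2" by (simp flip: exp_of_nat_mult)
    finally show ?thesis by (rule power2_le_imp_le) simp
  qed
  then have "\<forall>\<^sub>F K in sequentially. norm (\<Prod>p\<in>box K. char_factor p \<theta>) \<le> exp (- (s / 4))"
    unfolding eventually_sequentially by blast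
  then show ?thesis
    by (rule tendsto_upperbound[OF tendsto_norm[OF phi_limit]]) simp
qed

section \<open>The characteristic function near zero and away from zero\<close>

lemma nat_floor_bounds:
  assumes "x \<ge> (1::real)"
  shows "real (nat \<lfloor>x\<rfloor>) \<le> x" "x / 2 \<le> real (nat \<lfloor>x\<rfloor>)" "nat \<lfloor>x\<rfloor> \<ge> 1"
proof -
  have f: "1 \<le> \<lfloor>x\<rfloor>" using assms by simp
  then have n: "real (nat \<lfloor>x\<rfloor>) = of_int \<lfloor>x\<rfloor>" by simp
  have "x < of_int \<lfloor>x\<rfloor> + 1" "(1::real) \<le> of_int \<lfloor>x\<rfloor>" using f by linarith+
  then show "real (nat \<lfloor>x\<rfloor>) \<le> x" "x / 2 \<le> real (nat \<lfloor>x\<rfloor>)" unfolding n by linarith+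
  show "nat \<lfloor>x\<rfloor> \<ge> 1" using f by linarith
qed

text \<open>For \<open>j, k \<le> t powr (- 1 / 3)\<close> one has \<open>t * d \<le> 1\<close>, so
  \<open>bose2\<close> is at least \<open>1 / (4 * (t * d)\<^sup>2)\<close> and the sine is
  comparable to its argument. The dimension cancels and every pair contributes the same
  \<open>u = \<theta>\<^sup>2 / (16 * t\<^sup>2)\<close>; there are at least
  \<open>t powr (- 2 / 3) / 4\<close> pairs, and \<open>256 = 16 * 4 * 4\<close>.\<close>

lemma norm_phi_near:
  assumes "t \<le> 1" "\<bar>\<theta>\<bar> \<le> t"
  shows "norm (phi \<theta>) \<le> exp (- (\<theta>\<^sup>2 * t powr (- 8 / 3) / 256))"
proof -
  define m where "m = nat \<lfloor>t powr (- 1 / 3)\<rfloor>"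
  have "t powr (- 1 / 3) \<ge> 1" using powr_mono2'[of "- 1 / 3" t 1] t_pos assms by simp
  from nat_floor_bounds[OF this] have m: "real m \<le> t powr (- 1 / 3)" "t powr (- 1 / 3) / 2 \<le> real m"
    by (auto simp: m_def)
  have td: "t * rep_dim p \<le> 1" if "p \<in> box m" for p
  proof -
    obtain j k where p: "p = (j, k)" "j \<le> m" "k \<le> m" using \<open>p \<in> box m\<close> by (auto simp: box_def)
    have "j * k * (j + k) \<le> m * m * (m + m)" using p by (intro mult_le_mono add_mono) auto
    then have "real (j * k * (j + k)) \<le> real (m * m * (m + m))" by (simp only: of_nat_le_iff)
    then have "rep_dim p \<le> real m ^ 3" by (simp add: rep_dim_def p power3_eq_cube)
    also have "\<dots> \<le> (t powr (- 1 / 3)) ^ 3" using m by (intro power_mono) auto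
    also have "\<dots> = (t powr (- 1 / 3)) powr 3" using t_pos by simp
    also have "\<dots> = t powr (- 1)" unfolding powr_powr by simp
    also have "\<dots> = 1 / t" using t_pos by (simp add: powr_minus_divide)
    finally show ?thesis using t_pos by (simp add: field_simps)
  qed
  define u where "u = \<theta>\<^sup>2 / (16 * t\<^sup>2)"
  have "\<theta>\<^sup>2 \<le> t\<^sup>2" using power_mono[OF assms(2), of 2] by simp
  then have "\<theta>\<^sup>2 \<le> 16 * t\<^sup>2" using zero_le_power2[of t] by linarith
  then have u1: "u \<le> 1" using t_pos by (simp add: u_def divide_le_eq)
  have "norm (phi \<theta>) \<le> exp (- (real m ^ 2 * u / 4))"
  proof (rule norm_phi_le_exp[of "box m" m "\<lambda>_. u"])
    fix p assume p: "p \<in> box m"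
    then have pp: "p \<in> pos_pairs" using box_subset by auto
    let ?x = "t * rep_dim p"
    have x: "0 < ?x" "?x \<le> 1" using td[OF p] t_pos rep_dim_pos[OF pp] by auto
    have "\<bar>\<theta>\<bar> * rep_dim p \<le> t * rep_dim p" using assms rep_dim_pos[OF pp] by (intro mult_right_mono) auto
    then have "\<bar>\<theta>\<bar> * rep_dim p \<le> 2" using x by linarith
    then have "\<bar>\<theta> * rep_dim p / 2\<bar> \<le> 1" using rep_dim_pos[OF pp] by (simp add: abs_mult)
    then have "(\<theta> * rep_dim p / 2 / 2)\<^sup>2 \<le> (sin (\<theta> * rep_dim p / 2))\<^sup>2" by (rule sin_square_ge)
    moreover have "1 / (4 * ?x\<^sup>2) \<le> bose2 ?x" by (rule bose2_ge[OF x])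
    ultimately have "4 * (1 / (4 * ?x\<^sup>2)) * (\<theta> * rep_dim p / 2 / 2)\<^sup>2 \<le> 4 * bose2 ?x * (sin (\<theta> * rep_dim p / 2))\<^sup>2"
      using bose2_dim_pos[OF pp] by (intro mult_mono mult_nonneg_nonneg) auto
    moreover have "4 * (1 / (4 * ?x\<^sup>2)) * (\<theta> * rep_dim p / 2 / 2)\<^sup>2 = u"
      using t_pos rep_dim_pos[OF pp] by (simp add: u_def power_mult_distrib power_divide)
    ultimately show "0 \<le> u \<and> u \<le> 1 \<and> u \<le> 4 * bose2 (t * rep_dim p) * (sin (\<theta> * rep_dim p / 2))\<^sup>2"
      using u1 by (simp add: u_def)
  qed (auto simp: box_def power2_eq_square)
  also have "\<dots> \<le> exp (- (\<theta>\<^sup>2 * t powr (- 8 / 3) / 256))"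
  proof -
    have "(t powr (- 1 / 3) / 2)\<^sup>2 \<le> (real m)\<^sup>2" using m by (intro power_mono) auto
    moreover have "(t powr (- 1 / 3))\<^sup>2 = t powr (- 2 / 3)"
      unfolding power2_eq_square powr_add[symmetric] by simp
    ultimately have le: "t powr (- 2 / 3) / 4 * u \<le> (real m)\<^sup>2 * u"
      by (intro mult_right_mono) (auto simp: power_divide u_def)
    have eq: "t powr (- 2 / 3) / 4 * u = \<theta>\<^sup>2 * t powr (- 8 / 3) / 64"
    proof -
      have "t powr (- 8 / 3) = t powr (- 2 / 3) / t\<^sup>2"
        using t_pos powr_diff[of t "- 2 / 3" 2] by simp
      then show ?thesis using t_pos by (simp add: u_def mult_ac)
    qed
    have "\<theta>\<^sup>2 * t powr (- 8 / 3) / 64 \<le> (real m)\<^sup>2 * u" using le unfolding eq .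
    then show ?thesis unfolding exp_le_cancel_iff by linarith
  qed
  finally show ?thesis .
qed

text \<open>Among the pairs \<open>(1, k)\<close> with \<open>k\<close> up to order
  \<open>t powr (- 1 / 2)\<close>, \<open>t * d\<close> stays bounded, so \<open>bose2\<close> is
  bounded below, and \<open>sum_sin_square_triangular\<close> makes the sum of the squared sines of
  order \<open>t powr (- 1 / 2)\<close>. The constant is \<open>8192 = 2 * 256 * 16\<close>.\<close>

lemma norm_phi_far:
  assumes "t \<le> 1" "t \<le> \<bar>\<theta>\<bar>" "\<bar>\<theta>\<bar> \<le> pi"
  shows "norm (phi \<theta>) \<le> exp (- (min (bose2 9) (1 / 4) / 8192 * t powr (- 1 / 2)))"
proof -
  \<comment> \<open>\<open>bose2 9\<close> is a lower bound for \<open>bose2 (t * d)\<close> because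
    \<open>t * d \<le> 9\<close> for the pairs used; the cap \<open>1 / 4\<close> keeps the
    contributions \<open>4 * c * s k\<close> at most \<open>1\<close>.\<close>
  define c where "c = min (bose2 9) (1 / 4)"
  have c: "c > 0" "c \<le> bose2 9" "c \<le> 1 / 4" using bose2_pos[of 9] by (auto simp: c_def)
  define x where "x = t powr (- 1 / 2)"
  have x1: "x \<ge> 1" unfolding x_def using powr_mono2'[of "- 1 / 2" t 1] t_pos assms by simp
  define L where "L = nat \<lfloor>x\<rfloor>"
  have L: "real L \<le> x" "x / 2 \<le> real L" using nat_floor_bounds[OF x1] by (auto simp: L_def)
  \<comment> \<open>The step \<open>m\<close> is about
    \<open>\<bar>\<theta>\<bar> powr (- 1 / 2)\<close>, or \<open>1\<close> for
    \<open>\<bar>\<theta>\<bar> > 1\<close>, so that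
    \<open>m\<^sup>2 * \<bar>\<theta>\<bar> / 2\<close> lies in \<open>[1 / 8, pi / 2]\<close>,
    where the sine is bounded below.\<close>
  obtain m :: nat where m: "real m \<le> x" "1 / 4 \<le> real (m\<^sup>2) * \<bar>\<theta>\<bar>" "real (m\<^sup>2) * \<bar>\<theta>\<bar> \<le> pi"
  proof (cases "\<bar>\<theta>\<bar> \<le> 1")
    case True
    define y where "y = \<bar>\<theta>\<bar> powr (- 1 / 2)"
    have th: "\<bar>\<theta>\<bar> > 0" using assms t_pos by simp
    have y1: "y \<ge> 1" unfolding y_def using powr_mono2'[of "- 1 / 2" "\<bar>\<theta>\<bar>" 1] th True by simp
    have yx: "y \<le> x" unfolding y_def x_def using assms t_pos by (intro powr_mono2') auto
    have y2: "y\<^sup>2 * \<bar>\<theta>\<bar> = 1"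
    proof -
      have "y\<^sup>2 = \<bar>\<theta>\<bar> powr (- 1)" unfolding y_def power2_eq_square powr_add[symmetric] by simp
      then show ?thesis using th by (simp add: powr_minus_divide)
    qed
    note m = nat_floor_bounds[OF y1]
    show ?thesis
    proof (rule that[of "nat \<lfloor>y\<rfloor>"])
      show "real (nat \<lfloor>y\<rfloor>) \<le> x" using m yx by simp
      have "(y / 2)\<^sup>2 * \<bar>\<theta>\<bar> \<le> (real (nat \<lfloor>y\<rfloor>))\<^sup>2 * \<bar>\<theta>\<bar>"
        using m y1 by (intro mult_right_mono power_mono) auto
      then show "1 / 4 \<le> real ((nat \<lfloor>y\<rfloor>)\<^sup>2) * \<bar>\<theta>\<bar>" using y2 by (simp add: power_divide)
      have "(real (nat \<lfloor>y\<rfloor>))\<^sup>2 * \<bar>\<theta>\<bar> \<le> y\<^sup>2 * \<bar>\<theta>\<bar>"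
        using m by (intro mult_right_mono power_mono) auto
      then show "real ((nat \<lfloor>y\<rfloor>)\<^sup>2) * \<bar>\<theta>\<bar> \<le> pi" using y2 pi_gt3 by simp
    qed
  next
    case False
    show ?thesis by (rule that[of 1]) (use False x1 assms in auto)
  qed
  have sin_m: "(sin (real (m\<^sup>2) * \<theta> / 2))\<^sup>2 \<ge> 1 / 256"
  proof -
    have "1 / 8 / 2 \<le> sin (1 / 8 :: real)" by (rule sin_ge_half) auto
    also have "\<dots> \<le> sin (real (m\<^sup>2) * \<bar>\<theta>\<bar> / 2)"
      using m pi_gt3 by (intro sin_monotone_2pi_le) auto
    finally have "(1 / 16)\<^sup>2 \<le> (sin (real (m\<^sup>2) * \<bar>\<theta>\<bar> / 2))\<^sup>2" by (intro power_mono) auto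
    then show ?thesis by (auto simp: abs_if power_divide split: if_splits)
  qed
  define K where "K = 2 * m + L"
  define s where "s k = (sin (real (k * (k + 1)) * \<theta> / 4))\<^sup>2" for k :: nat
  have sum_s: "x / 8192 \<le> (\<Sum>k=1..K. s k)"
  proof -
    have "x / 2 * (1 / 256) \<le> real L * (sin (real (m\<^sup>2) * \<theta> / 2))\<^sup>2"
      using L sin_m x1 by (intro mult_mono) auto
    also have "\<dots> \<le> 16 * (\<Sum>k=1..K. s k)" unfolding K_def s_def by (rule sum_sin_square_triangular)
    finally show ?thesis by simp
  qed
  have "norm (phi \<theta>) \<le> exp (- (4 * c * (x / 8192) / 4))"
  proof (rule norm_phi_le_exp[of "{1} \<times> {1..K}" "Suc K" "\<lambda>p. 4 * c * s (snd p)"])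
    show "{1} \<times> {1..K} \<subseteq> box (Suc K)" by (auto simp: box_def)
    have "4 * c * (x / 8192) \<le> 4 * c * (\<Sum>k=1..K. s k)"
      using sum_s c by (intro mult_left_mono) auto
    also have "\<dots> = (\<Sum>p\<in>{1::nat} \<times> {1..K}. 4 * c * s (snd p))"
      unfolding sum.cartesian_product' by (simp add: sum_distrib_left)
    finally show "4 * c * (x / 8192) \<le> (\<Sum>p\<in>{1::nat} \<times> {1..K}. 4 * c * s (snd p))" .
    fix p :: "nat \<times> nat" assume "p \<in> {1} \<times> {1..K}"
    then obtain k where p: "p = (1, k)" "1 \<le> k" "k \<le> K" by auto
    then have pp: "p \<in> pos_pairs" by (simp add: pos_pairs_def)
    have d: "rep_dim p = real (k * (k + 1)) / 2" by (simp add: rep_dim_def p)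
    have "k * (k + 1) \<le> K * (K + K)" using p by (intro mult_le_mono) auto
    then have "real (k * (k + 1)) \<le> real (K * (K + K))" by (simp only: of_nat_le_iff)
    then have "rep_dim p \<le> (real K)\<^sup>2" unfolding d by (simp add: power2_eq_square)
    also have "\<dots> \<le> (3 * x)\<^sup>2" using m L by (intro power_mono) (auto simp: K_def)
    also have "\<dots> = 9 * (x * x)" by (simp add: power2_eq_square)
    also have "x * x = 1 / t"
      unfolding x_def powr_add[symmetric] using t_pos by (simp add: powr_minus_divide)
    finally have "t * rep_dim p \<le> 9" using t_pos by (simp add: field_simps)
    then have "bose2 9 \<le> bose2 (t * rep_dim p)"
      using t_pos rep_dim_pos[OF pp] by (intro bose2_antimono) auto
    then have cb: "c \<le> bose2 (t * rep_dim p)" using c by simp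
    have sk: "s k = (sin (\<theta> * rep_dim p / 2))\<^sup>2"
      unfolding s_def d by (simp add: mult_ac)
    have s1: "0 \<le> s k" "s k \<le> 1" unfolding s_def by (auto simp: power_le_one_iff abs_square_le_1)
    have "4 * c * s k \<le> 1 * 1" using c s1 by (intro mult_mono) auto
    moreover have "4 * c * s k \<le> 4 * bose2 (t * rep_dim p) * s k"
      using cb s1 by (intro mult_right_mono) auto
    ultimately show "0 \<le> 4 * c * s (snd p) \<and> 4 * c * s (snd p) \<le> 1 \<and>
        4 * c * s (snd p) \<le> 4 * bose2 (t * rep_dim p) * (sin (\<theta> * rep_dim p / 2))\<^sup>2"
      using c s1 by (simp add: p(1) sk)
  qed
  then show ?thesis by (simp add: c_def x_def mult_ac)
qed

text \<open>The factors and their Gaussian counterparts have modulus at most \<open>1\<close>, so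
  the difference of the products is at most the sum of the differences. With
  \<open>\<eta> = \<bar>\<theta>\<bar> / t\<close> the hypotheses of
  \<open>geometric_char_expansion\<close> hold uniformly in the pair, and its cubic term is charged
  to the variance at \<open>t / 2\<close> by \<open>bose_le_bose2_half\<close>.\<close>

lemma phi_gaussian_approx:
  assumes "\<bar>\<theta>\<bar> \<le> t"
  shows "norm (phi \<theta> - exp (\<i> * of_real (\<theta> * mean_N t) - of_real (\<theta>\<^sup>2 * var_N t / 2)))
     \<le> 15 * (\<bar>\<theta>\<bar> / t) * \<theta>\<^sup>2 * (var_N t + var_N (t / 2))"
proof -
  define \<eta> where "\<eta> = \<bar>\<theta>\<bar> / t"
  have \<eta>: "0 \<le> \<eta>" "\<eta> \<le> 1" "\<eta> * t = \<bar>\<theta>\<bar>" using assms t_pos by (auto simp: \<eta>_def)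
  define v where "v p = (rep_dim p)\<^sup>2 * bose2 (t * rep_dim p)" for p
  define v2 where "v2 p = (rep_dim p)\<^sup>2 * bose2 (t / 2 * rep_dim p)" for p
  define g where "g p = exp (\<i> * of_real (\<theta> * (rep_dim p * r p)) - complex_of_real (\<theta>\<^sup>2 * v p / 2))" for p
  have vpos: "v p \<ge> 0" "v2 p \<ge> 0" if "p \<in> pos_pairs" for p
    unfolding v_def v2_def using t_pos rep_dim_pos[OF that] bose2_pos[of "t * rep_dim p"] bose2_pos[of "t / 2 * rep_dim p"]
    by auto
  have fac: "norm (char_factor p \<theta> - g p) \<le> 15 * \<eta> * \<theta>\<^sup>2 * (v p + v2 p)" if p: "p \<in> pos_pairs" for p
  proof -
    let ?d = "rep_dim p" let ?\<alpha> = "\<theta> * ?d" let ?x = "t * ?d"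
    have d: "?d > 0" by (rule rep_dim_pos[OF p])
    have x: "?x > 0" using t_pos d by simp
    have e1: "\<bar>?\<alpha>\<bar> = \<eta> * ?x" using \<eta>(3) d by (simp add: abs_mult mult.assoc[symmetric])
    have e2: "?\<alpha>\<^sup>2 = \<eta>\<^sup>2 * ?x\<^sup>2" using e1 by (metis power2_abs power_mult_distrib)
    have "?x * r p \<le> 1" unfolding r_def by (rule bose_le[OF x])
    then have 1: "r p * \<bar>?\<alpha>\<bar> \<le> \<eta>" unfolding e1 using \<eta> mult_left_mono[of "?x * r p" 1 \<eta>] by (simp add: mult_ac)
    have "?x\<^sup>2 * (r p + (r p)\<^sup>2) \<le> 3" using bose2_le[OF x] by (simp add: bose2_def r_def)
    then have 2: "(r p + (r p)\<^sup>2) * ?\<alpha>\<^sup>2 \<le> 3 * \<eta>\<^sup>2"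
      unfolding e2 using mult_left_mono[of "?x\<^sup>2 * (r p + (r p)\<^sup>2)" 3 "\<eta>\<^sup>2"] by (simp add: mult_ac)
    have vd: "(r p + (r p)\<^sup>2) * ?\<alpha>\<^sup>2 = \<theta>\<^sup>2 * v p"
      by (simp add: v_def bose2_def r_def power_mult_distrib mult_ac)
    have rd: "r p * ?\<alpha> = \<theta> * (?d * r p)" by (simp add: mult_ac)
    have "norm (char_factor p \<theta> - g p) \<le> 15 * \<eta> * (\<theta>\<^sup>2 * v p) + r p * \<bar>?\<alpha>\<bar> ^ 3"
      using geometric_char_expansion[OF r_pos[OF p] 1 \<eta>(2) 2] unfolding vd rd char_factor_eq[OF p] g_def .
    also have "r p * \<bar>?\<alpha>\<bar> ^ 3 \<le> 2 * \<eta> * (\<theta>\<^sup>2 * v2 p)"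
    proof -
      have "?x * bose ?x \<le> 2 * bose2 (?x / 2)" by (rule bose_le_bose2_half[OF x])
      then have le: "(\<eta> * ?\<alpha>\<^sup>2) * (?x * r p) \<le> (\<eta> * ?\<alpha>\<^sup>2) * (2 * bose2 (?x / 2))"
        unfolding r_def using \<eta> by (intro mult_left_mono) auto
      have eq: "r p * \<bar>?\<alpha>\<bar> ^ 3 = (\<eta> * ?\<alpha>\<^sup>2) * (?x * r p)"
        unfolding abs_cube unfolding e1 by (simp add: mult_ac)
      have rhs: "(\<eta> * ?\<alpha>\<^sup>2) * (2 * bose2 (?x / 2)) = 2 * \<eta> * (\<theta>\<^sup>2 * v2 p)"
        by (simp add: v2_def power_mult_distrib mult_ac)
      show ?thesis using le unfolding eq rhs .
    qed
    also have "15 * \<eta> * (\<theta>\<^sup>2 * v p) + 2 * \<eta> * (\<theta>\<^sup>2 * v2 p) \<le> 15 * \<eta> * (\<theta>\<^sup>2 * v p) + 15 * \<eta> * (\<theta>\<^sup>2 * v2 p)"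
      using \<eta> vpos[OF p] by (intro add_left_mono mult_right_mono) auto
    finally show ?thesis by (simp add: algebra_simps)
  qed
  have sv: "v summable_on pos_pairs" "v2 summable_on pos_pairs"
    unfolding v_def v2_def by (rule var_N_summable, use t_pos in simp)+
  have iv: "infsum v pos_pairs = var_N t" "infsum v2 pos_pairs = var_N (t / 2)"
    unfolding v_def v2_def var_N_def by auto
  let ?B = "15 * \<eta> * \<theta>\<^sup>2 * (var_N t + var_N (t / 2))"
  have bound: "norm ((\<Prod>p\<in>box K. char_factor p \<theta>) - (\<Prod>p\<in>box K. g p)) \<le> ?B" for K
  proof -
    have "norm ((\<Prod>p\<in>box K. char_factor p \<theta>) - (\<Prod>p\<in>box K. g p)) \<le> (\<Sum>p\<in>box K. norm (char_factor p \<theta> - g p))"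
    proof (rule norm_prod_diff)
      fix p assume "p \<in> box K"
      then have p: "p \<in> pos_pairs" using box_subset by auto
      show "norm (char_factor p \<theta>) \<le> 1" by (rule norm_char_factor_le_1[OF p])
      show "norm (g p) \<le> 1" unfolding g_def using vpos[OF p] by simp
    qed
    also have "\<dots> \<le> (\<Sum>p\<in>box K. 15 * \<eta> * \<theta>\<^sup>2 * (v p + v2 p))"
      using box_subset by (intro sum_mono fac) auto
    also have "\<dots> = 15 * \<eta> * \<theta>\<^sup>2 * (sum v (box K) + sum v2 (box K))"
      by (simp add: sum_distrib_left[symmetric] sum.distrib)
    also have "\<dots> \<le> ?B"
      unfolding iv[symmetric] using \<eta> vpos box_subset
      by (intro mult_left_mono add_mono finite_sum_le_infsum sv box_finite) auto
    finally show ?thesis .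
  qed
  have "(\<lambda>K. \<Prod>p\<in>box K. g p) \<longlonglongrightarrow> exp (\<i> * of_real (\<theta> * mean_N t) - of_real (\<theta>\<^sup>2 * var_N t / 2))"
  proof -
    have "(\<Prod>p\<in>box K. g p) = exp (\<i> * of_real (\<theta> * (\<Sum>p\<in>box K. rep_dim p * r p)) - of_real (\<theta>\<^sup>2 * sum v (box K) / 2))" for K
      unfolding g_def exp_sum[OF box_finite, symmetric]
      by (simp add: sum_subtractf sum_distrib_left sum_divide_distrib)
    moreover have "(\<lambda>K. exp (\<i> * of_real (\<theta> * (\<Sum>p\<in>box K. rep_dim p * r p)) - of_real (\<theta>\<^sup>2 * sum v (box K) / 2))) \<longlonglongrightarrow>
        exp (\<i> * of_real (\<theta> * mean_N t) - complex_of_real (\<theta>\<^sup>2 * var_N t / 2))"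
      using mean_limit sum_box_tendsto[OF sv(1)] unfolding moments_S iv by (intro tendsto_intros) auto
    ultimately show ?thesis by simp
  qed
  then have "(\<lambda>K. norm ((\<Prod>p\<in>box K. char_factor p \<theta>) - (\<Prod>p\<in>box K. g p))) \<longlonglongrightarrow>
      norm (phi \<theta> - exp (\<i> * of_real (\<theta> * mean_N t) - of_real (\<theta>\<^sup>2 * var_N t / 2)))"
    by (intro tendsto_intros phi_limit)
  then have "norm (phi \<theta> - exp (\<i> * of_real (\<theta> * mean_N t) - of_real (\<theta>\<^sup>2 * var_N t / 2))) \<le> ?B"
    by (rule tendsto_upperbound) (use bound in \<open>auto intro!: always_eventually\<close>)
  then show ?thesis unfolding \<eta>_def .
qed

end

section \<open>The local limit theorem\<close>

lemma exp_minus_le_inverse: "y \<ge> 0 \<Longrightarrow> exp (- y) \<le> 1 / (1 + (y::real))"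
  using exp_ge_add_one_self[of y] by (simp add: exp_minus field_simps)

lemma power6_exp_le:
  assumes "c > 0" "x \<ge> (0::real)"
  shows "exp (- (c * x)) * x ^ 6 \<le> (6 / c) ^ 6"
proof -
  have "c * x / 6 \<le> exp (c * x / 6)" using exp_ge_add_one_self[of "c * x / 6"] by linarith
  then have "(c * x / 6) ^ 6 \<le> exp (c * x / 6) ^ 6" using assms by (intro power_mono) auto
  also have "\<dots> = exp (c * x)" by (simp flip: exp_of_nat_mult)
  finally have "(c / 6) ^ 6 * x ^ 6 \<le> exp (c * x)" by (simp add: power_mult_distrib power_divide)
  then have "x ^ 6 \<le> (6 / c) ^ 6 * exp (c * x)"
    using assms by (simp add: power_divide field_simps)
  then show ?thesis by (simp add: exp_minus field_simps)
qed

text \<open>The majorant for dominated convergence. For \<open>\<bar>\<theta>\<bar> \<le> t\<close>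
  the bound is Gaussian in \<open>s\<close> and stronger than needed; beyond that,
  \<open>1 + s\<^sup>2\<close> is at most a constant times \<open>t powr (- 8 / 3)\<close>, which
  the exponential of \<open>t powr (- 1 / 2)\<close> outweighs.\<close>

lemma (in geometric_family) norm_phi_le_rational:
  assumes t1: "t \<le> 1" and D: "var_N t \<le> D * t powr (- 8 / 3)" "D > 0" and v: "var_N t > 0"
    and s: "\<bar>s\<bar> \<le> pi * sqrt (var_N t)"
  shows "norm (phi (s / sqrt (var_N t))) \<le>
    (max 1 (256 * D) + (6 / (min (bose2 9) (1 / 4) / 8192)) ^ 6 * (1 + pi\<^sup>2 * D)) * inverse (1 + s\<^sup>2)"
proof -
  define \<theta> where "\<theta> = s / sqrt (var_N t)"
  \<comment> \<open>The maximum with \<open>1\<close> gives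
    \<open>(1 + s\<^sup>2) / D1 \<le> 1 + s\<^sup>2 / D1\<close>.\<close>
  define D1 where "D1 = max 1 (256 * D)"
  define c where "c = min (bose2 9) (1 / 4) / 8192"
  define W where "W = (6 / c) ^ 6 * (1 + pi\<^sup>2 * D)"
  have c: "c > 0" using bose2_pos[of 9] by (simp add: c_def)
  have W0: "W \<ge> 0" "D1 \<ge> 1" "D1 \<ge> 256 * D" using c D by (auto simp: W_def D1_def intro!: mult_nonneg_nonneg add_nonneg_nonneg)
  have tp: "t powr (- 8 / 3) \<ge> 1" using powr_mono2'[of "- 8 / 3" t 1] t_pos t1 by simp
  have \<theta>2: "\<theta>\<^sup>2 * var_N t = s\<^sup>2" using v by (simp add: \<theta>_def power_divide)
  have pos: "1 + s\<^sup>2 > 0" by (simp add: add_pos_nonneg)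
  have "norm (phi \<theta>) \<le> (D1 + W) / (1 + s\<^sup>2)"
  proof (cases "\<bar>\<theta>\<bar> \<le> t")
    case True
    have "s\<^sup>2 \<le> \<theta>\<^sup>2 * (D * t powr (- 8 / 3))" unfolding \<theta>2[symmetric] using D by (intro mult_left_mono) auto
    then have "s\<^sup>2 / (256 * D) \<le> \<theta>\<^sup>2 * t powr (- 8 / 3) / 256" using D(2) by (simp add: field_simps)
    moreover have "s\<^sup>2 / D1 \<le> s\<^sup>2 / (256 * D)" using W0 D by (intro divide_left_mono) auto
    ultimately have le: "s\<^sup>2 / D1 \<le> \<theta>\<^sup>2 * t powr (- 8 / 3) / 256" by linarith
    have "norm (phi \<theta>) \<le> exp (- (\<theta>\<^sup>2 * t powr (- 8 / 3) / 256))" by (rule norm_phi_near[OF t1 True])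
    also have "\<dots> \<le> exp (- (s\<^sup>2 / D1))" using le by simp
    also have "\<dots> \<le> 1 / (1 + s\<^sup>2 / D1)" using W0 by (intro exp_minus_le_inverse) auto
    also have "\<dots> \<le> 1 / ((1 + s\<^sup>2) / D1)"
    proof (intro divide_left_mono mult_pos_pos divide_pos_pos)
      show "(1 + s\<^sup>2) / D1 \<le> 1 + s\<^sup>2 / D1" using W0 by (simp add: add_divide_distrib)
    qed (use W0 pos in \<open>auto intro!: add_pos_nonneg\<close>)
    also have "\<dots> \<le> (D1 + W) / (1 + s\<^sup>2)" using W0 pos by (simp add: divide_right_mono)
    finally show ?thesis .
  next
    case False
    define x where "x = t powr (- 1 / 2)"
    have "\<bar>\<theta>\<bar> \<le> pi" using s v by (simp add: \<theta>_def divide_le_eq)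
    then have "norm (phi \<theta>) \<le> exp (- (c * x))"
      using norm_phi_far[of \<theta>] False t1 by (simp add: c_def x_def)
    moreover have "exp (- (c * x)) * (1 + s\<^sup>2) \<le> W"
    proof -
      have "s\<^sup>2 \<le> (pi * sqrt (var_N t))\<^sup>2" using power_mono[OF s, of 2] by simp
      also have "\<dots> = pi\<^sup>2 * var_N t" using v by (simp add: power_mult_distrib)
      also have "\<dots> \<le> pi\<^sup>2 * (D * t powr (- 8 / 3))" using D by (intro mult_left_mono) auto
      finally have "1 + s\<^sup>2 \<le> t powr (- 8 / 3) + pi\<^sup>2 * (D * t powr (- 8 / 3))" using tp by linarith
      also have "\<dots> = (1 + pi\<^sup>2 * D) * t powr (- 8 / 3)" by (simp add: algebra_simps)
      also have "\<dots> \<le> (1 + pi\<^sup>2 * D) * x ^ 6"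
      proof (rule mult_left_mono)
        \<comment> \<open>Rounded to an integer power of \<open>x\<close>, namely
          \<open>t powr (- 3) = x ^ 6\<close>, to match \<open>power6_exp_le\<close>.\<close>
        have "t powr (- 8 / 3) \<le> t powr (- 3)" using t_pos t1 by (intro powr_mono') auto
        also have "\<dots> = x powr 6" unfolding x_def powr_powr by simp
        also have "\<dots> = x ^ 6" using t_pos by (simp add: x_def)
        finally show "t powr (- 8 / 3) \<le> x ^ 6" .
      qed (use D in \<open>auto intro!: add_nonneg_nonneg mult_nonneg_nonneg\<close>)
      finally have "exp (- (c * x)) * (1 + s\<^sup>2) \<le> exp (- (c * x)) * ((1 + pi\<^sup>2 * D) * x ^ 6)"
        by (intro mult_left_mono) auto
      also have "\<dots> = (exp (- (c * x)) * x ^ 6) * (1 + pi\<^sup>2 * D)" by simp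
      also have "\<dots> \<le> (6 / c) ^ 6 * (1 + pi\<^sup>2 * D)"
        using D c by (intro mult_right_mono power6_exp_le) (auto simp: x_def intro!: add_nonneg_nonneg)
      finally show ?thesis by (simp add: W_def)
    qed
    then have "exp (- (c * x)) \<le> W / (1 + s\<^sup>2)" using pos by (simp add: le_divide_eq)
    moreover have "W / (1 + s\<^sup>2) \<le> (D1 + W) / (1 + s\<^sup>2)" using W0 pos by (intro divide_right_mono) auto
    ultimately show ?thesis by linarith
  qed
  then show ?thesis unfolding \<theta>_def D1_def W_def c_def divide_inverse .
qed

section \<open>The standard deviation along the sequence of parameters\<close>

lemma var_N_pos:
  assumes "t > 0"
  shows "var_N t > 0"
proof -
  have p: "(1, 1) \<in> pos_pairs" by (simp add: pos_pairs_def)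
  have "0 < (rep_dim (1, 1))\<^sup>2 * bose2 (t * rep_dim (1, 1))"
    using assms rep_dim_pos[OF p] by (intro mult_pos_pos bose2_pos) auto
  also have "\<dots> = (\<Sum>p\<in>{(1, 1)}. (rep_dim p)\<^sup>2 * bose2 (t * rep_dim p))" by simp
  also have "\<dots> \<le> var_N t"
    unfolding var_N_def
  proof (intro finite_sum_le_infsum var_N_summable)
    fix p assume "p \<in> pos_pairs - {(1, 1)}"
    then have "t * rep_dim p > 0" using rep_dim_pos[of p] assms by simp
    from bose2_pos[OF this] show "0 \<le> (rep_dim p)\<^sup>2 * bose2 (t * rep_dim p)" by simp
  qed (use p assms in auto)
  finally show ?thesis .
qed

lemma sigma_seq_asymp: "(\<lambda>n. sqrt (var_N (t_seq n)) / real n powr (4 / 5)) \<longlonglongrightarrow> sqrt (5 / 6) / const_X"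
proof -
  have "(\<lambda>n. sqrt (var_N (t_seq n) / real n powr (8 / 5))) \<longlonglongrightarrow> sqrt (5 / (6 * const_X\<^sup>2))"
    by (intro tendsto_real_sqrt var_seq_asymp)
  moreover have "sqrt (real n powr (8 / 5)) = real n powr (4 / 5)" for n
    using powr_half_sqrt[of "real n powr (8 / 5)"] by (simp add: powr_powr)
  moreover have "sqrt (5 / (6 * const_X\<^sup>2)) = sqrt (5 / 6) / const_X"
    using const_X_pos by (simp add: real_sqrt_divide real_sqrt_mult)
  ultimately show ?thesis by (simp add: real_sqrt_divide)
qed

lemma mean_error_seq: "(\<lambda>n. (mean_N (t_seq n) - real n) / sqrt (var_N (t_seq n))) \<longlonglongrightarrow> 0"
proof -
  have "(\<lambda>n. ((mean_N (t_seq n) - real n) / real n powr (4 / 5)) / (sqrt (var_N (t_seq n)) / real n powr (4 / 5)))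
      \<longlonglongrightarrow> 0 / (sqrt (5 / 6) / const_X)"
    using const_X_pos by (intro tendsto_divide mean_seq_asymp sigma_seq_asymp) auto
  then have "(\<lambda>n. ((mean_N (t_seq n) - real n) / real n powr (4 / 5)) / (sqrt (var_N (t_seq n)) / real n powr (4 / 5)))
      \<longlonglongrightarrow> 0" by simp
  then show ?thesis
    by (rule Lim_transform_eventually) (use eventually_gt_at_top[of 0] in eventually_elim, simp)
qed

text \<open>The product has order \<open>n powr (1 / 5)\<close>. Hence every fixed \<open>s\<close>
  eventually satisfies \<open>\<bar>s\<bar> / \<sigma> \<le> t\<close>, the range of the Gaussian
  approximation, and the error factor \<open>\<bar>\<theta>\<bar> / t\<close> tends to
  \<open>0\<close>.\<close>

lemma sigma_t_seq: "filterlim (\<lambda>n. sqrt (var_N (t_seq n)) * t_seq n) at_top sequentially"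
proof -
  have "filterlim (\<lambda>n. (sqrt (var_N (t_seq n)) / real n powr (4 / 5)) * (t_seq n / real n powr (- 3 / 5)) * real n powr (1 / 5))
      at_top sequentially"
  proof (rule filterlim_tendsto_pos_mult_at_top)
    show "(\<lambda>n. (sqrt (var_N (t_seq n)) / real n powr (4 / 5)) * (t_seq n / real n powr (- 3 / 5))) \<longlonglongrightarrow>
        sqrt (5 / 6) / const_X * tau1"
      by (intro tendsto_mult sigma_seq_asymp t_seq_asymp)
    show "0 < sqrt (5 / 6) / const_X * tau1" using const_X_pos tau1_pos by simp
    show "filterlim (\<lambda>n. real n powr (1 / 5)) at_top sequentially" by real_asymp
  qed
  moreover have "\<forall>\<^sub>F n in sequentially. (sqrt (var_N (t_seq n)) / real n powr (4 / 5)) * (t_seq n / real n powr (- 3 / 5)) * real n powr (1 / 5)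
      = sqrt (var_N (t_seq n)) * t_seq n"
    using eventually_gt_at_top[of 0]
  proof eventually_elim
    case (elim n)
    have "real n powr (4 / 5) * real n powr (- 3 / 5) = real n powr (1 / 5)"
      unfolding powr_add[symmetric] by simp
    moreover have "real n powr (4 / 5) \<noteq> 0" "real n powr (- 3 / 5) \<noteq> 0" using elim by auto
    ultimately show ?case by (simp add: field_simps)
  qed
  ultimately show ?thesis by (rule filterlim_cong[OF refl refl, THEN iffD1, rotated])
qed

text \<open>Shows that the variance at \<open>t / 2\<close> in the error of
  \<open>phi_gaussian_approx\<close> is comparable to the one at \<open>t\<close>.\<close>

lemma var_ratio_seq: "(\<lambda>n. var_N (t_seq n / 2) / var_N (t_seq n)) \<longlonglongrightarrow> 2 powr (8 / 3)"
proof -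
  have m: "5 / 3 * mean_coeff \<noteq> 0" using mean_coeff_pos by simp
  have "filterlim (\<lambda>t::real. t / 2) (at_right 0) (at_right 0)" by real_asymp
  then have half: "filterlim (\<lambda>n. t_seq n / 2) (at_right 0) sequentially"
    by (rule filterlim_compose[OF _ t_seq_at_right_0])
  have "(\<lambda>n. 2 powr (8 / 3) * (((t_seq n / 2) powr (8 / 3) * var_N (t_seq n / 2)) / (t_seq n powr (8 / 3) * var_N (t_seq n)))) \<longlonglongrightarrow>
      2 powr (8 / 3) * ((5 / 3 * mean_coeff) / (5 / 3 * mean_coeff))"
    using m by (intro tendsto_mult tendsto_divide tendsto_const filterlim_compose[OF var_N_leading half]
        filterlim_compose[OF var_N_leading t_seq_at_right_0])
  then have "(\<lambda>n. 2 powr (8 / 3) * (((t_seq n / 2) powr (8 / 3) * var_N (t_seq n / 2)) / (t_seq n powr (8 / 3) * var_N (t_seq n)))) \<longlonglongrightarrow>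
      2 powr (8 / 3)" using m by simp
  then show ?thesis
  proof (rule Lim_transform_eventually)
    show "\<forall>\<^sub>F n in sequentially. 2 powr (8 / 3) * (((t_seq n / 2) powr (8 / 3) * var_N (t_seq n / 2)) / (t_seq n powr (8 / 3) * var_N (t_seq n))) =
        var_N (t_seq n / 2) / var_N (t_seq n)"
      using t_seq_pos by eventually_elim (simp add: powr_divide)
  qed
qed

lemma geometric_family_of_model:
  assumes "geometric_model M X" "t > 0"
  shows "geometric_family (M t) (X t) t"
proof -
  have m: "prob_space (M t)" "prob_space.indep_vars (M t) (\<lambda>_. count_space UNIV) (X t) pos_pairs"
    "\<And>j k m. (j, k) \<in> pos_pairs \<Longrightarrow> measure (M t) {\<omega> \<in> space (M t). X t (j,k) \<omega> = m} =
          (1 - exp (- (real (j * k * (j + k)) * t / 2))) * exp (- (real (j * k * (j + k)) * real m * t / 2))"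
  proof -
    note * = assms(1)[unfolded geometric_model_def, rule_format, OF assms(2)]
    show "prob_space (M t)" "prob_space.indep_vars (M t) (\<lambda>_. count_space UNIV) (X t) pos_pairs"
      using * by blast+
    fix j k m assume "(j, k) \<in> pos_pairs"
    from bspec[OF conjunct2[OF conjunct2[OF *]] this]
    show "measure (M t) {\<omega> \<in> space (M t). X t (j,k) \<omega> = m} =
          (1 - exp (- (real (j * k * (j + k)) * t / 2))) * exp (- (real (j * k * (j + k)) * real m * t / 2))"
      unfolding prod.case by (rule spec)
  qed
  interpret prob_space "M t" by (rule m(1))
  show ?thesis
  proof
    fix p m assume p: "p \<in> pos_pairs"
    obtain j k where jk: "p = (j, k)" by (cases p)
    have "exp (- (real (j * k * (j + k)) * real m * t / 2)) = exp (- (t * rep_dim p)) ^ m"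
      unfolding exp_of_nat_mult[symmetric] by (simp add: rep_dim_def jk mult_ac)
    moreover have "exp (- (real (j * k * (j + k)) * t / 2)) = exp (- (t * rep_dim p))"
      by (simp add: rep_dim_def jk mult_ac)
    ultimately show "prob {\<omega> \<in> space (M t). X t p \<omega> = m} = (1 - exp (- (t * rep_dim p))) * exp (- (t * rep_dim p)) ^ m"
      using m(3)[of j k m] p unfolding jk by simp
  qed (use m(2) assms(2) in auto)
qed

text \<open>Fourier inversion in the variable \<open>s = \<sigma> * \<theta>\<close>, followed by
  dominated convergence to the integral of \<open>exp (- s\<^sup>2 / 2)\<close>.\<close>

lemma local_limit:
  fixes M :: "real \<Rightarrow> 'a measure" and X :: "real \<Rightarrow> nat \<times> nat \<Rightarrow> 'a \<Rightarrow> nat"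
  assumes model: "geometric_model M X"
  shows "(\<lambda>n. 2 * pi * sqrt (var_N (t_seq n)) *
    measure (M (t_seq n)) {\<omega> \<in> space (M (t_seq n)). N_sum (X (t_seq n)) \<omega> = of_nat n}) \<longlonglongrightarrow> sqrt (2 * pi)"
proof -
  define \<sigma> where "\<sigma> n = sqrt (var_N (t_seq n))" for n
  define ph where "ph n = geometric_family.phi (M (t_seq n)) (X (t_seq n))" for n
  define P where "P n = measure (M (t_seq n)) {\<omega> \<in> space (M (t_seq n)). N_sum (X (t_seq n)) \<omega> = of_nat n}" for n
  \<comment> \<open>Any number above the limit of \<open>t powr (8 / 3) * var_N t\<close> serves
    here.\<close>
  define D where "D = 5 / 3 * mean_coeff + 1"
  define B where "B = max 1 (256 * D) + (6 / (min (bose2 9) (1 / 4) / 8192)) ^ 6 * (1 + pi\<^sup>2 * D)"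
  have D: "D > 0" using mean_coeff_pos by (simp add: D_def add_pos_pos)
  \<comment> \<open>These conditions make the probabilistic locale and the majorant available. They
    hold eventually; setting \<open>h n\<close> to zero for the other \<open>n\<close> makes
    measurability and domination hold for all \<open>n\<close>.\<close>
  define good where "good n \<longleftrightarrow> 0 < t_seq n \<and> t_seq n \<le> 1 \<and> var_N (t_seq n) \<le> D * t_seq n powr (- 8 / 3)" for n
  have fam: "geometric_family (M (t_seq n)) (X (t_seq n)) (t_seq n)" if "good n" for n
    using that model by (intro geometric_family_of_model) (auto simp: good_def)
  have \<sigma>pos: "\<sigma> n > 0" if "good n" for n using that var_N_pos by (simp add: good_def \<sigma>_def)
  have ev_good: "\<forall>\<^sub>F n in sequentially. good n"
  proof -
    have "\<forall>\<^sub>F t in at_right 0. t powr (8 / 3) * var_N t < D"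
      by (rule order_tendstoD(2)[OF var_N_leading]) (simp add: D_def)
    moreover have "\<forall>\<^sub>F t in at_right (0::real). 0 < t \<and> t \<le> 1"
      unfolding eventually_at_right_field by (intro exI[of _ 1]) auto
    ultimately have "\<forall>\<^sub>F t in at_right 0. 0 < t \<and> t \<le> 1 \<and> var_N t \<le> D * t powr (- 8 / 3)"
    proof eventually_elim
      case (elim t)
      have "t powr (8 / 3) * t powr (- 8 / 3) = 1" unfolding powr_add[symmetric] using elim by simp
      then have "var_N t = (t powr (8 / 3) * var_N t) * t powr (- 8 / 3)" by (simp add: mult_ac)
      also have "\<dots> \<le> D * t powr (- 8 / 3)" using elim by (intro mult_right_mono) auto
      finally show ?case using elim by simp
    qed
    then show ?thesis unfolding good_def by (rule eventually_compose_filterlim[OF _ t_seq_at_right_0])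
  qed
  define h where "h n s = (if good n then indicator {- (pi * \<sigma> n)..pi * \<sigma> n} s * (ph n (s / \<sigma> n) * iexp (- (s / \<sigma> n * real n))) else 0)" for n s
  have h_int: "(CLINT s|lborel. h n s) = of_real (2 * pi * \<sigma> n * P n)" if g: "good n" for n
  proof -
    interpret F: geometric_family "M (t_seq n)" "X (t_seq n)" "t_seq n" by (rule fam[OF g])
    have s: "\<sigma> n > 0" by (rule \<sigma>pos[OF g])
    have "complex_of_real (2 * pi * P n) = (CLINT \<theta>|lborel. indicator {- pi..pi} \<theta> * (ph n \<theta> * iexp (- (\<theta> * real n))))"
      unfolding P_def ph_def by (rule F.inversion_N)
    also have "\<dots> = \<bar>1 / \<sigma> n\<bar> *\<^sub>R (CLINT s|lborel. indicator {- pi..pi} (0 + 1 / \<sigma> n * s) * (ph n (0 + 1 / \<sigma> n * s) * iexp (- ((0 + 1 / \<sigma> n * s) * real n))))"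
      by (rule lborel_integral_real_affine) (use s in simp)
    also have "(CLINT s|lborel. indicator {- pi..pi} (0 + 1 / \<sigma> n * s) * (ph n (0 + 1 / \<sigma> n * s) * iexp (- ((0 + 1 / \<sigma> n * s) * real n)))) =
        (CLINT s|lborel. h n s)"
    proof (rule Bochner_Integration.integral_cong[OF refl])
      fix x
      have "(indicator {- pi..pi} (x / \<sigma> n) :: complex) = indicator {- (pi * \<sigma> n)..pi * \<sigma> n} x"
        using s by (auto simp: indicator_def field_simps)
      then show "indicator {- pi..pi} (0 + 1 / \<sigma> n * x) * (ph n (0 + 1 / \<sigma> n * x) * iexp (- ((0 + 1 / \<sigma> n * x) * real n))) = h n x"
        using g by (simp add: h_def)
    qed
    finally have "complex_of_real (2 * pi * P n) = (1 / \<sigma> n) *\<^sub>R (CLINT s|lborel. h n s)" using s by simp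
    then have "\<sigma> n *\<^sub>R complex_of_real (2 * pi * P n) = (CLINT s|lborel. h n s)" using s by simp
    then show ?thesis by (simp add: scaleR_conv_of_real mult_ac)
  qed
  have h_meas: "h n \<in> borel_measurable lborel" for n
  proof (cases "good n")
    case True
    interpret F: geometric_family "M (t_seq n)" "X (t_seq n)" "t_seq n" by (rule fam[OF True])
    have [measurable]: "ph n \<in> borel_measurable borel" unfolding ph_def by (rule F.phi_measurable)
    show ?thesis unfolding h_def using True by simp
  next
    case False
    then show ?thesis unfolding h_def by simp
  qed
  have h_bound: "norm (h n s) \<le> B * inverse (1 + s\<^sup>2)" for n s
  proof (cases "good n \<and> \<bar>s\<bar> \<le> pi * \<sigma> n")
    case True
    interpret F: geometric_family "M (t_seq n)" "X (t_seq n)" "t_seq n" by (rule fam) (use True in simp)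
    have "norm (h n s) \<le> norm (ph n (s / \<sigma> n))"
      by (auto simp: h_def norm_mult indicator_def)
    also have "\<dots> \<le> B * inverse (1 + s\<^sup>2)"
      unfolding ph_def \<sigma>_def B_def
      using True D by (intro F.norm_phi_le_rational var_N_pos) (auto simp: good_def \<sigma>_def)
    finally show ?thesis .
  next
    case False
    have "B \<ge> 0" using D bose2_pos[of 9] unfolding B_def
      by (intro add_nonneg_nonneg mult_nonneg_nonneg zero_le_power) auto
    moreover have "h n s = 0" using False by (auto simp: h_def indicator_def)
    ultimately show ?thesis by (simp add: add_nonneg_nonneg)
  qed
  have h_lim: "(\<lambda>n. h n s) \<longlonglongrightarrow> of_real (exp (- (s\<^sup>2 / 2)))" for s
  proof -
    have c0: "(\<lambda>n. 1 / (\<sigma> n * t_seq n)) \<longlonglongrightarrow> 0"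
      using tendsto_inverse_0_at_top[OF sigma_t_seq] by (simp add: \<sigma>_def inverse_eq_divide)
    define G where "G n = exp (\<i> * of_real (s / \<sigma> n * mean_N (t_seq n)) - complex_of_real (s\<^sup>2 / 2))" for n
    \<comment> \<open>The error of \<open>phi_gaussian_approx\<close> at
      \<open>\<theta> = s / \<sigma> n\<close>, with
      \<open>\<theta>\<^sup>2 * var_N (t_seq n) = s\<^sup>2\<close> factored out.\<close>
    define E where "E n = 15 * (\<bar>s\<bar> * (1 / (\<sigma> n * t_seq n))) * (s\<^sup>2 * (1 + var_N (t_seq n / 2) / var_N (t_seq n)))" for n
    have "E \<longlonglongrightarrow> 15 * (\<bar>s\<bar> * 0) * (s\<^sup>2 * (1 + 2 powr (8 / 3)))"
      unfolding E_def by (intro tendsto_intros c0 var_ratio_seq)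
    then have E: "E \<longlonglongrightarrow> 0" by simp
    have ev_small: "\<forall>\<^sub>F n in sequentially. \<bar>s\<bar> * (1 / (\<sigma> n * t_seq n)) < 1"
    proof (rule order_tendstoD(2))
      show "(\<lambda>n. \<bar>s\<bar> * (1 / (\<sigma> n * t_seq n))) \<longlonglongrightarrow> \<bar>s\<bar> * 0"
        by (intro tendsto_mult tendsto_const c0)
    qed simp
    have err: "\<forall>\<^sub>F n in sequentially. norm (h n s - G n * iexp (- (s / \<sigma> n * real n))) \<le> E n"
      using ev_good ev_small
    proof eventually_elim
      case (elim n)
      interpret F: geometric_family "M (t_seq n)" "X (t_seq n)" "t_seq n" by (rule fam[OF elim(1)])
      have sp: "\<sigma> n > 0" by (rule \<sigma>pos[OF elim(1)])
      have tp: "0 < t_seq n" "t_seq n \<le> 1" using elim by (auto simp: good_def)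
      have vp: "var_N (t_seq n) > 0" "(\<sigma> n)\<^sup>2 = var_N (t_seq n)" using var_N_pos[OF tp(1)] by (auto simp: \<sigma>_def)
      have st: "\<bar>s / \<sigma> n\<bar> \<le> t_seq n" using elim(2) sp tp by (simp add: abs_divide field_simps)
      have "\<bar>s\<bar> \<le> t_seq n * \<sigma> n" using st sp by (simp add: abs_divide divide_le_eq)
      also have "\<dots> \<le> pi * \<sigma> n" using sp tp pi_gt3 by (intro mult_right_mono) auto
      finally have "indicator {- (pi * \<sigma> n)..pi * \<sigma> n} s = (1 :: complex)" by (auto simp: indicator_def)
      then have "h n s - G n * iexp (- (s / \<sigma> n * real n)) = (ph n (s / \<sigma> n) - G n) * iexp (- (s / \<sigma> n * real n))"
        using elim(1) by (simp add: h_def algebra_simps)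
      then have "norm (h n s - G n * iexp (- (s / \<sigma> n * real n))) = norm (ph n (s / \<sigma> n) - G n)"
        by (simp add: norm_mult)
      also have "norm (ph n (s / \<sigma> n) - G n) \<le> 15 * (\<bar>s / \<sigma> n\<bar> / t_seq n) * (s / \<sigma> n)\<^sup>2 * (var_N (t_seq n) + var_N (t_seq n / 2))"
      proof -
        have G: "G n = exp (\<i> * of_real (s / \<sigma> n * mean_N (t_seq n)) - of_real ((s / \<sigma> n)\<^sup>2 * var_N (t_seq n) / 2))"
          using vp by (simp add: G_def power_divide)
        show ?thesis unfolding ph_def G by (rule F.phi_gaussian_approx[OF st])
      qed
      also have "\<dots> = E n"
        unfolding E_def power_divide vp(2) using sp tp vp(1) by (simp add: abs_divide field_simps)
      finally show ?case .
    qed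
    have "(\<lambda>n. h n s - G n * iexp (- (s / \<sigma> n * real n))) \<longlonglongrightarrow> 0"
      by (rule Lim_null_comparison[OF err E])
    \<comment> \<open>The two oscillating phases nearly cancel: what remains is
      \<open>s * (mean_N (t_seq n) - n) / \<sigma> n\<close>, which tends to \<open>0\<close> by
      \<open>mean_error_seq\<close>.\<close>
    moreover have "(\<lambda>n. G n * iexp (- (s / \<sigma> n * real n))) \<longlonglongrightarrow> of_real (exp (- (s\<^sup>2 / 2)))"
    proof -
      have "(\<lambda>n. exp (\<i> * of_real (s * ((mean_N (t_seq n) - real n) / \<sigma> n)) - complex_of_real (s\<^sup>2 / 2))) \<longlonglongrightarrow>
          exp (\<i> * of_real (s * 0) - complex_of_real (s\<^sup>2 / 2))"
        unfolding \<sigma>_def by (intro tendsto_intros mean_error_seq)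
      moreover have "exp (\<i> * of_real (s * ((mean_N (t_seq n) - real n) / \<sigma> n)) - complex_of_real (s\<^sup>2 / 2)) =
          G n * iexp (- (s / \<sigma> n * real n))" for n
        unfolding G_def exp_add[symmetric]
        by (rule arg_cong[of _ _ exp]) (simp add: algebra_simps diff_divide_distrib)
      moreover have "exp (\<i> * of_real (s * 0) - complex_of_real (s\<^sup>2 / 2)) = of_real (exp (- (s\<^sup>2 / 2)))"
        by (simp flip: exp_of_real)
      ultimately show ?thesis by simp
    qed
    ultimately have "(\<lambda>n. (h n s - G n * iexp (- (s / \<sigma> n * real n))) + G n * iexp (- (s / \<sigma> n * real n))) \<longlonglongrightarrow>
        0 + of_real (exp (- (s\<^sup>2 / 2)))" by (rule tendsto_add)
    then show ?thesis by simp
  qed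
  have "(\<lambda>n. CLINT s|lborel. h n s) \<longlonglongrightarrow> (CLINT s|lborel. of_real (exp (- (s\<^sup>2 / 2))))"
  proof (rule integral_dominated_convergence)
    have "integrable lborel (\<lambda>x::real. inverse (1 + x\<^sup>2))"
      using integrable_inverse_1_plus_square by (simp add: set_integrable_def)
    then show "integrable lborel (\<lambda>s. B * inverse (1 + s\<^sup>2))" by (rule integrable_mult_right)
    show "(\<lambda>s. complex_of_real (exp (- (s\<^sup>2 / 2)))) \<in> borel_measurable lborel" by simp
  qed (use h_meas h_bound h_lim in auto)
  also have "(CLINT s|lborel. of_real (exp (- (s\<^sup>2 / 2)))) = complex_of_real (sqrt (2 * pi))"
  proof -
    have "(LBINT s. std_normal_density s) = 1"
      by (rule integral_normal_density) simp
    then have "(LBINT s. 1 / sqrt (2 * pi) * exp (- (s\<^sup>2 / 2))) = 1"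
      by (simp only: std_normal_density_def minus_divide_left)
    then have I: "1 / sqrt (2 * pi) * (LBINT s. exp (- (s\<^sup>2 / 2))) = 1"
      by (subst (asm) integral_mult_right_zero)
    have "x = a" if "1 / a * x = 1" "a > 0" for a x :: real
      using that by (simp add: field_simps)
    from this[OF I] have "(LBINT s. exp (- (s\<^sup>2 / 2))) = sqrt (2 * pi)" by simp
    then show ?thesis by (simp only: integral_complex_of_real)
  qed
  finally have lim: "(\<lambda>n. CLINT s|lborel. h n s) \<longlonglongrightarrow> complex_of_real (sqrt (2 * pi))" .
  have "(\<lambda>n. complex_of_real (2 * pi * \<sigma> n * P n)) \<longlonglongrightarrow> complex_of_real (sqrt (2 * pi))"
    by (rule Lim_transform_eventually[OF lim]) (use ev_good in eventually_elim, rule h_int)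
  then show ?thesis unfolding tendsto_of_real_iff \<sigma>_def P_def .
qed

theorem theorem9p2:
  fixes M :: "real \<Rightarrow> 'a measure" and X :: "real \<Rightarrow> nat \<times> nat \<Rightarrow> 'a \<Rightarrow> nat"
  assumes "geometric_model M X"
  shows "(\<forall>t>0. AE \<omega> in M t. N_sum (X t) \<omega> < \<infinity>) \<and>
    (\<lambda>n. measure (M (t_seq n)) {\<omega> \<in> space (M (t_seq n)). N_sum (X (t_seq n)) \<omega> = of_nat n})
      \<sim>[at_top] (\<lambda>n. 1 / sqrt (2 * pi * N_variance (M (t_seq n)) (X (t_seq n)))) \<and>
    (\<lambda>n. measure (M (t_seq n)) {\<omega> \<in> space (M (t_seq n)). N_sum (X (t_seq n)) \<omega> = of_nat n})
      \<sim>[at_top] (\<lambda>n. sqrt 3 * const_X / sqrt (5 * pi) * real n powr (- 4 / 5))"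
proof (intro conjI allI impI)
  fix t :: real assume "t > 0"
  then interpret F: geometric_family "M t" "X t" t by (rule geometric_family_of_model[OF assms])
  show "AE \<omega> in M t. N_sum (X t) \<omega> < \<infinity>" by (rule F.N_sum_finite)
next
  define P where "P n = measure (M (t_seq n)) {\<omega> \<in> space (M (t_seq n)). N_sum (X (t_seq n)) \<omega> = of_nat n}" for n
  define \<sigma> where "\<sigma> n = sqrt (var_N (t_seq n))" for n
  have lim: "(\<lambda>n. 2 * pi * \<sigma> n * P n) \<longlonglongrightarrow> sqrt (2 * pi)"
    unfolding P_def \<sigma>_def by (rule local_limit[OF assms])
  have pp: "sqrt (2 * pi) * sqrt (2 * pi) = 2 * pi" "sqrt (2 * pi) > 0" by simp_all
  have "(\<lambda>n. P n / (1 / sqrt (2 * pi * N_variance (M (t_seq n)) (X (t_seq n))))) \<longlonglongrightarrow> 1"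
  proof (rule Lim_transform_eventually)
    have "(\<lambda>n. 2 * pi * \<sigma> n * P n / sqrt (2 * pi)) \<longlonglongrightarrow> sqrt (2 * pi) / sqrt (2 * pi)"
      using pp by (intro tendsto_divide lim tendsto_const) auto
    then show "(\<lambda>n. 2 * pi * \<sigma> n * P n / sqrt (2 * pi)) \<longlonglongrightarrow> 1" using pp by simp
    show "\<forall>\<^sub>F n in sequentially. 2 * pi * \<sigma> n * P n / sqrt (2 * pi) = P n / (1 / sqrt (2 * pi * N_variance (M (t_seq n)) (X (t_seq n))))"
      using t_seq_pos
    proof eventually_elim
      case (elim n)
      interpret F: geometric_family "M (t_seq n)" "X (t_seq n)" "t_seq n"
        by (rule geometric_family_of_model[OF assms elim])
      have "sqrt (2 * pi * var_N (t_seq n)) = sqrt (2 * pi) * \<sigma> n" by (simp only: \<sigma>_def real_sqrt_mult)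
      moreover have "2 * pi * \<sigma> n * P n / sqrt (2 * pi) = P n * (sqrt (2 * pi) * \<sigma> n)"
      proof -
        have "(a * a) * x * y / a = y * (a * x)" if "a > 0" for a x y :: real
          using that by simp
        from this[OF pp(2), of "\<sigma> n" "P n"] show ?thesis unfolding pp(1) .
      qed
      ultimately show ?case unfolding F.variance_N by simp
    qed
  qed
  then show "P \<sim>[at_top] (\<lambda>n. 1 / sqrt (2 * pi * N_variance (M (t_seq n)) (X (t_seq n))))"
    by (rule asymp_equivI')
  have "(\<lambda>n. P n / (sqrt 3 * const_X / sqrt (5 * pi) * real n powr (- 4 / 5))) \<longlonglongrightarrow> 1"
  proof (rule Lim_transform_eventually)
    \<comment> \<open>The claimed constant times \<open>2 * pi\<close>. Since
      \<open>\<sigma> n\<close> behaves like \<open>sqrt (5 / 6) / const_X * n powr (4 / 5)\<close>,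
      the claim reduces to the identity \<open>k\<close>.\<close>
    let ?c = "2 * pi * (sqrt 3 * const_X / sqrt (5 * pi))"
    have k: "sqrt (5 / 6) / const_X * ?c = sqrt (2 * pi)"
    proof -
      have "sqrt (5 / 6) / const_X * ?c = 2 * pi * (sqrt (5 / 6) * sqrt 3 / sqrt (5 * pi))"
        using const_X_pos by simp
      also have "sqrt (5 / 6) * sqrt 3 / sqrt (5 * pi) = sqrt (5 / 6 * 3 / (5 * pi))"
        by (simp only: real_sqrt_mult real_sqrt_divide)
      also have "5 / 6 * 3 / (5 * pi) = 1 / (2 * pi)" by simp
      also have "2 * pi * sqrt (1 / (2 * pi)) = sqrt (2 * pi)"
        unfolding real_sqrt_divide using pp by (simp add: field_simps)
      finally show ?thesis .
    qed
    have "(\<lambda>n. 2 * pi * \<sigma> n * P n / (\<sigma> n / real n powr (4 / 5) * ?c)) \<longlonglongrightarrow> sqrt (2 * pi) / (sqrt (5 / 6) / const_X * ?c)"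
      using const_X_pos unfolding \<sigma>_def by (intro tendsto_divide tendsto_mult lim[unfolded \<sigma>_def] tendsto_const sigma_seq_asymp) auto
    then show "(\<lambda>n. 2 * pi * \<sigma> n * P n / (\<sigma> n / real n powr (4 / 5) * ?c)) \<longlonglongrightarrow> 1"
      unfolding k using pp by simp
    show "\<forall>\<^sub>F n in sequentially. 2 * pi * \<sigma> n * P n / (\<sigma> n / real n powr (4 / 5) * ?c) =
        P n / (sqrt 3 * const_X / sqrt (5 * pi) * real n powr (- 4 / 5))"
      using t_seq_pos eventually_gt_at_top[of 0]
    proof eventually_elim
      case (elim n)
      have s: "\<sigma> n > 0" using var_N_pos[OF elim(1)] by (simp add: \<sigma>_def)
      have m: "real n powr (- 4 / 5) = 1 / real n powr (4 / 5)"
        using powr_minus_divide[of "real n" "4 / 5"] by simp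
      have "2 * pi * \<sigma> n * P n / (\<sigma> n / y * (2 * pi * z)) = P n / (z * (1 / y))" if "y > 0" "z > 0" for y z
        using that s by (simp add: field_simps)
      from this[of "real n powr (4 / 5)" "sqrt 3 * const_X / sqrt (5 * pi)"]
      show ?case unfolding m using elim const_X_pos by simp
    qed
  qed
  then show "P \<sim>[at_top] (\<lambda>n. sqrt 3 * const_X / sqrt (5 * pi) * real n powr (- 4 / 5))"
    by (rule asymp_equivI')
qed

end
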